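(* Let $N\ge 2$ and $f$ be as in the context. There exists $R_0>0$ (depending only on $N$ and $f$) such that for every $\Omega$ as in the context, if $\mathbb{R}\times B'_R\subset\Omega$ for some $R>R_0$, then the unique entire solution $u$ associated with $\Omega$ (see context) propagates along the $x_1$-axis, that is, $$u(t,\cdot)\to u_\infty\ \text{ in }\Omega\ \text{ as }t\to+\infty,\qquad\text{with}\quad \inf_{\mathbb{R}\times B'_R}u_\infty>0.$$
   Context: Points of $\mathbb{R}^N$ are written $x=(x_1,x')$ with $x_1\in\mathbb{R}$, $x'\in\mathbb{R}^{N-1}$. $B'_R$ is the open ball of radius $R$ centred at $0$ in $\mathbb{R}^{N-1}$; $\nu$ is the outward unit normal of $\Omega$. Domain: $\Omega\subset\mathbb{R}^N$ is an unbounded, uniformly $C^{2,\alpha}$ domain such that $\Omega\cap\{x_1<0\}=(-\infty,0)\times\omega$ for an open set $\omega\subset\mathbb{R}^{N-1}$. Nonlinearity: $f\in C^{1,1}([0,1])$ and there is $\theta\in(0,1)$ with $f(0)=f(\theta)=f(1)=0$, $f'(0)<0$, $f'(1)<0$, $f<0$ on $(0,\theta)$, $f>0$ on $(\theta,1)$; moreover $\int_0^1 f(s)\,ds>0$. Travelling front: $(\varphi,c)$, with $c>0$, is the unique solution of $\varphi''+c\varphi'+f(\varphi)=0$ in $\mathbb{R}$, $\varphi(-\infty)=1$, $\varphi(+\infty)=0$, $\varphi(0)=\theta$. Solution $u$: $u$ is the unique entire solution (defined for all $t\in\mathbb{R}$, with $0<u<1$) of $\partial_t u-\Delta u=f(u)$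 in $\mathbb{R}\times\Omega$, $\partial_\nu u=0$ on $\mathbb{R}\times\partial\Omega$, such that $u(t,x)-\varphi(x_1-ct)\to0$ as $t\to-\infty$ uniformly in $\overline\Omega$. It is increasing in $t$, and $u_\infty:=\lim_{t\to+\infty}u(t,\cdot)$ (limit in $C^2_{loc}(\Omega)$) is a stationary solution. *)

theory Defs
  imports "HOL-Analysis.Analysis"
begin

(* R^N is rendered as real \<times> real^'n, so N = CARD('n) + 1 ranges over all N \<ge> 2, and
   x = (x1, x') has x1 = fst x and x' = snd x. *)

definition bistable :: "(real \<Rightarrow> real) \<Rightarrow> real \<Rightarrow> bool" where
  "bistable f \<theta> \<longleftrightarrow>
     0 < \<theta> \<and> \<theta> < 1 \<and>
     (\<exists>f' L. (\<forall>s\<in>{0..1}. (f has_real_derivative f' s) (at s within {0..1})) \<and>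
             L-lipschitz_on {0..1} f' \<and> f' 0 < 0 \<and> f' 1 < 0) \<and>
     f 0 = 0 \<and> f \<theta> = 0 \<and> f 1 = 0 \<and>
     (\<forall>s. 0 < s \<and> s < \<theta> \<longrightarrow> f s < 0) \<and>
     (\<forall>s. \<theta> < s \<and> s < 1 \<longrightarrow> 0 < f s) \<and>
     0 < integral {0..1} f"

(* Only the values of f on [0,1] are meaningful, hence the range condition on \<phi>. *)
definition travelling_front ::
    "(real \<Rightarrow> real) \<Rightarrow> real \<Rightarrow> (real \<Rightarrow> real) \<Rightarrow> real \<Rightarrow> bool" where
  "travelling_front f \<theta> \<phi> c \<longleftrightarrow>
     0 < c \<and> (\<forall>z. 0 \<le> \<phi> z \<and> \<phi> z \<le> 1) \<and>
     (\<exists>\<phi>' \<phi>''. \<forall>z. (\<phi> has_real_derivative \<phi>' z) (at z) \<and>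
                   (\<phi>' has_real_derivative \<phi>'' z) (at z) \<and>
                   \<phi>'' z + c * \<phi>' z + f (\<phi> z) = 0) \<and>
     (\<phi> \<longlongrightarrow> 1) at_bot \<and> (\<phi> \<longlongrightarrow> 0) at_top \<and> \<phi> 0 = \<theta>"

(* Intended for open S: G is the gradient of g on S and H its Hessian, as an endomorphism. *)
definition has_grad_hess ::
    "('a::euclidean_space \<Rightarrow> real) \<Rightarrow> ('a \<Rightarrow> 'a) \<Rightarrow> ('a \<Rightarrow> 'a \<Rightarrow>\<^sub>L 'a) \<Rightarrow> 'a set \<Rightarrow> bool" where
  "has_grad_hess g G H S \<longleftrightarrow>
     (\<forall>x\<in>S. (GDERIV g x :> G x) \<and> (G has_derivative blinfun_apply (H x)) (at x))"

definition trace_of :: "('a::euclidean_space \<Rightarrow>\<^sub>L 'a) \<Rightarrow> real" where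
  "trace_of A = (\<Sum>b\<in>Basis. blinfun_apply A b \<bullet> b)"

(* K bounds each of sup |g|, sup |Dg|, sup |D^2 g| and the \<alpha>-Hoelder seminorm of D^2 g. *)
definition C2_holder_bounded ::
    "real \<Rightarrow> real \<Rightarrow> 'a::euclidean_space set \<Rightarrow> ('a \<Rightarrow> real) \<Rightarrow> bool" where
  "C2_holder_bounded \<alpha> K S g \<longleftrightarrow>
     (\<exists>G H. has_grad_hess g G H S \<and>
        (\<forall>x\<in>S. \<bar>g x\<bar> \<le> K \<and> norm (G x) \<le> K \<and> norm (H x) \<le> K) \<and>
        (\<forall>x\<in>S. \<forall>y\<in>S. norm (H x - H y) \<le> K * norm (x - y) powr \<alpha>))"

(* Near each boundary point p, in orthonormal coordinates (s, y) centred at p, the set is exactly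
   the epigraph of a C^{2,\<alpha>} function; uniformity: the size r of the coordinate
   cylinder and the bound K are the same for all p. *)
definition uniformly_C2_holder :: "real \<Rightarrow> (real \<times> (real^'n)) set \<Rightarrow> bool" where
  "uniformly_C2_holder \<alpha> \<Omega> \<longleftrightarrow>
     (\<exists>r>0. \<exists>K>0. \<forall>p\<in>frontier \<Omega>.
        \<exists>(T :: real \<times> (real^'n) \<Rightarrow> real \<times> (real^'n)) (\<psi> :: real^'n \<Rightarrow> real).
        orthogonal_transformation T \<and>
        C2_holder_bounded \<alpha> K (ball 0 r) \<psi> \<and> \<psi> 0 = 0 \<and>
        (\<forall>s y. \<bar>s\<bar> < r \<and> norm y < r \<longrightarrow> (p + T (s, y) \<in> \<Omega> \<longleftrightarrow> \<psi> y < s)))"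

definition admissible_domain ::
    "real \<Rightarrow> (real \<times> (real^'n)) set \<Rightarrow> (real^'n) set \<Rightarrow> bool" where
  "admissible_domain \<alpha> \<Omega> \<omega> \<longleftrightarrow>
     open \<Omega> \<and> connected \<Omega> \<and> \<Omega> \<noteq> {} \<and> \<not> bounded \<Omega> \<and>
     uniformly_C2_holder \<alpha> \<Omega> \<and>
     open \<omega> \<and> \<Omega> \<inter> {x. fst x < 0} = {..<0} \<times> \<omega>"

(* Via a C^1 function \<rho> that defines the set near p as {\<rho> < 0}: the normal is the normalised
   gradient of \<rho> at p (the library's sgn v is v / |v|). *)
definition outward_unit_normal ::
    "'a::euclidean_space set \<Rightarrow> 'a \<Rightarrow> 'a \<Rightarrow> bool" where
  "outward_unit_normal \<Omega> p \<nu> \<longleftrightarrow>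
     p \<in> frontier \<Omega> \<and>
     (\<exists>r>0. \<exists>\<rho> G. (\<forall>x\<in>ball p r. GDERIV \<rho> x :> G x) \<and> continuous_on (ball p r) G \<and>
        G p \<noteq> 0 \<and> \<Omega> \<inter> ball p r = {x \<in> ball p r. \<rho> x < 0} \<and> \<nu> = sgn (G p))"

(* Classical solutions, for all t \<in> R, of u_t - \<Delta> u = f(u) in \<Omega> with zero Neumann condition:
   C^1 in t and C^2 in x inside, with u and its spatial gradient continuous up to the boundary,
   so that on the boundary G t is the continuous extension of the gradient. *)
definition neumann_solution ::
    "(real \<Rightarrow> real) \<Rightarrow> 'a::euclidean_space set \<Rightarrow> (real \<Rightarrow> 'a \<Rightarrow> real) \<Rightarrow> bool" where
  "neumann_solution f \<Omega> u \<longleftrightarrow>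
     (\<forall>t. \<forall>x\<in>closure \<Omega>. 0 \<le> u t x \<and> u t x \<le> 1) \<and>
     (\<exists>u_t G H.
        continuous_on (UNIV \<times> closure \<Omega>) (\<lambda>(t, x). u t x) \<and>
        continuous_on (UNIV \<times> closure \<Omega>) (\<lambda>(t, x). G t x) \<and>
        continuous_on (UNIV \<times> \<Omega>) (\<lambda>(t, x). u_t t x) \<and>
        continuous_on (UNIV \<times> \<Omega>) (\<lambda>(t, x). H t x) \<and>
        (\<forall>t. \<forall>x\<in>\<Omega>. ((\<lambda>\<tau>. u \<tau> x) has_real_derivative u_t t x) (at t)) \<and>
        (\<forall>t. has_grad_hess (u t) (G t) (H t) \<Omega>) \<and>
        (\<forall>t. \<forall>x\<in>\<Omega>. u_t t x - trace_of (H t x) = f (u t x)) \<and>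
        (\<forall>t p \<nu>. outward_unit_normal \<Omega> p \<nu> \<longrightarrow> G t p \<bullet> \<nu> = 0))"

definition entire_solution_from_front ::
    "(real \<Rightarrow> real) \<Rightarrow> (real \<Rightarrow> real) \<Rightarrow> real \<Rightarrow> (real \<times> (real^'n)) set \<Rightarrow>
     (real \<Rightarrow> real \<times> (real^'n) \<Rightarrow> real) \<Rightarrow> bool" where
  "entire_solution_from_front f \<phi> c \<Omega> u \<longleftrightarrow>
     neumann_solution f \<Omega> u \<and>
     (\<forall>t. \<forall>x\<in>closure \<Omega>. 0 < u t x \<and> u t x < 1) \<and>
     uniform_limit (closure \<Omega>) (\<lambda>t x. u t x - \<phi> (fst x - c * t)) (\<lambda>_. 0) at_bot"

definition stationary_solution ::
    "(real \<Rightarrow> real) \<Rightarrow> 'a::euclidean_space set \<Rightarrow> ('a \<Rightarrow> real) \<Rightarrow> bool" where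
  "stationary_solution f \<Omega> v \<longleftrightarrow> neumann_solution f \<Omega> (\<lambda>_. v)"

(* u(t,.) \<rightarrow> v in C^2_loc(\<Omega>) as t \<rightarrow> +\<infinity> *)
definition tendsto_C2_loc ::
    "'a::euclidean_space set \<Rightarrow> (real \<Rightarrow> 'a \<Rightarrow> real) \<Rightarrow> ('a \<Rightarrow> real) \<Rightarrow> bool" where
  "tendsto_C2_loc \<Omega> u v \<longleftrightarrow>
     (\<exists>G H Gv Hv.
        (\<forall>t. has_grad_hess (u t) (G t) (H t) \<Omega> \<and> continuous_on \<Omega> (H t)) \<and>
        has_grad_hess v Gv Hv \<Omega> \<and> continuous_on \<Omega> Hv \<and>
        (\<forall>C. compact C \<and> C \<subseteq> \<Omega> \<longrightarrow>
           uniform_limit C u v at_top \<and> uniform_limit C G Gv at_top \<and>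
           uniform_limit C H Hv at_top))"

end

theory Submission
  imports Defs
begin

text \<open>
Every estimate for the parabolic problem is an application of the maximum principle, in the elementary
form \<open>parabolic_max_principle\<close>: at a positive maximum over a compact part of space-time, \<open>\<partial>\<^sub>t - \<Delta>\<close>
cannot be negative.

The solution propagates for a simple reason. The front \<open>\<phi>\<close> of \<open>f\<close>, lowered by a small constant \<open>\<eta>\<close> and
bent around a point, becomes a bump that is positive only on a ball of some radius \<open>R0\<close>, and that
stays a strict subsolution even while its centre moves slowly to the right
(\<open>moving_subsolution\<close>): the speed \<open>c > 0\<close> leaves room for the curvature and for the slow motion where \<open>\<phi>\<close>
is steep, and \<open>f' < 0\<close> at \<open>0\<close> and \<open>1\<close> leaves room on the tails. For very negative times
\<open>u\<close> is close to \<open>1\<close> far to the left, so the bump fits below it there, and it stays below while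
it is carried along the cylinder (\<open>moving_subsolution_below\<close>). The ball may stick out of the cylinder
slightly: where it meets the boundary of the domain the two are almost tangent, so the bump has the
sign of the normal derivative that the Neumann condition tolerates. This is what makes the
lower bound uniform up to the edge of the cylinder.

For the limit one needs that \<open>u\<close> increases in time (\<open>increasing_in_time\<close>). For very negative times,
\<open>u(t) - u(t + h)\<close> can be positive only where both functions are close to \<open>0\<close> or both are close to \<open>1\<close>;
there \<open>f\<close> decreases, so this difference decays exponentially from arbitrarily early times and is
not positive. The comparison principle for the Neumann problem in the unbounded domain
(\<open>neumann_comparison\<close>) then gives all later times.

The limit is \<open>C\<^sup>2\<close> inside and \<open>C\<^sup>1\<close> up to the boundary because \<open>u\<close>, its gradient and its Hessian are
equicontinuous in \<open>x\<close> uniformly in \<open>t\<close>. Inside, one estimate of the gradient by the size of the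
function and of \<open>\<partial>\<^sub>t - \<Delta>\<close> (\<open>interior_gradient_estimate\<close>) is applied to \<open>u\<close> and to
its first and second differences; since \<open>f'\<close> is Lipschitz, this bounds the Lipschitz constants of the
gradient and of the Hessian. At the boundary, the derivative of \<open>u\<close> in the normal direction at \<open>p\<close> vanishes
at \<open>p\<close> and, because the normal is Lipschitz, is at most a multiple of the distance to \<open>p\<close> on the boundary.
A square-root barrier spreads this bound inside (\<open>dirichlet_barrier\<close>), and the interior
estimate turns it into a modulus of continuity of the gradient along normals
(\<open>normal_modulus\<close>). It is proportional to a local bound of the gradient itself, which is
removed by weighting the gradient with a cutoff and looking at the maximum
(\<open>global_gradient_bound\<close>).

The uniform regularity of the domain enters as a two-sided tangent ball condition
(\<open>two_sided_ball\<close>), which implies at once that the normal is Lipschitz.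
\<close>

section \<open>Laplacian and heat operator at a point\<close>

text \<open>The value of the Laplacian at one point, for functions that need be differentiable only near that
point. A relation carries the existence of the derivatives along, so that barriers are assembled by
introduction rules.\<close>

definition lap_at :: "('a::euclidean_space \<Rightarrow> real) \<Rightarrow> 'a \<Rightarrow> real \<Rightarrow> bool" where
  "lap_at g x l \<longleftrightarrow> (\<exists>G H. (\<forall>\<^sub>F y in nhds x. GDERIV g y :> G y) \<and>
     (G has_derivative H) (at x) \<and> l = (\<Sum>b\<in>Basis. H b \<bullet> b))"

definition heat_at :: "(real \<Rightarrow> 'a::euclidean_space \<Rightarrow> real) \<Rightarrow> real \<Rightarrow> 'a \<Rightarrow> real \<Rightarrow> bool" where
  "heat_at w t x s \<longleftrightarrow> (\<exists>a l. ((\<lambda>\<tau>. w \<tau> x) has_real_derivative a) (at t) \<and> lap_at (w t) x l \<and> s = a - l)"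

lemma lap_atI:
  assumes "\<forall>\<^sub>F y in nhds x. GDERIV g y :> G y" "(G has_derivative H) (at x)" "l = (\<Sum>b\<in>Basis. H b \<bullet> b)"
  shows "lap_at g x l"
  using assms unfolding lap_at_def by blast

lemma lap_at_add:
  assumes "lap_at g x l" "lap_at h x k"
  shows "lap_at (\<lambda>y. g y + h y) x (l + k)"
proof -
  obtain G H where g: "\<forall>\<^sub>F y in nhds x. GDERIV g y :> G y" "(G has_derivative H) (at x)" "l = (\<Sum>b\<in>Basis. H b \<bullet> b)"
    using assms(1) unfolding lap_at_def by blast
  obtain G' H' where h: "\<forall>\<^sub>F y in nhds x. GDERIV h y :> G' y" "(G' has_derivative H') (at x)" "k = (\<Sum>b\<in>Basis. H' b \<bullet> b)"
    using assms(2) unfolding lap_at_def by blast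
  show ?thesis
  proof (rule lap_atI)
    show "\<forall>\<^sub>F y in nhds x. GDERIV (\<lambda>y. g y + h y) y :> G y + G' y"
      using g(1) h(1) by eventually_elim (rule GDERIV_add)
    show "((\<lambda>y. G y + G' y) has_derivative (\<lambda>v. H v + H' v)) (at x)"
      by (intro has_derivative_add g h)
    show "l + k = (\<Sum>b\<in>Basis. (H b + H' b) \<bullet> b)"
      by (simp add: g h inner_add_left sum.distrib)
  qed
qed

lemma lap_at_cmult:
  assumes "lap_at g x l"
  shows "lap_at (\<lambda>y. c * g y) x (c * l)"
proof -
  obtain G H where g: "\<forall>\<^sub>F y in nhds x. GDERIV g y :> G y" "(G has_derivative H) (at x)" "l = (\<Sum>b\<in>Basis. H b \<bullet> b)"
    using assms(1) unfolding lap_at_def by blast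
  show ?thesis
  proof (rule lap_atI)
    show "\<forall>\<^sub>F y in nhds x. GDERIV (\<lambda>y. c * g y) y :> c *\<^sub>R G y"
      using g(1)
    proof eventually_elim
      case (elim y)
      from GDERIV_mult[OF GDERIV_const elim, of c] show ?case by simp
    qed
    show "((\<lambda>y. c *\<^sub>R G y) has_derivative (\<lambda>v. c *\<^sub>R H v)) (at x)"
      by (intro has_derivative_scaleR_right g)
    show "c * l = (\<Sum>b\<in>Basis. (c *\<^sub>R H b) \<bullet> b)"
      by (simp add: g sum_distrib_left)
  qed
qed

lemma lap_at_diff:
  assumes "lap_at g x l" "lap_at h x k"
  shows "lap_at (\<lambda>y. g y - h y) x (l - k)"
  using lap_at_add[OF assms(1) lap_at_cmult[OF assms(2), of "-1"]] by simp

lemma lap_at_const: "lap_at (\<lambda>y. c) x 0"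
  by (rule lap_atI[where G = "\<lambda>_. 0" and H = "\<lambda>_. 0"]) (auto simp: GDERIV_const)

lemma lap_at_inner: "lap_at (\<lambda>y. (y - c) \<bullet> m) x 0"
  by (rule lap_atI[where G = "\<lambda>_. m" and H = "\<lambda>_. 0"])
     (auto simp: gderiv_def intro!: derivative_eq_intros always_eventually)

lemma lap_at_inner_sq: "lap_at (\<lambda>y. ((y - c) \<bullet> m)\<^sup>2) x (2 * (m \<bullet> m))"
proof (rule lap_atI[where G = "\<lambda>y. (2 * ((y - c) \<bullet> m)) *\<^sub>R m" and H = "\<lambda>v. (2 * (v \<bullet> m)) *\<^sub>R m"])
  show "\<forall>\<^sub>F y in nhds x. GDERIV (\<lambda>y. ((y - c) \<bullet> m)\<^sup>2) y :> (2 * ((y - c) \<bullet> m)) *\<^sub>R m"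
    by (auto simp: gderiv_def algebra_simps intro!: always_eventually derivative_eq_intros)
  show "((\<lambda>y. (2 * ((y - c) \<bullet> m)) *\<^sub>R m) has_derivative (\<lambda>v. (2 * (v \<bullet> m)) *\<^sub>R m)) (at x)"
    by (auto intro!: derivative_eq_intros)
  have "m \<bullet> m = (\<Sum>b\<in>Basis. (m \<bullet> b) * (m \<bullet> b))" by (rule euclidean_inner)
  then show "2 * (m \<bullet> m) = (\<Sum>b\<in>Basis. (2 * (b \<bullet> m)) *\<^sub>R m \<bullet> b)"
    by (simp add: sum_distrib_left inner_commute algebra_simps)
qed

text \<open>All radial barriers are written as functions of the squared distance, which is smooth at the centre.\<close>

lemma lap_at_comp_sq:
  fixes g :: "real \<Rightarrow> real" and x c :: "'a::euclidean_space"
  assumes g1: "\<forall>\<^sub>F s in nhds ((x - c) \<bullet> (x - c)). (g has_real_derivative g1 s) (at s)"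
    and g2: "(g1 has_real_derivative g2) (at ((x - c) \<bullet> (x - c)))"
  shows "lap_at (\<lambda>y. g ((y - c) \<bullet> (y - c))) x
    (4 * g2 * ((x - c) \<bullet> (x - c)) + 2 * real DIM('a) * g1 ((x - c) \<bullet> (x - c)))"
proof -
  let ?q = "\<lambda>y. (y - c) \<bullet> (y - c)"
  let ?G = "\<lambda>y. (2 * g1 (?q y)) *\<^sub>R (y - c)"
  let ?H = "\<lambda>v. (4 * g2 * (v \<bullet> (x - c))) *\<^sub>R (x - c) + (2 * g1 (?q x)) *\<^sub>R v"
  have cont: "(?q \<longlongrightarrow> ?q x) (nhds x)"
    by (intro tendsto_intros filterlim_ident)
  have ev: "\<forall>\<^sub>F y in nhds x. (g has_real_derivative g1 (?q y)) (at (?q y))"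
    using eventually_compose_filterlim[OF g1 cont] .
  have dq: "(?q has_derivative (\<lambda>v. 2 * (v \<bullet> (y - c)))) (at y)" for y
    by (auto intro!: derivative_eq_intros simp: inner_commute)
  show ?thesis
  proof (rule lap_atI[where G = ?G and H = ?H])
    show "\<forall>\<^sub>F y in nhds x. GDERIV (\<lambda>y. g (?q y)) y :> ?G y"
      using ev
    proof eventually_elim
      case (elim y)
      have "GDERIV ?q y :> (2 *\<^sub>R (y - c))"
        using dq[of y] by (simp add: gderiv_def inner_commute)
      from GDERIV_DERIV_compose[OF this elim] show ?case by (simp add: algebra_simps)
    qed
    have "((\<lambda>y. g1 (?q y)) has_derivative (\<lambda>v. g2 * (2 * (v \<bullet> (x - c))))) (at x)"
      using has_derivative_compose[OF dq[of x], of g1 "\<lambda>v. g2 * v"] g2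
      by (simp add: has_field_derivative_def)
    from this show "(?G has_derivative ?H) (at x)"
      by (auto intro!: derivative_eq_intros simp: algebra_simps)
    have 1: "(x - c) \<bullet> (x - c) = (\<Sum>b\<in>Basis. ((x - c) \<bullet> b) * ((x - c) \<bullet> b))" by (rule euclidean_inner)
    have "(\<Sum>b\<in>Basis. ?H b \<bullet> b) = (\<Sum>b\<in>Basis. 4 * g2 * (((x - c) \<bullet> b) * ((x - c) \<bullet> b)) + 2 * g1 (?q x))"
    proof (intro sum.cong refl)
      fix b :: 'a assume b: "b \<in> Basis"
      have "b \<bullet> (x - c) = (x - c) \<bullet> b" by (rule inner_commute)
      then show "?H b \<bullet> b = 4 * g2 * (((x - c) \<bullet> b) * ((x - c) \<bullet> b)) + 2 * g1 (?q x)"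
        using b by (simp add: inner_add_left)
    qed
    also have "\<dots> = 4 * g2 * (\<Sum>b\<in>Basis. ((x - c) \<bullet> b) * ((x - c) \<bullet> b)) + 2 * real DIM('a) * g1 (?q x)"
      by (simp add: sum.distrib sum_distrib_left)
    finally show "4 * g2 * ?q x + 2 * real DIM('a) * g1 (?q x) = (\<Sum>b\<in>Basis. ?H b \<bullet> b)"
      using 1 by simp
  qed
qed

lemma lap_at_sq: "lap_at (\<lambda>y. (y - c) \<bullet> (y - c)) (x::'a::euclidean_space) (2 * real DIM('a))"
  using lap_at_comp_sq[of "\<lambda>s. s" "\<lambda>_. 1" x c 0] by simp

lemma lap_at_translate:
  assumes "lap_at g (x + h) l"
  shows "lap_at (\<lambda>y. g (y + h)) x l"
proof -
  obtain G H where g: "\<forall>\<^sub>F y in nhds (x+h). GDERIV g y :> G y" "(G has_derivative H) (at (x+h))" "l = (\<Sum>b\<in>Basis. H b \<bullet> b)"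
    using assms(1) unfolding lap_at_def by blast
  have d: "((\<lambda>y. y + h) has_derivative (\<lambda>v. v)) (at y)" for y
    by (auto intro!: derivative_eq_intros)
  have "((\<lambda>y. y + h) \<longlongrightarrow> x + h) (nhds x)"
    by (intro tendsto_intros filterlim_ident)
  from eventually_compose_filterlim[OF g(1) this]
  have ev: "\<forall>\<^sub>F y in nhds x. GDERIV g (y+h) :> G (y+h)" .
  show ?thesis
  proof (rule lap_atI)
    show "\<forall>\<^sub>F y in nhds x. GDERIV (\<lambda>y. g (y + h)) y :> G (y + h)"
      using ev by eventually_elim (use has_derivative_compose[OF d] in \<open>auto simp: gderiv_def\<close>)
    show "((\<lambda>y. G (y + h)) has_derivative H) (at x)"
      using has_derivative_compose[OF d g(2)] by simp
  qed (fact g)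
qed

definition reflect :: "'a::euclidean_space \<Rightarrow> 'a \<Rightarrow> 'a \<Rightarrow> 'a" where
  "reflect x0 b y = y - (2 * ((y - x0) \<bullet> b)) *\<^sub>R b"

text \<open>Reflecting a coordinate axis only changes the sign of basis vectors, so that the trace of the
Hessian can be compared term by term.\<close>

lemma lap_at_reflect:
  assumes b: "b \<in> Basis" and "lap_at g (reflect x0 b x) l"
  shows "lap_at (\<lambda>y. g (reflect x0 b y)) x l"
proof -
  define s where "s h = h - (2 * (h \<bullet> b)) *\<^sub>R b" for h
  have ssym: "s v \<bullet> w = v \<bullet> s w" for v w
    by (simp add: s_def algebra_simps inner_commute)
  obtain G H where g: "\<forall>\<^sub>F y in nhds (reflect x0 b x). GDERIV g y :> G y" "(G has_derivative H) (at (reflect x0 b x))" "l = (\<Sum>b\<in>Basis. H b \<bullet> b)"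
    using assms(2) unfolding lap_at_def by blast
  have d: "(reflect x0 b has_derivative s) (at y)" for y
    unfolding reflect_def s_def by (auto intro!: derivative_eq_intros)
  have sl: "bounded_linear s" using d has_derivative_bounded_linear by blast
  have "(reflect x0 b \<longlongrightarrow> reflect x0 b x) (nhds x)"
    unfolding reflect_def by (intro tendsto_intros filterlim_ident)
  from eventually_compose_filterlim[OF g(1) this]
  have ev: "\<forall>\<^sub>F y in nhds x. GDERIV g (reflect x0 b y) :> G (reflect x0 b y)" .
  have Hl: "linear H" using g(2) has_derivative_linear by blast
  show ?thesis
  proof (rule lap_atI)
    show "\<forall>\<^sub>F y in nhds x. GDERIV (\<lambda>y. g (reflect x0 b y)) y :> s (G (reflect x0 b y))"
      using ev
    proof eventually_elim
      case (elim y)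
      then show ?case
        using has_derivative_compose[OF d[of y], of g "\<lambda>h. h \<bullet> G (reflect x0 b y)"]
        by (simp add: gderiv_def ssym)
    qed
    show "((\<lambda>y. s (G (reflect x0 b y))) has_derivative (\<lambda>v. s (H (s v)))) (at x)"
      by (rule bounded_linear.has_derivative[OF sl]) (rule has_derivative_compose[OF d g(2)])
    have "H (s c) \<bullet> s c = H c \<bullet> c" if "c \<in> Basis" for c
    proof (cases "c = b")
      case True
      then have "s c = - c" using b by (simp add: s_def inner_Basis scaleR_2)
      then show ?thesis by (simp add: linear_neg[OF Hl])
    next
      case False
      then have "s c = c" using b that by (simp add: s_def inner_Basis)
      then show ?thesis by simp
    qed
    then show "l = (\<Sum>c\<in>Basis. s (H (s c)) \<bullet> c)"
      by (simp add: ssym g)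
  qed
qed

text \<open>In each coordinate direction a positive second derivative would make the first derivative, which
vanishes at the maximum, positive just after it.\<close>

lemma lap_at_local_max:
  assumes "lap_at g x l" and mx: "\<forall>\<^sub>F y in nhds x. g y \<le> g x"
  shows "l \<le> 0"
proof -
  obtain G H where g: "\<forall>\<^sub>F y in nhds x. GDERIV g y :> G y" "(G has_derivative H) (at x)" "l = (\<Sum>b\<in>Basis. H b \<bullet> b)"
    using assms(1) unfolding lap_at_def by blast
  from g(1) mx have "\<forall>\<^sub>F y in nhds x. GDERIV g y :> G y \<and> g y \<le> g x" by eventually_elim simp
  then obtain e where e: "e > 0" "\<And>y. dist y x < e \<Longrightarrow> GDERIV g y :> G y \<and> g y \<le> g x"
    unfolding eventually_nhds_metric by blast
  have "H b \<bullet> b \<le> 0" if b: "b \<in> Basis" for b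
  proof (rule ccontr)
    assume "\<not> H b \<bullet> b \<le> 0"
    then have pos: "H b \<bullet> b > 0" by simp
    let ?l = "\<lambda>s::real. x + s *\<^sub>R b"
    have dl: "(?l has_derivative (\<lambda>s. s *\<^sub>R b)) (at s)" for s
      by (auto intro!: derivative_eq_intros)
    have dist: "dist (?l s) x < e" if "\<bar>s\<bar> < e" for s
      using that b by (simp add: dist_norm)
    have d1: "((\<lambda>s. g (?l s)) has_real_derivative (G (?l s) \<bullet> b)) (at s)" if "\<bar>s\<bar> < e" for s
      using has_derivative_compose[OF dl[of s], of g "\<lambda>h. h \<bullet> G (?l s)"] e(2)[OF dist[OF that]]
      by (simp add: gderiv_def has_field_derivative_def inner_commute mult_commute_abs[of "b \<bullet> _"])
    have "((\<lambda>s. G (?l s)) has_derivative (\<lambda>s. H (s *\<^sub>R b))) (at 0)"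
      using has_derivative_compose[OF dl[of 0], of G H] g(2) by simp
    then have "((\<lambda>s. G (?l s) \<bullet> b) has_derivative (\<lambda>s. H (s *\<^sub>R b) \<bullet> b)) (at 0)"
      by (rule has_derivative_inner_left)
    moreover have "H (s *\<^sub>R b) \<bullet> b = (H b \<bullet> b) * s" for s
      using linear_scale[OF has_derivative_linear[OF g(2)]] by (simp)
    ultimately have d2: "((\<lambda>s. G (?l s) \<bullet> b) has_real_derivative (H b \<bullet> b)) (at 0)"
      by (simp add: has_field_derivative_def fun_eq_iff)
    have G0: "G (?l 0) \<bullet> b = 0"
      by (rule DERIV_local_max[OF d1[of 0], of e]) (use e(1) e(2)[OF dist] in \<open>auto\<close>)
    obtain d where d: "d > 0" "\<And>h. 0 < h \<Longrightarrow> h < d \<Longrightarrow> G (?l 0) \<bullet> b < G (?l (0 + h)) \<bullet> b"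
      using DERIV_pos_inc_right[OF d2 pos] by blast
    define h where "h = min d e / 2"
    have h: "0 < h" "h < d" "h < e" using d e(1) by (auto simp: h_def)
    have "g (?l 0) < g (?l h)"
    proof (rule DERIV_pos_imp_increasing_open[OF h(1)])
      fix s assume s: "0 < s" "s < h"
      then show "\<exists>y. ((\<lambda>s. g (?l s)) has_real_derivative y) (at s) \<and> 0 < y"
        using d1[of s] d(2)[of s] h G0 by auto
    next
      show "continuous_on {0..h} (\<lambda>s. g (?l s))"
        using h by (intro continuous_at_imp_continuous_on ballI DERIV_isCont[OF d1]) auto
    qed
    with e(2)[OF dist[of h]] h show False by simp
  qed
  then show ?thesis unfolding g(3) by (intro sum_nonpos) auto
qed

lemma lap_at_grad_hess:
  assumes "has_grad_hess g G H S" "open S" "x \<in> S"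
  shows "lap_at g x (trace_of (H x))"
proof (rule lap_atI)
  show "\<forall>\<^sub>F y in nhds x. GDERIV g y :> G y"
    using assms unfolding has_grad_hess_def eventually_nhds by blast
qed (use assms in \<open>auto simp: has_grad_hess_def trace_of_def\<close>)

lemma heat_at_diff:
  assumes "heat_at v t x s" "heat_at w t x r"
  shows "heat_at (\<lambda>t x. v t x - w t x) t x (s - r)"
proof -
  obtain a l where 1: "((\<lambda>\<tau>. v \<tau> x) has_real_derivative a) (at t)" "lap_at (v t) x l" "s = a - l"
    using assms(1) unfolding heat_at_def by blast
  obtain b k where 2: "((\<lambda>\<tau>. w \<tau> x) has_real_derivative b) (at t)" "lap_at (w t) x k" "r = b - k"
    using assms(2) unfolding heat_at_def by blast
  show ?thesis unfolding heat_at_def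
    by (rule exI[of _ "a - b"], rule exI[of _ "l - k"]) (use 1 2 in \<open>auto intro: DERIV_diff lap_at_diff\<close>)
qed

lemma heat_at_cmult:
  assumes "heat_at v t x s"
  shows "heat_at (\<lambda>t x. c * v t x) t x (c * s)"
proof -
  obtain a l where 1: "((\<lambda>\<tau>. v \<tau> x) has_real_derivative a) (at t)" "lap_at (v t) x l" "s = a - l"
    using assms(1) unfolding heat_at_def by blast
  show ?thesis unfolding heat_at_def
    by (rule exI[of _ "c * a"], rule exI[of _ "c * l"])
       (use 1 in \<open>auto intro: DERIV_cmult lap_at_cmult simp: right_diff_distrib\<close>)
qed

text \<open>Shifts in space are the case \<open>\<tau> = 0\<close>; differences in space are written with \<open>u (t + 0)\<close> below to match.\<close>

lemma heat_at_translate: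
  assumes "heat_at v (t + \<tau>) (x + h) s"
  shows "heat_at (\<lambda>t x. v (t + \<tau>) (x + h)) t x s"
proof -
  obtain a l where 1: "((\<lambda>\<tau>. v \<tau> (x+h)) has_real_derivative a) (at (t + \<tau>))" "lap_at (v (t + \<tau>)) (x+h) l" "s = a - l"
    using assms(1) unfolding heat_at_def by blast
  show ?thesis unfolding heat_at_def
    by (rule exI[of _ a], rule exI[of _ l])
       (use 1 in \<open>auto intro: lap_at_translate simp: DERIV_shift\<close>)
qed

lemma heat_at_reflect:
  assumes "b \<in> Basis" "heat_at v t (reflect x0 b x) s"
  shows "heat_at (\<lambda>t x. v t (reflect x0 b x)) t x s"
  using assms unfolding heat_at_def by (auto intro: lap_at_reflect)

lemma heat_at_time_mult:
  assumes "heat_at w t x s" "(a has_real_derivative a') (at t)"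
  shows "heat_at (\<lambda>t x. a t * w t x) t x (a' * w t x + a t * s)"
proof -
  obtain b l where 1: "((\<lambda>\<tau>. w \<tau> x) has_real_derivative b) (at t)" "lap_at (w t) x l" "s = b - l"
    using assms(1) unfolding heat_at_def by blast
  have 2: "((\<lambda>\<tau>. a \<tau> * w \<tau> x) has_real_derivative (a' * w t x + a t * b)) (at t)"
    using DERIV_mult[OF assms(2) 1(1)] by (simp add: mult.commute add.commute)
  show ?thesis unfolding heat_at_def
    by (rule exI, rule exI, rule conjI[OF 2], rule conjI[OF lap_at_cmult[OF 1(2)]])
       (simp add: 1 right_diff_distrib)
qed

lemma heat_at_separated:
  assumes "(b has_real_derivative b') (at t)" "lap_at c x l"
  shows "heat_at (\<lambda>t x. b t + c x) t x (b' - l)"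
proof -
  have 1: "((\<lambda>\<tau>. b \<tau> + c x) has_real_derivative b') (at t)"
    using DERIV_add[OF assms(1) DERIV_const] by simp
  have 2: "lap_at (\<lambda>x. b t + c x) x l"
    using lap_at_add[OF lap_at_const assms(2)] by simp
  show ?thesis unfolding heat_at_def using 1 2 by blast
qed

section \<open>The parabolic maximum principle\<close>

lemma heat_at_local_max:
  assumes "heat_at z t x s" and mx: "\<forall>\<^sub>F y in nhds x. z t y \<le> z t x"
    and mt: "\<forall>\<^sub>F \<tau> in at_left t. z \<tau> x \<le> z t x"
  shows "0 \<le> s"
proof -
  obtain a l where 1: "((\<lambda>\<tau>. z \<tau> x) has_real_derivative a) (at t)" "lap_at (z t) x l" "s = a - l"
    using assms(1) unfolding heat_at_def by blast
  have l: "l \<le> 0" using lap_at_local_max[OF 1(2) mx] .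
  have "a \<ge> 0"
  proof (rule ccontr)
    assume "\<not> a \<ge> 0"
    then obtain d where d: "d > 0" "\<And>h. 0 < h \<Longrightarrow> h < d \<Longrightarrow> z t x < z (t - h) x"
      using DERIV_neg_dec_left[OF 1(1)] by force
    obtain b where b: "b < t" "\<And>y. b < y \<Longrightarrow> y < t \<Longrightarrow> z y x \<le> z t x"
      using mt unfolding eventually_at_left_field by blast
    define h where "h = min d (t - b) / 2"
    have "0 < h" "h < d" "b < t - h" using d b by (auto simp: h_def min_def field_simps)
    with d(2)[of h] b(2)[of "t - h"] show False by simp
  qed
  with l 1 show ?thesis by simp
qed

text \<open>A positive value forces a positive maximum, which neither alternative allows. The first
alternative covers boundary points from which the function still increases into the region, as
happens under a Neumann condition. A maximum gives information from the left in time, so the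
final time is treated like the earlier ones.\<close>

lemma parabolic_max_principle:
  assumes K: "compact K" and cont: "continuous_on K (\<lambda>(t, x). z t x)"
    and step: "\<And>t x. (t, x) \<in> K \<Longrightarrow> 0 < z t x \<Longrightarrow>
      (\<exists>s y. (s, y) \<in> K \<and> z t x < z s y) \<or>
      (\<exists>s<0. heat_at z t x s \<and> (\<forall>\<^sub>F y in nhds x. (t, y) \<in> K) \<and> (\<forall>\<^sub>F \<tau> in at_left t. (\<tau>, x) \<in> K))"
    and tx: "(t, x) \<in> K"
  shows "z t x \<le> 0"
proof (rule ccontr)
  assume pos: "\<not> z t x \<le> 0"
  obtain m where m: "m \<in> K" "\<And>y. y \<in> K \<Longrightarrow> (\<lambda>(t, x). z t x) y \<le> (\<lambda>(t, x). z t x) m"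
    using continuous_attains_sup[OF K _ cont] tx by blast
  obtain t0 x0 where m0: "m = (t0, x0)" by force
  have mx: "z s y \<le> z t0 x0" if "(s, y) \<in> K" for s y
    using m(2)[OF that] m0 by simp
  have "0 < z t0 x0" using mx[OF tx] pos by simp
  from step[OF m(1)[unfolded m0] this] show False
  proof
    assume "\<exists>s y. (s, y) \<in> K \<and> z t0 x0 < z s y"
    with mx show False by force
  next
    assume "\<exists>s<0. heat_at z t0 x0 s \<and> (\<forall>\<^sub>F y in nhds x0. (t0, y) \<in> K) \<and> (\<forall>\<^sub>F \<tau> in at_left t0. (\<tau>, x0) \<in> K)"
    then obtain s where s: "s < 0" "heat_at z t0 x0 s" "\<forall>\<^sub>F y in nhds x0. (t0, y) \<in> K" "\<forall>\<^sub>F \<tau> in at_left t0. (\<tau>, x0) \<in> K"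
      by blast
    have "0 \<le> s"
      by (rule heat_at_local_max[OF s(2)]) (use s(3,4) mx in \<open>auto elim: eventually_mono\<close>)
    with s show False by simp
  qed
qed


section \<open>Interior gradient estimate\<close>

lemma continuous_on_case_prod_diff:
  fixes v w :: "'b::topological_space \<Rightarrow> 'c::topological_space \<Rightarrow> real"
  assumes "continuous_on K (\<lambda>(t, x). v t x)" "continuous_on K (\<lambda>(t, x). w t x)"
  shows "continuous_on K (\<lambda>(t, x). v t x - w t x)"
  using assms unfolding case_prod_beta by (rule continuous_on_diff)

lemma reflect_simps:
  assumes "b \<in> Basis"
  shows "dist (reflect x0 b x) x0 = dist x x0"
    and "(reflect x0 b x - x0) \<bullet> b = - ((x - x0) \<bullet> b)"
    and "reflect x0 b (x0 + s *\<^sub>R b) = x0 - s *\<^sub>R b"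
    and "(x - x0) \<bullet> b = 0 \<Longrightarrow> reflect x0 b x = x"
proof -
  have bb: "b \<bullet> b = 1" using assms by simp
  show "(reflect x0 b x - x0) \<bullet> b = - ((x - x0) \<bullet> b)"
    by (simp add: reflect_def algebra_simps bb)
  show "reflect x0 b (x0 + s *\<^sub>R b) = x0 - s *\<^sub>R b"
    by (simp add: reflect_def bb algebra_simps flip: scaleR_2)
  show "(x - x0) \<bullet> b = 0 \<Longrightarrow> reflect x0 b x = x" by (simp add: reflect_def)
  have "(v - (2 * (v \<bullet> b)) *\<^sub>R b) \<bullet> (v - (2 * (v \<bullet> b)) *\<^sub>R b) = v \<bullet> v" for v
  proof -
    have "b \<bullet> v = v \<bullet> b" by (rule inner_commute)
    then show ?thesis by (simp add: inner_diff_left inner_diff_right bb)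
  qed
  then have "(norm (x - x0 - (2 * ((x - x0) \<bullet> b)) *\<^sub>R b))\<^sup>2 = (norm (x - x0))\<^sup>2"
    unfolding power2_norm_eq_inner by blast
  moreover have "reflect x0 b x - x0 = x - x0 - (2 * ((x - x0) \<bullet> b)) *\<^sub>R b"
    by (simp add: reflect_def)
  ultimately have "norm (reflect x0 b x - x0) = norm (x - x0)"
    by (metis norm_ge_zero power2_eq_iff_nonneg)
  then show "dist (reflect x0 b x) x0 = dist x x0" unfolding dist_norm .
qed

text \<open>The difference of \<open>w\<close> and its mirror image vanishes on the mirror and so can be compared, on a half
ball, with a barrier that vanishes linearly there. This gives its slope at the mirror.\<close>

lemma odd_part_bound:
  fixes w :: "real \<Rightarrow> 'a::euclidean_space \<Rightarrow> real"
  assumes r: "0 < r" and b: "b \<in> Basis"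
    and cont: "continuous_on ({t0 - r\<^sup>2..t0} \<times> cball x0 r) (\<lambda>(t, x). w t x)"
    and M: "\<And>t x. t \<in> {t0 - r\<^sup>2..t0} \<Longrightarrow> x \<in> cball x0 r \<Longrightarrow> \<bar>w t x\<bar> \<le> M"
    and N: "\<And>t x. t \<in> {t0 - r\<^sup>2<..t0} \<Longrightarrow> x \<in> ball x0 r \<Longrightarrow> \<exists>s. heat_at w t x s \<and> \<bar>s\<bar> \<le> N"
    and e: "0 < e" and A: "A = M / r\<^sup>2 * (1 + 2 * real DIM('a)) + N + e"
    and s: "0 \<le> s" "s \<le> r"
  shows "w t0 (x0 + s *\<^sub>R b) - w t0 (x0 - s *\<^sub>R b) \<le> 2 * M / r\<^sup>2 * s\<^sup>2 + A * (s * (r - s))"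
proof -
  let ?I = "{t0 - r\<^sup>2..t0}"
  have M0: "0 \<le> M" using M[of t0 x0] r by auto
  have N0: "0 \<le> N" using N[of t0 x0] r by fastforce
  have A0: "0 \<le> A" unfolding A using M0 N0 e by simp
  \<comment> \<open>The first two terms of the barrier dominate \<open>2 M\<close> on the sphere and at the initial time; the concave
    last term, which vanishes on the mirror, makes \<open>\<partial>\<^sub>t B - \<Delta> B\<close> exceed \<open>2 N\<close>.\<close>
  define K where "K = ?I \<times> (cball x0 r \<inter> {x. 0 \<le> (x - x0) \<bullet> b})"
  define B where "B = (\<lambda>t x. 2 * M / r\<^sup>2 * ((x - x0) \<bullet> (x - x0)) + 2 * M / r\<^sup>2 * (t0 - t)
      + (A * r * ((x - x0) \<bullet> b) - A * ((x - x0) \<bullet> b)\<^sup>2))"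
  define z where "z = (\<lambda>t x. (w t x - w t (reflect x0 b x)) - B t x)"
  have "closed {x. 0 \<le> (x - x0) \<bullet> b}"
    by (intro closed_Collect_le continuous_intros)
  then have K: "compact K" unfolding K_def by (intro compact_Times compact_Int_closed) auto
  have refl: "reflect x0 b x \<in> cball x0 r" if "x \<in> cball x0 r" for x
    using that reflect_simps(1)[OF b, of x0 x] by (simp add: dist_commute)
  have contz: "continuous_on K (\<lambda>(t, x). z t x)"
  proof -
    have 1: "continuous_on K (\<lambda>(t, x). w t x)"
      by (rule continuous_on_subset[OF cont]) (auto simp: K_def)
    have 2: "continuous_on K (\<lambda>(t, x). w t (reflect x0 b x))"
      unfolding case_prod_beta
      by (rule continuous_on_compose2[OF cont, of K "\<lambda>p. (fst p, reflect x0 b (snd p))", simplified case_prod_beta fst_conv snd_conv])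
         (use refl in \<open>auto simp: K_def reflect_def intro!: continuous_intros\<close>)
    have 3: "continuous_on K (\<lambda>(t, x). B t x)"
      unfolding B_def case_prod_beta by (intro continuous_intros)
    show ?thesis unfolding z_def
      by (intro continuous_on_case_prod_diff 1 2 3)
  qed
  have heatB: "heat_at B t x (- (2 * M / r\<^sup>2) * (1 + 2 * real DIM('a)) + 2 * A)" for t x
  proof -
    have 1: "((\<lambda>\<tau>. B \<tau> x) has_real_derivative - (2 * M / r\<^sup>2)) (at t)"
      unfolding B_def by (rule derivative_eq_intros refl | simp)+
    have 2: "lap_at (B t) x (2 * M / r\<^sup>2 * (2 * real DIM('a)) + 0 + (A * r * 0 - A * (2 * (b \<bullet> b))))"
      unfolding B_def
      by (intro lap_at_add lap_at_diff lap_at_cmult lap_at_sq lap_at_const lap_at_inner lap_at_inner_sq)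
    show ?thesis unfolding heat_at_def
      by (rule exI, rule exI, rule conjI[OF 1], rule conjI[OF 2]) (use b in \<open>simp add: algebra_simps add_divide_distrib\<close>)
  qed
  have main: "z t x \<le> 0" if tx: "(t, x) \<in> K" for t x
  proof (rule parabolic_max_principle[OF K contz _ tx])
    fix t x assume txK: "(t, x) \<in> K" and pos: "0 < z t x"
    let ?xi = "(x - x0) \<bullet> b"
    have t: "t0 - r\<^sup>2 \<le> t" "t \<le> t0" and x: "dist x x0 \<le> r" "0 \<le> ?xi"
      using txK by (auto simp: K_def dist_commute)
    have "\<bar>?xi\<bar> \<le> norm (x - x0)" using Basis_le_norm[OF b] .
    then have xi: "?xi \<le> r" using x by (simp add: dist_norm)
    have Bform: "B t x = 2 * M / r\<^sup>2 * ((norm (x - x0))\<^sup>2 + (t0 - t)) + A * (?xi * (r - ?xi))"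
      unfolding B_def power2_norm_eq_inner
      by (simp add: distrib_left right_diff_distrib power2_eq_square mult.assoc)
    have p: "0 \<le> A * (?xi * (r - ?xi))" using A0 x xi by simp
    have q: "0 \<le> 2 * M / r\<^sup>2 * ((norm (x - x0))\<^sup>2 + (t0 - t))" using M0 t by simp
    have W: "w t x - w t (reflect x0 b x) \<le> 2 * M"
      using M[of t x] M[of t "reflect x0 b x"] refl[of x] t x by (auto simp: dist_commute)
    have big: "(norm (x - x0))\<^sup>2 + (t0 - t) < r\<^sup>2"
    proof (rule ccontr)
      assume "\<not> ?thesis"
      then have "2 * M / r\<^sup>2 * r\<^sup>2 \<le> 2 * M / r\<^sup>2 * ((norm (x - x0))\<^sup>2 + (t0 - t))"
        using M0 by (intro mult_left_mono) auto
      then have "2 * M \<le> B t x" using Bform p r by simp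
      with W pos show False by (simp add: z_def)
    qed
    have "(norm (x - x0))\<^sup>2 < r\<^sup>2" using big t by simp
    then have x1: "x \<in> ball x0 r" using r by (simp add: power2_less_imp_less dist_norm norm_minus_commute)
    have "0 \<le> (norm (x - x0))\<^sup>2" by simp
    then have t1: "t0 - r\<^sup>2 < t" using big by linarith
    have xi0: "0 < ?xi"
    proof (rule ccontr)
      assume "\<not> 0 < ?xi"
      then have "?xi = 0" using x by simp
      then have "w t x - w t (reflect x0 b x) = 0" using reflect_simps(4)[OF b] by simp
      with Bform p q pos show False by (simp add: z_def)
    qed
    have rx1: "reflect x0 b x \<in> ball x0 r" using x1 reflect_simps(1)[OF b, of x0 x] by (simp add: dist_commute)
    obtain s1 where s1: "heat_at w t x s1" "\<bar>s1\<bar> \<le> N" using N[of t x] t t1 x1 by auto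
    obtain s2 where s2: "heat_at w t (reflect x0 b x) s2" "\<bar>s2\<bar> \<le> N" using N[of t "reflect x0 b x"] t t1 rx1 by auto
    have hz: "heat_at z t x ((s1 - s2) - (- (2 * M / r\<^sup>2) * (1 + 2 * real DIM('a)) + 2 * A))"
      unfolding z_def
      by (intro heat_at_diff s1 heat_at_reflect[OF b s2(1)] heatB)
    have neg: "(s1 - s2) - (- (2 * M / r\<^sup>2) * (1 + 2 * real DIM('a)) + 2 * A) < 0"
    proof -
      have "(s1 - s2) - (- (2 * M / r\<^sup>2) * (1 + 2 * real DIM('a)) + 2 * A) = (s1 - s2) - 2 * N - 2 * e"
        unfolding A by (simp add: algebra_simps add_divide_distrib)
      then show ?thesis using s1(2) s2(2) e by linarith
    qed
    have ev1: "\<forall>\<^sub>F y in nhds x. (t, y) \<in> K"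
    proof -
      have "open (ball x0 r \<inter> {y. 0 < (y - x0) \<bullet> b})"
        by (intro open_Int open_Collect_less continuous_intros) auto
      then have "\<forall>\<^sub>F y in nhds x. y \<in> ball x0 r \<inter> {y. 0 < (y - x0) \<bullet> b}"
        using x1 xi0 by (intro eventually_nhds_in_open) auto
      then show ?thesis by eventually_elim (use t in \<open>auto simp: K_def\<close>)
    qed
    have ev2: "\<forall>\<^sub>F \<tau> in at_left t. (\<tau>, x) \<in> K"
      unfolding eventually_at_left_field
      by (rule exI[of _ "t0 - r\<^sup>2"]) (use t t1 x in \<open>auto simp: K_def dist_commute\<close>)
    show "(\<exists>s y. (s, y) \<in> K \<and> z t x < z s y) \<or>
        (\<exists>s<0. heat_at z t x s \<and> (\<forall>\<^sub>F y in nhds x. (t, y) \<in> K) \<and> (\<forall>\<^sub>F \<tau> in at_left t. (\<tau>, x) \<in> K))"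
      using hz neg ev1 ev2 by blast
  qed
  have "(t0, x0 + s *\<^sub>R b) \<in> K"
    using s r b by (auto simp: K_def dist_norm)
  from main[OF this] show ?thesis
    unfolding z_def B_def using b
    by (simp add: reflect_simps(3)[OF b] power2_eq_square algebra_simps)
qed

text \<open>Dividing the bound of \<open>odd_part_bound\<close> by the distance to the mirror and letting it tend to \<open>0\<close> bounds one
component of the gradient.\<close>

lemma interior_gradient_estimate:
  fixes w :: "real \<Rightarrow> 'a::euclidean_space \<Rightarrow> real"
  assumes r: "0 < r"
    and cont: "continuous_on ({t0 - r\<^sup>2..t0} \<times> cball x0 r) (\<lambda>(t, x). w t x)"
    and M: "\<And>t x. t \<in> {t0 - r\<^sup>2..t0} \<Longrightarrow> x \<in> cball x0 r \<Longrightarrow> \<bar>w t x\<bar> \<le> M"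
    and N: "\<And>t x. t \<in> {t0 - r\<^sup>2<..t0} \<Longrightarrow> x \<in> ball x0 r \<Longrightarrow> \<exists>s. heat_at w t x s \<and> \<bar>s\<bar> \<le> N"
    and g: "GDERIV (w t0) x0 :> g"
  shows "norm g \<le> real DIM('a) * (1 + 2 * real DIM('a)) * (M / r + N * r)"
proof -
  let ?d = "real DIM('a)"
  have M0: "0 \<le> M" using M[of t0 x0] r by auto
  have N0: "0 \<le> N" using N[of t0 x0] r by fastforce
  have comp: "g \<bullet> b \<le> (1 + 2 * ?d) * (M / r + N * r)"
    if cont: "continuous_on ({t0 - r\<^sup>2..t0} \<times> cball x0 r) (\<lambda>(t, x). w t x)"
    and M: "\<And>t x. t \<in> {t0 - r\<^sup>2..t0} \<Longrightarrow> x \<in> cball x0 r \<Longrightarrow> \<bar>w t x\<bar> \<le> M"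
    and N: "\<And>t x. t \<in> {t0 - r\<^sup>2<..t0} \<Longrightarrow> x \<in> ball x0 r \<Longrightarrow> \<exists>s. heat_at w t x s \<and> \<bar>s\<bar> \<le> N"
    and g: "GDERIV (w t0) x0 :> g"
    and b: "b \<in> Basis" for w g and b :: 'a
  proof -
    have *: "2 * (g \<bullet> b) \<le> (M / r\<^sup>2 * (1 + 2 * ?d) + N + e) * r" if e: "0 < e" for e
    proof -
      define A where "A = M / r\<^sup>2 * (1 + 2 * ?d) + N + e"
      have bd: "w t0 (x0 + s *\<^sub>R b) - w t0 (x0 - s *\<^sub>R b) \<le> 2 * M / r\<^sup>2 * s\<^sup>2 + A * (s * (r - s))"
        if "0 \<le> s" "s \<le> r" for s
        by (rule odd_part_bound[OF r b cont M N e A_def that])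
      let ?h = "\<lambda>s. w t0 (x0 + s *\<^sub>R b) - w t0 (x0 - s *\<^sub>R b)"
      let ?k = "\<lambda>s. 2 * M / r\<^sup>2 * s\<^sup>2 + A * (s * (r - s))"
      have g': "(w t0 has_derivative (\<lambda>h. h \<bullet> g)) (at x0)" using g by (simp add: gderiv_def)
      have "((\<lambda>s. w t0 (x0 + s *\<^sub>R b)) has_derivative (\<lambda>s. (s *\<^sub>R b) \<bullet> g)) (at 0)"
        by (rule has_derivative_compose[of "\<lambda>s. x0 + s *\<^sub>R b" "\<lambda>s. s *\<^sub>R b" 0 UNIV "w t0" "\<lambda>h. h \<bullet> g"])
           (use g' in \<open>auto intro!: derivative_eq_intros\<close>)
      moreover have "((\<lambda>s. w t0 (x0 - s *\<^sub>R b)) has_derivative (\<lambda>s. (- (s *\<^sub>R b)) \<bullet> g)) (at 0)"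
        by (rule has_derivative_compose[of "\<lambda>s. x0 - s *\<^sub>R b" "\<lambda>s. - (s *\<^sub>R b)" 0 UNIV "w t0" "\<lambda>h. h \<bullet> g"])
           (use g' in \<open>auto intro!: derivative_eq_intros\<close>)
      ultimately have "(?h has_derivative (\<lambda>s. (s *\<^sub>R b) \<bullet> g - (- (s *\<^sub>R b)) \<bullet> g)) (at 0)"
        by (rule has_derivative_diff)
      then have "(?h has_real_derivative (2 * (g \<bullet> b))) (at 0)"
        by (simp add: has_field_derivative_def inner_commute[of b] mult.commute[of 2] mult_commute_abs algebra_simps)
      moreover have "(?k has_real_derivative (A * r)) (at 0)"
        by (rule derivative_eq_intros refl | simp)+
      ultimately have D: "((\<lambda>s. ?k s - ?h s) has_real_derivative (A * r - 2 * (g \<bullet> b))) (at 0)"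
        by (intro DERIV_diff)
      have "A * r - 2 * (g \<bullet> b) \<ge> 0"
      proof (rule ccontr)
        assume "\<not> ?thesis"
        then obtain d where d: "d > 0" "\<And>h. 0 < h \<Longrightarrow> h < d \<Longrightarrow> ?k (0 + h) - ?h (0 + h) < ?k 0 - ?h 0"
          using DERIV_neg_dec_right[OF D] by force
        define h where "h = min d r / 2"
        have "0 < h" "h < d" "h \<le> r" using d r by (auto simp: h_def)
        then have "?k (0 + h) - ?h (0 + h) < ?k 0 - ?h 0" "?h h \<le> ?k h" using d(2)[of h] bd[of h] by auto
        then show False by simp
      qed
      then show ?thesis unfolding A_def by simp
    qed
    have "2 * (g \<bullet> b) \<le> (M / r\<^sup>2 * (1 + 2 * ?d) + N) * r + e" if "0 < e" for e
    proof -
      have "2 * (g \<bullet> b) \<le> (M / r\<^sup>2 * (1 + 2 * ?d) + N + e / r) * r"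
        using r that by (intro \<open>\<And>e. 0 < e \<Longrightarrow> 2 * (g \<bullet> b) \<le> _ e\<close>) simp
      then show ?thesis using r by (simp add: distrib_right)
    qed
    then have "2 * (g \<bullet> b) \<le> (M / r\<^sup>2 * (1 + 2 * ?d) + N) * r"
      by (rule field_le_epsilon)
    also have "\<dots> = (1 + 2 * ?d) * (M / r) + 1 * (N * r)"
      using r by (simp add: power2_eq_square field_simps)
    also have "\<dots> \<le> (1 + 2 * ?d) * (M / r) + (1 + 2 * ?d) * (N * r)"
      using N0 r by (intro add_left_mono mult_right_mono) auto
    finally have "2 * (g \<bullet> b) \<le> (1 + 2 * ?d) * (M / r + N * r)"
      by (simp add: algebra_simps)
    moreover have "0 \<le> (1 + 2 * ?d) * (M / r + N * r)" using M0 N0 r by simp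
    moreover have "2 * a \<le> X \<Longrightarrow> 0 \<le> X \<Longrightarrow> a \<le> X" for a X :: real by simp
    ultimately show ?thesis by blast
  qed
  have up: "g \<bullet> b \<le> (1 + 2 * ?d) * (M / r + N * r)" if "b \<in> Basis" for b
    by (rule comp[OF cont M N g that])
  have lo: "(- g) \<bullet> b \<le> (1 + 2 * ?d) * (M / r + N * r)" if "b \<in> Basis" for b
  proof (rule comp[of "\<lambda>t x. - w t x"])
    show "continuous_on ({t0 - r\<^sup>2..t0} \<times> cball x0 r) (\<lambda>(t, x). - w t x)"
      using continuous_on_minus[OF cont] by (simp add: case_prod_beta)
    show "\<exists>s. heat_at (\<lambda>t x. - w t x) t x s \<and> \<bar>s\<bar> \<le> N" if tx: "t \<in> {t0 - r\<^sup>2<..t0}" "x \<in> ball x0 r" for t x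
    proof -
      obtain s where "heat_at w t x s" "\<bar>s\<bar> \<le> N" using N[OF tx] by blast
      then show ?thesis using heat_at_cmult[of w t x s "-1"] by (intro exI[of _ "-s"]) auto
    qed
    show "GDERIV (\<lambda>x. - w t0 x) x0 :> - g" by (rule GDERIV_minus[OF g])
  qed (use M that in auto)
  have "norm g \<le> (\<Sum>b\<in>Basis. \<bar>g \<bullet> b\<bar>)" by (rule norm_le_l1)
  also have "\<dots> \<le> (\<Sum>b\<in>(Basis::'a set). (1 + 2 * ?d) * (M / r + N * r))"
    using up lo by (intro sum_mono) (auto simp: abs_le_iff)
  also have "\<dots> = ?d * (1 + 2 * ?d) * (M / r + N * r)" by simp
  finally show ?thesis .
qed


section \<open>Domains with two-sided tangent balls\<close>

lemma disjoint_balls_dist: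
  fixes a b :: "'a::euclidean_space"
  assumes "ball a r \<inter> ball b s = {}" "0 < r" "0 < s"
  shows "r + s \<le> dist a b"
proof (rule ccontr)
  assume "\<not> r + s \<le> dist a b"
  then have d: "norm (b - a) < r + s" by (simp add: dist_norm norm_minus_commute)
  define c where "c = a + (r / (r + s)) *\<^sub>R (b - a)"
  have "dist a c = r / (r + s) * norm (b - a)"
    using assms by (simp add: c_def dist_norm)
  also have "\<dots> < r / (r + s) * (r + s)"
    using assms d by (intro mult_strict_left_mono) auto
  also have "\<dots> = r" using assms by simp
  finally have 1: "c \<in> ball a r" by simp
  have "b - c = (1 - r / (r + s)) *\<^sub>R (b - a)"
    by (simp add: c_def algebra_simps)
  also have "1 - r / (r + s) = s / (r + s)" using assms by (simp add: field_simps)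
  finally have "dist b c = s / (r + s) * norm (b - a)"
    using assms by (simp add: dist_norm)
  also have "\<dots> < s / (r + s) * (r + s)"
    using assms d by (intro mult_strict_left_mono) auto
  also have "\<dots> = s" using assms by simp
  finally have 2: "c \<in> ball b s" by simp
  from 1 2 assms(1) show False by blast
qed

lemma norm_add_scaleR_sq:
  fixes v w :: "'a::real_inner"
  shows "(norm (v + c *\<^sub>R w))\<^sup>2 = (norm v)\<^sup>2 + 2 * c * (v \<bullet> w) + c\<^sup>2 * (norm w)\<^sup>2"
  unfolding power2_norm_eq_inner
  by (simp add: inner_add_left inner_add_right inner_commute[of w v] power2_eq_square algebra_simps)

text \<open>The regularity of the domain in the form used throughout: \<open>n q\<close> is the inward unit normal, and two
balls of one radius \<open>r0\<close> touch the boundary at \<open>q\<close> from inside and from outside.\<close>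

locale two_sided_ball =
  fixes \<Omega> :: "'a::euclidean_space set" and n :: "'a \<Rightarrow> 'a" and r0 :: real
  assumes open_dom: "open \<Omega>" and r0: "0 < r0"
    and norm_n: "\<And>q. q \<in> frontier \<Omega> \<Longrightarrow> norm (n q) = 1"
    and inner_ball: "\<And>q. q \<in> frontier \<Omega> \<Longrightarrow> ball (q + r0 *\<^sub>R n q) r0 \<subseteq> \<Omega>"
    and outer_ball: "\<And>q. q \<in> frontier \<Omega> \<Longrightarrow> ball (q - r0 *\<^sub>R n q) r0 \<inter> \<Omega> = {}"
begin

lemma frontier_eq: "frontier \<Omega> = closure \<Omega> - \<Omega>"
  using open_dom by (simp add: frontier_def interior_open)

lemma closure_cases: "x \<in> closure \<Omega> \<longleftrightarrow> x \<in> \<Omega> \<or> x \<in> frontier \<Omega>"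
  using closure_subset frontier_eq by auto

lemma normal_inner_self: "q \<in> frontier \<Omega> \<Longrightarrow> n q \<bullet> n q = 1"
  using norm_n by (simp add: norm_eq_1)

lemma outer_dist:
  assumes "q \<in> frontier \<Omega>" "x \<in> closure \<Omega>"
  shows "r0 \<le> norm (x - q + r0 *\<^sub>R n q)"
proof -
  have "closure \<Omega> \<inter> ball (q - r0 *\<^sub>R n q) r0 = {}"
    using outer_ball[OF assms(1)] open_Int_closure_eq_empty[of "ball (q - r0 *\<^sub>R n q) r0" \<Omega>] by (auto simp: Int_commute)
  then have "x \<notin> ball (q - r0 *\<^sub>R n q) r0" using assms by blast
  then show ?thesis by (simp add: dist_norm norm_minus_commute algebra_simps)
qed

text \<open>Points of the closure avoid the exterior ball at \<open>q\<close>; hence the domain bends at most quadratically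
below its tangent plane.\<close>

lemma outer_inner:
  assumes "q \<in> frontier \<Omega>" "x \<in> closure \<Omega>"
  shows "- (norm (x - q))\<^sup>2 \<le> 2 * r0 * ((x - q) \<bullet> n q)"
proof -
  have "r0\<^sup>2 \<le> (norm (x - q + r0 *\<^sub>R n q))\<^sup>2"
    using outer_dist[OF assms] r0 by (intro power_mono) auto
  also have "\<dots> = (norm (x - q))\<^sup>2 + 2 * r0 * ((x - q) \<bullet> n q) + r0\<^sup>2"
    using norm_n[OF assms(1)] by (simp add: norm_add_scaleR_sq)
  finally show ?thesis by simp
qed

text \<open>The interior ball at \<open>p\<close> is disjoint from the exterior ball at \<open>q\<close>, and vice versa. Adding the two
resulting inequalities for the centres in the parallelogram law leaves a bound on the normals.\<close>

lemma normal_lipschitz: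
  assumes p: "p \<in> frontier \<Omega>" and q: "q \<in> frontier \<Omega>"
  shows "norm (n p - n q) \<le> dist p q / r0"
proof -
  let ?a = "p - q" and ?b = "r0 *\<^sub>R (n p + n q)"
  have 1: "2 * r0 \<le> norm (?a + ?b)"
  proof -
    have "ball (p + r0 *\<^sub>R n p) r0 \<inter> ball (q - r0 *\<^sub>R n q) r0 = {}"
      using inner_ball[OF p] outer_ball[OF q] by blast
    from disjoint_balls_dist[OF this r0 r0] show ?thesis by (simp add: dist_norm algebra_simps)
  qed
  have 2: "2 * r0 \<le> norm (?b - ?a)"
  proof -
    have "ball (q + r0 *\<^sub>R n q) r0 \<inter> ball (p - r0 *\<^sub>R n p) r0 = {}"
      using inner_ball[OF q] outer_ball[OF p] by blast
    from disjoint_balls_dist[OF this r0 r0] show ?thesis by (simp add: dist_norm algebra_simps)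
  qed
  have "(2 * r0)\<^sup>2 \<le> (norm (?a + ?b))\<^sup>2" "(2 * r0)\<^sup>2 \<le> (norm (?b - ?a))\<^sup>2"
    using 1 2 r0 by (intro power_mono; simp)+
  moreover have "(norm (?a + ?b))\<^sup>2 + (norm (?b - ?a))\<^sup>2 = 2 * (norm ?a)\<^sup>2 + 2 * (norm ?b)\<^sup>2"
    unfolding power2_norm_eq_inner by (simp add: algebra_simps inner_commute)
  ultimately have A: "4 * r0\<^sup>2 \<le> (norm ?a)\<^sup>2 + (norm ?b)\<^sup>2" by (simp add: power_mult_distrib)
  have "(norm ?b)\<^sup>2 = r0\<^sup>2 * (norm (n p + n q))\<^sup>2" by (simp add: power_mult_distrib)
  moreover have "(norm (n p + n q))\<^sup>2 + (norm (n p - n q))\<^sup>2 = 4"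
    unfolding power2_norm_eq_inner using normal_inner_self[OF p] normal_inner_self[OF q] by (simp add: algebra_simps inner_commute)
  ultimately have "(norm ?b)\<^sup>2 = 4 * r0\<^sup>2 - r0\<^sup>2 * (norm (n p - n q))\<^sup>2"
    by (metis add_diff_cancel_right' mult.commute right_diff_distrib)
  with A have "r0\<^sup>2 * (norm (n p - n q))\<^sup>2 \<le> (norm ?a)\<^sup>2" by simp
  then have "(r0 * norm (n p - n q))\<^sup>2 \<le> (norm ?a)\<^sup>2" by (simp add: power_mult_distrib)
  then have "r0 * norm (n p - n q) \<le> norm ?a" by (rule power2_le_imp_le) simp
  then show ?thesis using r0 by (simp add: dist_norm field_simps)
qed

lemma inner_normals:
  assumes p: "p \<in> frontier \<Omega>" and q: "q \<in> frontier \<Omega>"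
  shows "1 - (dist p q / r0)\<^sup>2 / 2 \<le> n p \<bullet> n q"
proof -
  have "(norm (n p - n q))\<^sup>2 = 2 - 2 * (n p \<bullet> n q)"
    unfolding power2_norm_eq_inner using normal_inner_self[OF p] normal_inner_self[OF q] by (simp add: algebra_simps inner_commute)
  moreover have "(norm (n p - n q))\<^sup>2 \<le> (dist p q / r0)\<^sup>2"
    using normal_lipschitz[OF p q] by (intro power_mono) auto
  ultimately show ?thesis by simp
qed

lemma inward_inside:
  assumes q: "q \<in> frontier \<Omega>" and p: "p \<in> frontier \<Omega>" and pq: "dist p q \<le> r0 / 2" and s: "0 < s" "s \<le> r0"
  shows "q + s *\<^sub>R n p \<in> \<Omega>" "q - s *\<^sub>R n p \<notin> \<Omega>"
proof -
  have "(dist p q / r0)\<^sup>2 \<le> (1 / 2)\<^sup>2" using pq r0 by (intro power_mono) (auto simp: field_simps)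
  then have i: "7 / 8 \<le> n p \<bullet> n q" using inner_normals[OF p q] by (simp add: power2_eq_square)
  have "(norm (s *\<^sub>R n p - r0 *\<^sub>R n q))\<^sup>2 = s * s - 2 * s * r0 * (n p \<bullet> n q) + r0\<^sup>2"
    unfolding power2_norm_eq_inner using normal_inner_self[OF p] normal_inner_self[OF q]
    by (simp add: algebra_simps inner_commute power2_eq_square)
  also have "\<dots> < r0\<^sup>2"
  proof -
    have "s * s < s * (2 * r0 * (7 / 8))" using s r0 by (intro mult_strict_left_mono) auto
    also have "\<dots> \<le> s * (2 * r0 * (n p \<bullet> n q))" using s r0 i by (intro mult_left_mono) auto
    finally show ?thesis by (simp add: algebra_simps)
  qed
  finally have N: "norm (s *\<^sub>R n p - r0 *\<^sub>R n q) < r0" using r0 by (simp add: power2_less_imp_less)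
  have "dist (q + r0 *\<^sub>R n q) (q + s *\<^sub>R n p) < r0" "dist (q - r0 *\<^sub>R n q) (q - s *\<^sub>R n p) < r0"
    using N by (simp_all add: dist_norm norm_minus_commute)
  then show "q + s *\<^sub>R n p \<in> \<Omega>" "q - s *\<^sub>R n p \<notin> \<Omega>"
    using inner_ball[OF q] outer_ball[OF q] by (auto simp: subset_iff)
qed

text \<open>A segment in direction \<open>n p\<close> that left the domain would leave it at a boundary point whose normal is close
to \<open>n p\<close>, but just before such a point the segment would be in the exterior ball.\<close>

lemma shift_inside:
  assumes p: "p \<in> frontier \<Omega>" and x: "x \<in> closure \<Omega>" "dist p x \<le> r0 / 4" and k: "0 < k" "k \<le> r0 / 4"
  shows "x + k *\<^sub>R n p \<in> \<Omega>"
proof (rule ccontr)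
  assume no: "x + k *\<^sub>R n p \<notin> \<Omega>"
  have xin: "x \<in> \<Omega>"
    using x no closure_cases inward_inside(1)[of x p k] p k r0 by (auto simp: dist_commute)
  let ?S = "closed_segment x (x + k *\<^sub>R n p)"
  have "?S \<inter> frontier \<Omega> \<noteq> {}"
    by (rule connected_Int_frontier) (use xin no in auto)
  then obtain q where q: "q \<in> frontier \<Omega>" "q \<in> ?S" by blast
  then obtain c where c: "0 \<le> c" "c \<le> 1" "q = (1 - c) *\<^sub>R x + c *\<^sub>R (x + k *\<^sub>R n p)"
    unfolding closed_segment_def by blast
  have q': "q = x + (c * k) *\<^sub>R n p" using c(3) by (simp add: algebra_simps)
  have c0: "c \<noteq> 0"
  proof
    assume "c = 0"
    then have "q = x" using q' by simp
    with q(1) xin frontier_eq show False by blast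
  qed
  have "c * k \<le> 1 * k" using c k by (intro mult_right_mono) auto
  then have ck: "0 < c * k" "c * k \<le> r0 / 4" using c(1) c0 k by (simp, linarith)
  have "dist p q \<le> dist p x + dist x q" by (rule dist_triangle)
  also have "dist x q = c * k" using q' ck norm_n[OF p] by (simp add: dist_norm)
  finally have "dist p q \<le> r0 / 2" using x ck by simp
  from inward_inside(2)[OF q(1) p this ck(1)] ck r0 q' xin show False by simp
qed

lemma depth_ball:
  assumes p: "p \<in> frontier \<Omega>" and s: "0 < s" "s \<le> r0"
  shows "ball (p + s *\<^sub>R n p) s \<subseteq> \<Omega>"
proof -
  have "ball (p + s *\<^sub>R n p) s \<subseteq> ball (p + r0 *\<^sub>R n p) r0"
  proof
    fix y assume "y \<in> ball (p + s *\<^sub>R n p) s"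
    then have "dist (p + s *\<^sub>R n p) y < s" by simp
    moreover have "dist (p + r0 *\<^sub>R n p) (p + s *\<^sub>R n p) = r0 - s"
      using norm_n[OF p] s by (simp add: dist_norm flip: scaleR_left_diff_distrib)
    ultimately show "y \<in> ball (p + r0 *\<^sub>R n p) r0"
      using dist_triangle[of "p + r0 *\<^sub>R n p" y "p + s *\<^sub>R n p"] by simp
  qed
  then show ?thesis using inner_ball[OF p] by blast
qed

text \<open>The ball around \<open>x\<close> and the exterior ball at the nearest point \<open>q\<close> are disjoint and touch at \<open>q\<close>, so the
two centres and \<open>q\<close> are aligned.\<close>

lemma nearest_normal:
  assumes q: "q \<in> frontier \<Omega>" and b: "ball x (dist x q) \<subseteq> \<Omega>"
  shows "x = q + dist x q *\<^sub>R n q"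
proof (cases "x = q")
  case False
  define d where "d = dist x q"
  have d: "0 < d" using False by (simp add: d_def)
  have "ball x d \<inter> ball (q - r0 *\<^sub>R n q) r0 = {}"
    using b outer_ball[OF q] by (auto simp: d_def)
  from disjoint_balls_dist[OF this d r0] have "d + r0 \<le> norm ((x - q) + r0 *\<^sub>R n q)"
    by (simp add: dist_norm algebra_simps)
  then have "(d + r0)\<^sup>2 \<le> (norm ((x - q) + r0 *\<^sub>R n q))\<^sup>2" using d r0 by (intro power_mono) auto
  also have "\<dots> = d\<^sup>2 + 2 * r0 * ((x - q) \<bullet> n q) + r0\<^sup>2"
    using norm_n[OF q] by (simp add: norm_add_scaleR_sq d_def dist_norm)
  finally have "2 * r0 * d \<le> 2 * r0 * ((x - q) \<bullet> n q)" by (simp add: power2_eq_square algebra_simps)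
  then have i: "d \<le> (x - q) \<bullet> n q" using r0 by simp
  have "(norm ((x - q) - d *\<^sub>R n q))\<^sup>2 = d\<^sup>2 - 2 * d * ((x - q) \<bullet> n q) + d\<^sup>2"
    using norm_n[OF q] norm_add_scaleR_sq[of "x - q" "- d" "n q"] by (simp add: d_def dist_norm)
  also have "\<dots> \<le> d\<^sup>2 - 2 * d * d + d\<^sup>2" using i d by simp
  also have "\<dots> = 0" by (simp add: power2_eq_square)
  finally have "(x - q) - d *\<^sub>R n q = 0" by simp
  then show ?thesis by (simp add: d_def algebra_simps)
qed simp

lemma near_boundary_cases:
  assumes x: "x \<in> closure \<Omega>" and no: "\<not> ball x \<sigma> \<subseteq> \<Omega>" and \<sigma>: "0 < \<sigma>"
  obtains q where "q \<in> frontier \<Omega>" "dist x q < \<sigma>" "x = q + dist x q *\<^sub>R n q"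
proof (cases "x \<in> \<Omega>")
  case False
  then have "x \<in> frontier \<Omega>" using x closure_cases by blast
  then show ?thesis using that[of x] \<sigma> by simp
next
  case True
  have "x \<in> ball x \<sigma> \<inter> \<Omega>" using True \<sigma> by simp
  then have ne: "ball x \<sigma> \<inter> frontier \<Omega> \<noteq> {}"
    by (intro connected_Int_frontier connected_ball) (use no in blast)+
  then have "frontier \<Omega> \<noteq> {}" by blast
  then obtain q where q: "q \<in> frontier \<Omega>" "\<And>y. y \<in> frontier \<Omega> \<Longrightarrow> dist x q \<le> dist x y"
    using distance_attains_inf[OF frontier_closed] by blast
  have "ball x (dist x q) \<subseteq> \<Omega>"
  proof (rule ccontr)
    assume a: "\<not> ?thesis"
    have "0 < dist x q" using True q(1) frontier_eq by auto
    then have "x \<in> ball x (dist x q) \<inter> \<Omega>" using True by simp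
    then have "ball x (dist x q) \<inter> frontier \<Omega> \<noteq> {}"
      by (intro connected_Int_frontier connected_ball) (use a in blast)+
    with q(2) show False by force
  qed
  then have "x = q + dist x q *\<^sub>R n q" by (rule nearest_normal[OF q(1)])
  moreover have "dist x q < \<sigma>" using ne q(2) by force
  ultimately show ?thesis using that q(1) by blast
qed

section \<open>Comparison for the Neumann problem\<close>

text \<open>The function \<open>|x - x0|\<^sup>2 - m \<bullet> (x - x0)\<close> serves as a penalty near \<open>x0\<close>: it has bounded
Laplacian, it is larger on a small sphere than at the centre, and it decreases strictly into the domain
at boundary points. The linear term, along the normal of a nearby boundary point, provides the
last property without spoiling the second.\<close>

lemma local_barrier:
  assumes x0: "x0 \<in> closure \<Omega>"
  obtains m where "norm m \<le> 3 / 8 * (r0 / 8)"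
    "\<And>q. q \<in> frontier \<Omega> \<Longrightarrow> dist x0 q \<le> r0 / 8 \<Longrightarrow> 2 * ((q - x0) \<bullet> n q) - n q \<bullet> m < 0"
proof (cases "\<exists>p\<in>frontier \<Omega>. dist x0 p \<le> r0 / 8")
  case False
  then show ?thesis using that[of 0] r0 by auto
next
  case True
  then obtain p where p: "p \<in> frontier \<Omega>" "dist x0 p \<le> r0 / 8" by blast
  define m where "m = (3 / 8 * (r0 / 8)) *\<^sub>R n p"
  show ?thesis
  proof (rule that[of m])
    show "norm m \<le> 3 / 8 * (r0 / 8)" using norm_n[OF p(1)] r0 by (simp add: m_def)
    fix q assume q: "q \<in> frontier \<Omega>" "dist x0 q \<le> r0 / 8"
    have pq: "dist p q \<le> r0 / 4" using dist_triangle[of p q x0] p q by (simp add: dist_commute)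
    have "(dist p q / r0)\<^sup>2 \<le> (1 / 4)\<^sup>2" using pq r0 by (intro power_mono) (auto simp: field_simps)
    then have i: "31 / 32 \<le> n q \<bullet> n p" using inner_normals[OF p(1) q(1)] by (simp add: power2_eq_square inner_commute)
    have "(norm (x0 - q))\<^sup>2 \<le> (r0 / 8)\<^sup>2" using q(2) by (intro power_mono) (auto simp: dist_norm)
    moreover have "- (norm (x0 - q))\<^sup>2 \<le> 2 * r0 * ((x0 - q) \<bullet> n q)" by (rule outer_inner[OF q(1) x0])
    ultimately have "r0 * (2 * ((q - x0) \<bullet> n q)) \<le> r0 * (r0 / 64)"
      by (simp add: inner_diff_left algebra_simps power2_eq_square)
    then have 1: "2 * ((q - x0) \<bullet> n q) \<le> r0 / 64" using r0 by simp
    have "3 / 8 * (r0 / 8) * (31 / 32) \<le> 3 / 8 * (r0 / 8) * (n q \<bullet> n p)"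
      using i r0 by (intro mult_left_mono) auto
    also have "\<dots> = n q \<bullet> m" by (simp add: m_def)
    finally show "2 * ((q - x0) \<bullet> n q) - n q \<bullet> m < 0" using 1 r0 by simp
  qed
qed

text \<open>The domain is unbounded, so a positive supremum need not be attained. A point where it is nearly
attained becomes a true maximum after subtraction of a small multiple of the penalty of
\<open>local_barrier\<close>, whose strict slope at the boundary keeps the maximum away from it.\<close>

lemma neumann_comparison:
  assumes cont: "continuous_on ({T..T'} \<times> closure \<Omega>) (\<lambda>(t, x). w t x)"
    and bnd: "\<And>t x. t \<in> {T..T'} \<Longrightarrow> x \<in> closure \<Omega> \<Longrightarrow> w t x \<le> M"
    and nd: "\<And>t q. t \<in> {T<..T'} \<Longrightarrow> q \<in> frontier \<Omega> \<Longrightarrow>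
        ((\<lambda>s. w t (q + s *\<^sub>R n q)) has_real_derivative 0) (at 0 within {0..})"
    and pde: "\<And>t x. t \<in> {T<..T'} \<Longrightarrow> x \<in> \<Omega> \<Longrightarrow> 0 < w t x \<Longrightarrow> \<exists>s. heat_at w t x s \<and> s \<le> lam * w t x"
    and init: "\<And>x. x \<in> closure \<Omega> \<Longrightarrow> w T x \<le> m0" and m0: "0 \<le> m0"
    and tx: "t \<in> {T..T'}" "x \<in> closure \<Omega>"
  shows "w t x \<le> m0 * exp (lam * (t - T))"
proof -
  let ?d = "real DIM('a)"
  let ?I = "{T..T'}"
  define a where "a = (\<lambda>t. exp (- lam * (t - T)))"
  have a0: "0 < a t" for t by (simp add: a_def)
  have da: "(a has_real_derivative (- lam * a t)) (at t)" for t
    unfolding a_def by (auto intro!: derivative_eq_intros)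
  have aT: "a T = 1" by (simp add: a_def)
  have main: "a t * w t x \<le> m0 + \<beta> * (t - T)" if \<beta>: "0 < \<beta>" and tx: "t \<in> ?I" "x \<in> closure \<Omega>" for \<beta> t x
  proof (rule ccontr)
    assume neg: "\<not> ?thesis"
    define y where "y = (\<lambda>t x. a t * w t x - (m0 + \<beta> * (t - T)))"
    let ?Y = "(\<lambda>(t, x). y t x) ` (?I \<times> closure \<Omega>)"
    have ypos: "0 < y t x" using neg by (simp add: y_def)
    have yb: "y s z \<le> exp (\<bar>lam\<bar> * (T' - T)) * \<bar>M\<bar>" if sz: "s \<in> ?I" "z \<in> closure \<Omega>" for s z
    proof -
      have "a s * w s z \<le> a s * \<bar>M\<bar>" using bnd[OF sz] a0[of s] by (intro mult_left_mono) auto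
      also have "\<dots> \<le> exp (\<bar>lam\<bar> * (T' - T)) * \<bar>M\<bar>"
      proof (rule mult_right_mono)
        have "- lam * (s - T) \<le> \<bar>lam\<bar> * (s - T)" using sz by (intro mult_right_mono) auto
        also have "\<dots> \<le> \<bar>lam\<bar> * (T' - T)" using sz by (intro mult_left_mono) auto
        finally show "a s \<le> exp (\<bar>lam\<bar> * (T' - T))" by (simp add: a_def)
      qed simp
      moreover have "0 \<le> m0 + \<beta> * (s - T)" using m0 \<beta> sz by simp
      ultimately show ?thesis by (simp add: y_def)
    qed
    have bdd: "bdd_above ?Y" by (rule bdd_aboveI[of _ "exp (\<bar>lam\<bar> * (T' - T)) * \<bar>M\<bar>"]) (use yb in auto)
    define S where "S = Sup ?Y"
    have yS: "y s z \<le> S" if "s \<in> ?I" "z \<in> closure \<Omega>" for s z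
      unfolding S_def by (rule cSup_upper[OF _ bdd]) (use that in force)
    have S0: "0 < S" using yS[OF tx] ypos by linarith
    \<comment> \<open>The defect \<open>e\<close> of the near-maximum fixes the size \<open>K\<close> of the penalty: \<open>K\<close> times its growth on the sphere
      exceeds \<open>e\<close>, and its Laplacian is absorbed by the slack \<open>\<beta>\<close>.\<close>
    define e where "e = min (S / 4) (\<beta> * (r0 / 8)\<^sup>2 / (16 * ?d))"
    have e: "0 < e" "e \<le> S / 4" using S0 \<beta> r0 by (auto simp: e_def)
    define K where "K = 4 * e / (r0 / 8)\<^sup>2"
    have K0: "0 < K" using e r0 by (simp add: K_def)
    have Kr: "K * (r0 / 8)\<^sup>2 = 4 * e" using r0 by (simp add: K_def)
    have Kb: "K * (2 * ?d) < \<beta>"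
    proof -
      have "e \<le> \<beta> * (r0 / 8)\<^sup>2 / (16 * ?d)" by (simp add: e_def)
      then have "e * (16 * ?d) \<le> \<beta> * (r0 / 8)\<^sup>2" by (simp add: pos_le_divide_eq)
      moreover have "2 * (K * (2 * ?d)) * (r0 / 8)\<^sup>2 = e * (16 * ?d)"
      proof -
        have "2 * (K * (2 * ?d)) * (r0 / 8)\<^sup>2 = 4 * ?d * (K * (r0 / 8)\<^sup>2)" by simp
        then show ?thesis unfolding Kr by simp
      qed
      ultimately have "2 * (K * (2 * ?d)) * (r0 / 8)\<^sup>2 \<le> \<beta> * (r0 / 8)\<^sup>2" by (simp only:)
      then have "2 * (K * (2 * ?d)) \<le> \<beta>" using r0 by simp
      moreover have "0 < K * (2 * ?d)" using K0 by simp
      ultimately show ?thesis by linarith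
    qed
    have "?Y \<noteq> {}" using tx by auto
    have "S - e < Sup ?Y" using e by (simp add: S_def)
    then obtain p where "p \<in> ?Y" "S - e < p"
      using less_cSup_iff[OF \<open>?Y \<noteq> {}\<close> bdd] by blast
    then obtain t1 x1 where t1: "t1 \<in> ?I" "x1 \<in> closure \<Omega>" "S - e < y t1 x1" by force
    obtain m where m: "norm m \<le> 3 / 8 * (r0 / 8)"
      "\<And>q. q \<in> frontier \<Omega> \<Longrightarrow> dist x1 q \<le> r0 / 8 \<Longrightarrow> 2 * ((q - x1) \<bullet> n q) - n q \<bullet> m < 0"
      using local_barrier[OF t1(2)] by blast
    define \<zeta> where "\<zeta> = (\<lambda>x. (x - x1) \<bullet> (x - x1) - (x - x1) \<bullet> m)"
    have zb: "\<bar>(z - x1) \<bullet> m\<bar> \<le> 3 / 8 * (r0 / 8)\<^sup>2" if "dist x1 z \<le> r0 / 8" for z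
    proof -
      have "\<bar>(z - x1) \<bullet> m\<bar> \<le> norm (z - x1) * norm m" by (rule Cauchy_Schwarz_ineq2)
      also have "\<dots> \<le> (r0 / 8) * (3 / 8 * (r0 / 8))"
        using that m(1) r0 by (intro mult_mono) (auto simp: dist_norm norm_minus_commute)
      finally show ?thesis by (simp add: power2_eq_square)
    qed
    have z_lo: "- 2 * e \<le> K * \<zeta> z" if "dist x1 z \<le> r0 / 8" for z
    proof -
      have "- (3 / 8 * (r0 / 8)\<^sup>2) \<le> \<zeta> z" using zb[OF that] inner_ge_zero[of "z - x1"] unfolding \<zeta>_def by linarith
      then have "K * (- (3 / 8 * (r0 / 8)\<^sup>2)) \<le> K * \<zeta> z" using K0 by (intro mult_left_mono) auto
      then show ?thesis using Kr e by (simp add: algebra_simps)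
    qed
    have z_sph: "2 * e \<le> K * \<zeta> z" if "dist x1 z = r0 / 8" for z
    proof -
      have "(z - x1) \<bullet> (z - x1) = (r0 / 8)\<^sup>2"
        unfolding that[symmetric] by (simp add: dot_square_norm dist_norm norm_minus_commute)
      then have "5 / 8 * (r0 / 8)\<^sup>2 \<le> \<zeta> z" using zb[of z] that unfolding \<zeta>_def by (simp add: abs_le_iff)
      then have "K * (5 / 8 * (r0 / 8)\<^sup>2) \<le> K * \<zeta> z" using K0 by (intro mult_left_mono) auto
      then show ?thesis using Kr e by (simp add: algebra_simps)
    qed
    define C where "C = ?I \<times> (closure \<Omega> \<inter> cball x1 (r0 / 8))"
    define z where "z = (\<lambda>t x. a t * w t x - ((m0 + \<beta> * (t - T) + (S - e)) + K * \<zeta> x))"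
    have zy: "z t x = y t x - (S - e) - K * \<zeta> x" for t x by (simp add: z_def y_def)
    have compC: "compact C" unfolding C_def by (intro compact_Times closed_Int_compact) auto
    have contw: "continuous_on C (\<lambda>(t, x). w t x)"
      by (rule continuous_on_subset[OF cont]) (auto simp: C_def)
    have contz: "continuous_on C (\<lambda>(t, x). z t x)"
      unfolding z_def case_prod_beta \<zeta>_def a_def
      by (intro continuous_intros contw[unfolded case_prod_beta])
    have lapz: "lap_at (\<lambda>x. K * \<zeta> x) v (K * (2 * ?d - 0))" for v
      unfolding \<zeta>_def by (intro lap_at_cmult lap_at_diff lap_at_sq lap_at_inner)
    have "z t1 x1 \<le> 0"
    proof (rule parabolic_max_principle[OF compC contz])
      show "(t1, x1) \<in> C" using t1 r0 by (auto simp: C_def)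
      fix s v assume sv: "(s, v) \<in> C" and pos: "0 < z s v"
      have s: "T \<le> s" "s \<le> T'" and v: "v \<in> closure \<Omega>" "dist x1 v \<le> r0 / 8"
        using sv by (auto simp: C_def)
      have ysv: "y s v \<le> S" using yS s v by auto
      have v': "dist x1 v < r0 / 8"
        using v(2) z_sph[of v] pos ysv e unfolding zy by (cases "dist x1 v = r0 / 8") auto
      have ypos: "0 < y s v" using z_lo[OF v(2)] pos e unfolding zy by linarith
      have sT: "T < s"
      proof (rule ccontr)
        assume "\<not> T < s" then have "s = T" using s by simp
        with ypos init[OF v(1)] aT show False by (simp add: y_def)
      qed
      have wpos: "0 < w s v"
      proof -
        have "0 \<le> m0 + \<beta> * (s - T)" using m0 \<beta> s by simp
        then have "0 < a s * w s v" using ypos by (simp add: y_def)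
        then show ?thesis using a0[of s] by (simp add: zero_less_mult_iff)
      qed
      show "(\<exists>s' y. (s', y) \<in> C \<and> z s v < z s' y) \<or>
        (\<exists>r<0. heat_at z s v r \<and> (\<forall>\<^sub>F y in nhds v. (s, y) \<in> C) \<and> (\<forall>\<^sub>F \<tau> in at_left s. (\<tau>, v) \<in> C))"
      proof (cases "v \<in> \<Omega>")
        case True
        obtain r where r: "heat_at w s v r" "r \<le> lam * w s v" using pde[of s v] sT s True wpos by auto
        have h: "heat_at z s v ((- lam * a s * w s v + a s * r) - (\<beta> - K * (2 * ?d - 0)))"
          unfolding z_def
          by (intro heat_at_diff heat_at_time_mult[OF r(1) da] heat_at_separated lapz)
             (auto intro!: derivative_eq_intros)
        have "a s * r \<le> a s * (lam * w s v)" using r(2) a0[of s] by simp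
        then have neg: "(- lam * a s * w s v + a s * r) - (\<beta> - K * (2 * ?d - 0)) < 0"
          using Kb by (simp add: algebra_simps)
        have "\<forall>\<^sub>F y in nhds v. y \<in> \<Omega> \<inter> ball x1 (r0 / 8)"
          by (rule eventually_nhds_in_open) (use open_dom True v' in auto)
        then have ev1: "\<forall>\<^sub>F y in nhds v. (s, y) \<in> C"
          by eventually_elim (use s closure_subset in \<open>auto simp: C_def\<close>)
        have ev2: "\<forall>\<^sub>F \<tau> in at_left s. (\<tau>, v) \<in> C"
          unfolding eventually_at_left_field
          by (rule exI[of _ T]) (use s sT v in \<open>auto simp: C_def\<close>)
        show ?thesis using h neg ev1 ev2 by blast
      next
        case False
        then have q: "v \<in> frontier \<Omega>" using v closure_cases by blast
        let ?l = "\<lambda>\<sigma>. v + \<sigma> *\<^sub>R n v"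
        have "((\<lambda>\<sigma>. K * \<zeta> (?l \<sigma>)) has_real_derivative (K * (2 * ((v - x1) \<bullet> n v) - n v \<bullet> m))) (at 0 within {0..})"
          unfolding \<zeta>_def has_field_derivative_def
          by (auto intro!: derivative_eq_intros simp: inner_commute algebra_simps fun_eq_iff)
        from DERIV_diff[OF DERIV_cmult[OF nd[of s v], of "a s"] DERIV_add[OF DERIV_const this, of "m0 + \<beta> * (s - T) + (S - e)"]]
        have D: "((\<lambda>\<sigma>. z s (?l \<sigma>)) has_real_derivative (- (K * (2 * ((v - x1) \<bullet> n v) - n v \<bullet> m)))) (at 0 within {0..})"
          using sT s q unfolding z_def by simp
        have "K * (2 * ((v - x1) \<bullet> n v) - n v \<bullet> m) < 0"
          using m(2)[OF q v(2)] K0 by (simp add: mult_pos_neg)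
        then obtain d where d: "d > 0" "\<And>h. 0 < h \<Longrightarrow> h < d \<Longrightarrow> z s (?l 0) < z s (?l h)"
          using has_real_derivative_pos_inc_right[OF D] by auto
        define h where "h = Min {d / 2, r0, r0 / 8 - dist x1 v}"
        have h: "0 < h" "h < d" "h \<le> r0" "h \<le> r0 / 8 - dist x1 v"
          using d r0 v' by (auto simp: h_def)
        have "?l h \<in> \<Omega>" using inward_inside(1)[OF q q] h r0 by simp
        moreover have "dist x1 (?l h) \<le> r0 / 8"
          using dist_triangle[of x1 "?l h" v] h norm_n[OF q] by (simp add: dist_norm)
        ultimately have "(s, ?l h) \<in> C" using s closure_subset by (auto simp: C_def)
        moreover have "z s v < z s (?l h)" using d(2)[OF h(1,2)] by simp
        ultimately show ?thesis by blast
      qed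
    qed
    moreover have "z t1 x1 > 0" using t1(3) by (simp add: zy \<zeta>_def)
    ultimately show False by simp
  qed
  have "a t * w t x \<le> m0 + e" if e: "0 < e" for e
  proof -
    define \<beta> where "\<beta> = e / (1 + (t - T))"
    have p: "0 < 1 + (t - T)" using tx by simp
    have "\<beta> * (t - T) \<le> \<beta> * (1 + (t - T))" using e p by (intro mult_left_mono) (auto simp: \<beta>_def)
    also have "\<dots> = e" using p by (simp add: \<beta>_def)
    finally show ?thesis using main[of \<beta> t x] tx e p by (simp add: \<beta>_def)
  qed
  then have "a t * w t x \<le> m0" by (rule field_le_epsilon)
  then have "exp (lam * (t - T)) * (a t * w t x) \<le> exp (lam * (t - T)) * m0" by simp
  moreover have "exp (lam * (t - T)) * (a t * w t x) = (exp (lam * (t - T)) * a t) * w t x" by simp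
  moreover have "exp (lam * (t - T)) * a t = 1" unfolding a_def by (simp flip: exp_add)
  ultimately have "1 * w t x \<le> exp (lam * (t - T)) * m0" by (simp only:)
  then show ?thesis by (simp add: mult.commute)
qed

end


section \<open>A barrier at boundary points\<close>

lemma norm_directional_derivative_le:
  fixes g :: "'a::real_normed_vector \<Rightarrow> 'b::real_normed_vector"
  assumes d: "(g has_derivative g') (at x)" and k0: "0 < k0"
    and b: "\<And>k. 0 < k \<Longrightarrow> k \<le> k0 \<Longrightarrow> norm (g (x + k *\<^sub>R v) - g x) \<le> k * c"
  shows "norm (g' v) \<le> c"
proof -
  have "((\<lambda>k. g (x + k *\<^sub>R v)) has_derivative (\<lambda>k. g' (k *\<^sub>R v))) (at 0)"
    by (rule has_derivative_compose[of "\<lambda>k. x + k *\<^sub>R v" "\<lambda>k. k *\<^sub>R v" 0 UNIV g g'])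
       (use d in \<open>auto intro!: derivative_eq_intros\<close>)
  then have "((\<lambda>k. g (x + k *\<^sub>R v)) has_vector_derivative g' v) (at 0)"
    unfolding has_vector_derivative_def
    using linear_scale[OF has_derivative_linear[OF d]] by simp
  then have "((\<lambda>k. g (x + k *\<^sub>R v)) has_vector_derivative g' v) (at 0 within {0<..})"
    by (rule has_vector_derivative_at_within)
  then have "((\<lambda>y. (1 / norm (y - 0)) *\<^sub>R (g (x + y *\<^sub>R v) - (g (x + 0 *\<^sub>R v) + (y - 0) *\<^sub>R g' v))) \<longlongrightarrow> 0) (at 0 within {0<..})"
    unfolding has_vector_derivative_def has_derivative_within by blast
  then have "((\<lambda>k. (g (x + k *\<^sub>R v) - g x) /\<^sub>R k - g' v) \<longlongrightarrow> 0) (at 0 within {0<..})"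
    by (rule Lim_transform_eventually)
       (auto simp: eventually_at_filter scaleR_diff_right scaleR_add_right divide_inverse intro!: always_eventually)
  then have "((\<lambda>k. (g (x + k *\<^sub>R v) - g x) /\<^sub>R k) \<longlongrightarrow> g' v) (at 0 within {0<..})"
    by (rule Lim_null[THEN iffD2])
  then have lim: "((\<lambda>k. norm ((g (x + k *\<^sub>R v) - g x) /\<^sub>R k)) \<longlongrightarrow> norm (g' v)) (at_right 0)"
    by (rule tendsto_norm)
  show ?thesis
  proof (rule tendsto_upperbound[OF lim])
    show "\<forall>\<^sub>F k in at_right 0. norm ((g (x + k *\<^sub>R v) - g x) /\<^sub>R k) \<le> c"
      unfolding eventually_at_right_field
    proof (rule exI[of _ k0], intro conjI k0 allI impI)
      fix k :: real assume k: "0 < k" "k < k0"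
      have "norm ((g (x + k *\<^sub>R v) - g x) /\<^sub>R k) = norm (g (x + k *\<^sub>R v) - g x) / k"
        using k by (simp add: divide_inverse mult.commute)
      also have "\<dots> \<le> c" using b[of k] k by (simp add: pos_divide_le_eq mult.commute)
      finally show "norm ((g (x + k *\<^sub>R v) - g x) /\<^sub>R k) \<le> c" .
    qed
  qed simp
qed

context two_sided_ball
begin

text \<open>The power of \<open>x\<close> with respect to the exterior ball at \<open>p\<close> of half the radius. Halving the
radius makes it at least \<open>|x - p|\<^sup>2 / 2\<close> on the closure of the domain, rather than only nonnegative.\<close>

definition tangent_power :: "'a \<Rightarrow> 'a \<Rightarrow> real" where
  "tangent_power p x = (norm (x - p))\<^sup>2 + r0 * ((x - p) \<bullet> n p)"

lemma tangent_power_lower: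
  assumes "p \<in> frontier \<Omega>" "x \<in> closure \<Omega>"
  shows "(norm (x - p))\<^sup>2 / 2 \<le> tangent_power p x"
  using outer_inner[OF assms] by (simp add: tangent_power_def)

lemma tangent_power_sqrt_lower:
  assumes "p \<in> frontier \<Omega>" "x \<in> closure \<Omega>"
  shows "dist p x \<le> sqrt 2 * sqrt (tangent_power p x)"
proof -
  have "(dist p x)\<^sup>2 \<le> 2 * tangent_power p x" using tangent_power_lower[OF assms] by (simp add: dist_norm norm_minus_commute)
  then have "dist p x \<le> sqrt (2 * tangent_power p x)" by (rule real_le_rsqrt)
  then show ?thesis by (simp add: real_sqrt_mult)
qed

lemma tangent_power_upper:
  assumes "p \<in> frontier \<Omega>" "dist p x \<le> r"
  shows "tangent_power p x \<le> r\<^sup>2 + r0 * r"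
proof -
  have r: "norm (x - p) \<le> r" using assms by (simp add: dist_norm norm_minus_commute)
  have "(x - p) \<bullet> n p \<le> norm (x - p) * norm (n p)" by (rule norm_cauchy_schwarz)
  then have "(x - p) \<bullet> n p \<le> r" using r norm_n[OF assms(1)] by simp
  then have "r0 * ((x - p) \<bullet> n p) \<le> r0 * r" using r0 by simp
  moreover have "(norm (x - p))\<^sup>2 \<le> r\<^sup>2" using r by (intro power_mono) auto
  ultimately show ?thesis by (simp add: tangent_power_def)
qed

text \<open>Near its zero set the square root is very concave in the radial direction, and this outweighs the
curvature of the spheres.\<close>

lemma lap_at_sqrt_tangent_power:
  assumes p: "p \<in> frontier \<Omega>" and pos: "0 < tangent_power p x" and small: "real DIM('a) * tangent_power p x \<le> r0\<^sup>2 / 8"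
  shows "\<exists>l. lap_at (\<lambda>x. sqrt (tangent_power p x)) x l \<and> l \<le> - (r0\<^sup>2 / (8 * (tangent_power p x * sqrt (tangent_power p x))))"
proof -
  define c where "c = p - (r0 / 2) *\<^sub>R n p"
  have Qc: "tangent_power p y = (y - c) \<bullet> (y - c) - r0\<^sup>2 / 4" for y
  proof -
    have 1: "y - c = (y - p) + (r0 / 2) *\<^sub>R n p" by (simp add: c_def)
    have "(norm (y - c))\<^sup>2 = (norm (y - p))\<^sup>2 + r0 * ((y - p) \<bullet> n p) + r0\<^sup>2 / 4"
      unfolding 1 norm_add_scaleR_sq using norm_n[OF p] by (simp add: power_divide)
    then show ?thesis by (simp add: tangent_power_def power2_norm_eq_inner)
  qed
  let ?q = "(x - c) \<bullet> (x - c)"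
  let ?Q = "tangent_power p x"
  let ?g1 = "\<lambda>s. inverse (sqrt (s - r0\<^sup>2 / 4)) / 2"
  have qpos: "r0\<^sup>2 / 4 < ?q" using pos Qc[of x] by simp
  have ev: "\<forall>\<^sub>F s in nhds ?q. ((\<lambda>s. sqrt (s - r0\<^sup>2 / 4)) has_real_derivative ?g1 s) (at s)"
  proof -
    have "\<forall>\<^sub>F s in nhds ?q. s \<in> {r0\<^sup>2 / 4<..}"
      by (rule eventually_nhds_in_open) (use qpos in auto)
    then show ?thesis
      by eventually_elim (auto intro!: derivative_eq_intros)
  qed
  have S: "sqrt ?Q * sqrt ?Q = ?Q" using pos by simp
  have d2: "(?g1 has_real_derivative (- (1 / 4) / (?Q * sqrt ?Q))) (at ?q)"
  proof -
    have e: "?q - r0\<^sup>2 / 4 = ?Q" using Qc[of x] by simp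
    have R: "0 < sqrt ?Q" using pos by simp
    have "(?g1 has_real_derivative - (inverse (sqrt (?q - r0\<^sup>2 / 4)) * (inverse (sqrt (?q - r0\<^sup>2 / 4)) / 2) * inverse (sqrt (?q - r0\<^sup>2 / 4))) / 2) (at ?q)"
      using qpos by (auto intro!: derivative_eq_intros)
    moreover have "- (inverse R * (inverse R / 2) * inverse R) / 2 = - (1 / 4) / (R * R * R)" if "0 < R" for R :: real
      using that by (simp add: field_simps)
    ultimately show ?thesis unfolding e using R S by metis
  qed
  have "lap_at (\<lambda>y. sqrt ((y - c) \<bullet> (y - c) - r0\<^sup>2 / 4)) x
      (4 * (- (1 / 4) / (?Q * sqrt ?Q)) * ?q + 2 * real DIM('a) * ?g1 ?q)"
    by (rule lap_at_comp_sq[OF ev d2])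
  also have "4 * (- (1 / 4) / (?Q * sqrt ?Q)) * ?q + 2 * real DIM('a) * ?g1 ?q
     = (real DIM('a) * ?Q - (?Q + r0\<^sup>2 / 4)) / (?Q * sqrt ?Q)"
  proof -
    have gen: "4 * (- (1 / 4) / (Q * R)) * (Q + a) + 2 * d * (inverse R / 2) = (d * Q - (Q + a)) / (Q * R)"
      if "0 < R" "Q = R * R" for R Q a d :: real
      using that by (simp add: field_simps)
    have e: "?q - r0\<^sup>2 / 4 = ?Q" "?q = ?Q + r0\<^sup>2 / 4" using Qc[of x] by simp_all
    show ?thesis unfolding e(1) unfolding e(2) by (rule gen) (use pos in auto)
  qed
  also have "(\<lambda>y. sqrt ((y - c) \<bullet> (y - c) - r0\<^sup>2 / 4)) = (\<lambda>y. sqrt (tangent_power p y))"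
    by (simp add: Qc)
  finally have l: "lap_at (\<lambda>y. sqrt (tangent_power p y)) x ((real DIM('a) * ?Q - (?Q + r0\<^sup>2 / 4)) / (?Q * sqrt ?Q))" .
  have "(real DIM('a) * ?Q - (?Q + r0\<^sup>2 / 4)) / (?Q * sqrt ?Q) \<le> (- (r0\<^sup>2 / 8)) / (?Q * sqrt ?Q)"
    using pos small by (intro divide_right_mono) auto
  also have "\<dots> = - (r0\<^sup>2 / (8 * (?Q * sqrt ?Q)))" by simp
  finally show ?thesis using l by blast
qed

text \<open>A function that is small on the boundary near \<open>p\<close> is small inside near \<open>p\<close>. The square root of the
tangent power dominates \<open>|x - p|\<close> on the boundary and any constant away from \<open>p\<close>, and
its strongly negative Laplacian pays for the term \<open>A / \<tau> * (t0 - t)\<close> that absorbs the unknown initial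
values.\<close>

lemma dirichlet_barrier:
  assumes p: "p \<in> frontier \<Omega>" and r: "0 < r" "r \<le> r0 / (16 * real DIM('a))" and \<tau>: "0 < \<tau>" and C: "0 \<le> C"
    and cont: "continuous_on ({t0 - \<tau>..t0} \<times> (closure \<Omega> \<inter> cball p r)) (\<lambda>(t, x). v t x)"
    and A: "\<And>t x. t \<in> {t0 - \<tau>..t0} \<Longrightarrow> x \<in> closure \<Omega> \<inter> cball p r \<Longrightarrow> v t x \<le> A" and A0: "0 \<le> A"
    and B: "\<And>t x. t \<in> {t0 - \<tau>..t0} \<Longrightarrow> x \<in> frontier \<Omega> \<inter> cball p r \<Longrightarrow> v t x \<le> B * dist p x + e"
    and e: "0 \<le> e" and B0: "0 \<le> B"
    and N: "\<And>t x. t \<in> {t0 - \<tau><..t0} \<Longrightarrow> x \<in> \<Omega> \<inter> ball p r \<Longrightarrow> \<exists>s. heat_at v t x s \<and> s \<le> N" and N0: "0 \<le> N"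
    and C1: "sqrt 2 * A \<le> C * r" and C2: "sqrt 2 * B \<le> C"
    and C3: "8 * (A / \<tau> + N) * ((2 * r0 * r) * sqrt (2 * r0 * r)) < C * r0\<^sup>2"
    and x: "x \<in> closure \<Omega> \<inter> cball p r"
  shows "v t0 x \<le> C * sqrt (tangent_power p x) + e"
proof -
  let ?d = "real DIM('a)"
  have d1: "1 \<le> ?d" by (simp add: Suc_leI)
  have rd: "?d * r \<le> r0 / 16" using r(2) d1 by (simp add: field_simps)
  have rr0: "r \<le> r0" 
  proof -
    have "1 * r \<le> ?d * r" using d1 r by (intro mult_right_mono) auto
    then show ?thesis using rd r0 by linarith
  qed
  define K where "K = {t0 - \<tau>..t0} \<times> (closure \<Omega> \<inter> cball p r)"
  define z where "z = (\<lambda>t x. v t x - ((e + A / \<tau> * (t0 - t)) + C * sqrt (tangent_power p x)))"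
  have K: "compact K" unfolding K_def by (intro compact_Times closed_Int_compact) auto
  have contz: "continuous_on K (\<lambda>(t, x). z t x)"
    unfolding z_def case_prod_beta tangent_power_def
    by (intro continuous_intros cont[folded K_def, unfolded case_prod_beta]) (use \<tau> in auto)
  have "z t0 x \<le> 0"
  proof (rule parabolic_max_principle[OF K contz])
    show "(t0, x) \<in> K" using x \<tau> by (auto simp: K_def)
    fix t x assume tx: "(t, x) \<in> K" and pos: "0 < z t x"
    have t: "t0 - \<tau> \<le> t" "t \<le> t0" and x: "x \<in> closure \<Omega>" "dist p x \<le> r"
      using tx by (auto simp: K_def)
    let ?Q = "tangent_power p x"
    have lo: "dist p x \<le> sqrt 2 * sqrt ?Q" by (rule tangent_power_sqrt_lower[OF p x(1)])
    have vA: "v t x \<le> A" using A t x by auto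
    have At: "0 \<le> A / \<tau> * (t0 - t)" using A0 \<tau> t by simp
    have "0 \<le> (norm (x - p))\<^sup>2 / 2" by simp
    then have Q0: "0 \<le> ?Q" using tangent_power_lower[OF p x(1)] by linarith
    then have Cs: "0 \<le> C * sqrt ?Q" using C by simp
    have nf: "x \<notin> frontier \<Omega>"
    proof
      assume f: "x \<in> frontier \<Omega>"
      have "v t x \<le> B * dist p x + e" using B t x f by auto
      also have "B * dist p x \<le> B * (sqrt 2 * sqrt ?Q)" using lo B0 by (intro mult_left_mono)
      also have "\<dots> = (sqrt 2 * B) * sqrt ?Q" by simp
      also have "\<dots> \<le> C * sqrt ?Q"
        using C2 Q0 by (intro mult_right_mono) auto
      finally show False using pos At by (simp add: z_def)
    qed
    have dr: "dist p x < r"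
    proof (rule ccontr)
      assume "\<not> dist p x < r"
      then have dr: "dist p x = r" using x by simp
      have "sqrt 2 * A \<le> C * dist p x" using C1 dr by simp
      also have "\<dots> \<le> C * (sqrt 2 * sqrt ?Q)" using lo C by (intro mult_left_mono)
      finally have "sqrt 2 * A \<le> sqrt 2 * (C * sqrt ?Q)" by (simp add: algebra_simps)
      then have "A \<le> C * sqrt ?Q" by simp
      then show False using pos At vA e by (simp add: z_def)
    qed
    have tt: "t0 - \<tau> < t"
    proof (rule ccontr)
      assume "\<not> t0 - \<tau> < t"
      then have "t0 - t = \<tau>" using t by simp
      then have "A / \<tau> * (t0 - t) = A" using \<tau> by simp
      then show False using pos Cs vA e by (simp add: z_def)
    qed
    have xin: "x \<in> \<Omega>" using x nf closure_cases by blast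
    have "x \<noteq> p" using xin p frontier_eq by auto
    then have "0 < (norm (x - p))\<^sup>2 / 2" by simp
    then have Qpos: "0 < ?Q" using tangent_power_lower[OF p x(1)] by linarith
    have "r\<^sup>2 \<le> r0 * r" using rr0 r by (simp add: power2_eq_square)
    then have Qup: "?Q \<le> 2 * r0 * r" using tangent_power_upper[OF p x(2)] by simp
    have "?d * ?Q \<le> ?d * (2 * r0 * r)" using Qup by (intro mult_left_mono) auto
    also have "\<dots> = 2 * r0 * (?d * r)" by simp
    also have "\<dots> \<le> 2 * r0 * (r0 / 16)" using rd r0 by (intro mult_left_mono) auto
    finally have "?d * ?Q \<le> r0\<^sup>2 / 8" by (simp add: power2_eq_square)
    then obtain l where l: "lap_at (\<lambda>x. sqrt (tangent_power p x)) x l" "l \<le> - (r0\<^sup>2 / (8 * (?Q * sqrt ?Q)))"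
      using lap_at_sqrt_tangent_power[OF p Qpos] by blast
    obtain s where s: "heat_at v t x s" "s \<le> N" using N[of t x] t tt xin dr by auto
    have hz: "heat_at z t x (s - (- (A / \<tau>) - C * l))"
      unfolding z_def
      by (intro heat_at_diff s heat_at_separated lap_at_cmult l) (rule derivative_eq_intros refl | simp)+
    have "?Q * sqrt ?Q \<le> (2 * r0 * r) * sqrt (2 * r0 * r)"
      using Qup Qpos r0 r by (intro mult_mono) auto
    then have "8 * (A / \<tau> + N) * (?Q * sqrt ?Q) \<le> 8 * (A / \<tau> + N) * ((2 * r0 * r) * sqrt (2 * r0 * r))"
      using A0 N0 \<tau> by (intro mult_left_mono) auto
    then have "8 * (A / \<tau> + N) * (?Q * sqrt ?Q) < C * r0\<^sup>2" using C3 by simp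
    then have "A / \<tau> + N < C * (r0\<^sup>2 / (8 * (?Q * sqrt ?Q)))" using Qpos by (simp add: field_simps)
    moreover have "C * l \<le> C * - (r0\<^sup>2 / (8 * (?Q * sqrt ?Q)))" using l(2) C by (rule mult_left_mono)
    ultimately have neg: "s - (- (A / \<tau>) - C * l) < 0" using s(2) by simp
    have "\<forall>\<^sub>F y in nhds x. y \<in> \<Omega> \<inter> ball p r"
      by (rule eventually_nhds_in_open) (use open_dom xin dr in auto)
    then have ev1: "\<forall>\<^sub>F y in nhds x. (t, y) \<in> K"
      by eventually_elim (use t closure_subset in \<open>auto simp: K_def\<close>)
    have ev2: "\<forall>\<^sub>F s in at_left t. (s, x) \<in> K"
      unfolding eventually_at_left_field
      by (rule exI[of _ "t0 - \<tau>"]) (use t tt x in \<open>auto simp: K_def\<close>)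
    show "(\<exists>s y. (s, y) \<in> K \<and> z t x < z s y) \<or>
        (\<exists>s<0. heat_at z t x s \<and> (\<forall>\<^sub>F y in nhds x. (t, y) \<in> K) \<and> (\<forall>\<^sub>F \<tau> in at_left t. (\<tau>, x) \<in> K))"
      using hz neg ev1 ev2 by blast
  qed
  then show ?thesis by (simp add: z_def)
qed

end

section \<open>Solutions of the Neumann problem\<close>

text \<open>A bounded solution of the Neumann problem for all times. The second-difference condition on \<open>f\<close> is
what a Lipschitz derivative gives; it is the form in which this property is used.\<close>

locale neumann_flow = two_sided_ball \<Omega> n r0 for \<Omega> :: "'a::euclidean_space set" and n r0 +
  fixes f :: "real \<Rightarrow> real" and L :: real
    and u u_t :: "real \<Rightarrow> 'a \<Rightarrow> real" and G :: "real \<Rightarrow> 'a \<Rightarrow> 'a" and H :: "real \<Rightarrow> 'a \<Rightarrow> 'a \<Rightarrow>\<^sub>L 'a"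
  assumes L: "0 < L" and f0: "f 0 = 0"
    and f_lip: "\<And>a b. a \<in> {0..1} \<Longrightarrow> b \<in> {0..1} \<Longrightarrow> \<bar>f a - f b\<bar> \<le> L * \<bar>a - b\<bar>"
    and f_second: "\<And>a b c d. a \<in> {0..1} \<Longrightarrow> b \<in> {0..1} \<Longrightarrow> c \<in> {0..1} \<Longrightarrow> d \<in> {0..1} \<Longrightarrow>
        \<bar>f a - f b - (f c - f d)\<bar> \<le> L * \<bar>a - b - (c - d)\<bar> + L * (\<bar>c - d\<bar> + \<bar>a - b\<bar>) * \<bar>b - d\<bar>"
    and u01: "\<And>t x. x \<in> closure \<Omega> \<Longrightarrow> u t x \<in> {0..1}"
    and cont_u: "continuous_on (UNIV \<times> closure \<Omega>) (\<lambda>(t, x). u t x)"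
    and cont_G: "continuous_on (UNIV \<times> closure \<Omega>) (\<lambda>(t, x). G t x)"
    and grad_hess: "\<And>t. has_grad_hess (u t) (G t) (H t) \<Omega>"
    and time_deriv: "\<And>t x. x \<in> \<Omega> \<Longrightarrow> ((\<lambda>\<tau>. u \<tau> x) has_real_derivative u_t t x) (at t)"
    and pde: "\<And>t x. x \<in> \<Omega> \<Longrightarrow> u_t t x - trace_of (H t x) = f (u t x)"
    and neumann: "\<And>t q. q \<in> frontier \<Omega> \<Longrightarrow> G t q \<bullet> n q = 0"
begin

lemma heat_u: "x \<in> \<Omega> \<Longrightarrow> heat_at u t x (f (u t x))"
  unfolding heat_at_def
  using time_deriv lap_at_grad_hess[OF grad_hess open_dom] pde by metis

lemma dom_closure: "x \<in> \<Omega> \<Longrightarrow> x \<in> closure \<Omega>"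
  using closure_subset by blast

lemma frontier_closure: "x \<in> frontier \<Omega> \<Longrightarrow> x \<in> closure \<Omega>"
  using closure_cases by blast

lemma f_bound: "a \<in> {0..1} \<Longrightarrow> \<bar>f a\<bar> \<le> L"
proof -
  assume a: "a \<in> {0..1}"
  have "\<bar>f a - f 0\<bar> \<le> L * \<bar>a - 0\<bar>" by (rule f_lip) (use a in auto)
  also have "\<dots> \<le> L * 1" using a L by (intro mult_left_mono) auto
  finally show ?thesis by (simp add: f0)
qed

lemma grad: "x \<in> \<Omega> \<Longrightarrow> GDERIV (u t) x :> G t x"
  using grad_hess unfolding has_grad_hess_def by blast

lemma hess: "x \<in> \<Omega> \<Longrightarrow> (G t has_derivative blinfun_apply (H t x)) (at x)"
  using grad_hess unfolding has_grad_hess_def by blast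

lemma cont_u_sub: "K \<subseteq> closure \<Omega> \<Longrightarrow> continuous_on (I \<times> K) (\<lambda>(t, x). u t x)"
  by (rule continuous_on_subset[OF cont_u]) auto

lemma cont_G_sub: "K \<subseteq> closure \<Omega> \<Longrightarrow> continuous_on (I \<times> K) (\<lambda>(t, x). G t x)"
  by (rule continuous_on_subset[OF cont_G]) auto

lemma cont_u_x: "continuous_on (closure \<Omega>) (u t)"
  by (rule continuous_on_compose2[OF cont_u, of _ "\<lambda>x. (t, x)", simplified]) (auto intro!: continuous_intros)

lemma cont_G_x: "continuous_on (closure \<Omega>) (G t)"
  by (rule continuous_on_compose2[OF cont_G, of _ "\<lambda>x. (t, x)", simplified]) (auto intro!: continuous_intros)

lemma u_mvt:
  assumes k: "0 < k" and int: "\<And>s. 0 < s \<Longrightarrow> s < k \<Longrightarrow> x + s *\<^sub>R v \<in> \<Omega>"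
    and cl: "x \<in> closure \<Omega>" "x + k *\<^sub>R v \<in> closure \<Omega>"
  obtains s where "0 < s" "s < k" "u t (x + k *\<^sub>R v) - u t x = k * (G t (x + s *\<^sub>R v) \<bullet> v)"
proof -
  have cl': "x + s *\<^sub>R v \<in> closure \<Omega>" if "s \<in> {0..k}" for s
    using that cl int[of s] dom_closure by (cases "s = 0 \<or> s = k") auto
  have "continuous_on {0..k} (\<lambda>s. u t (x + s *\<^sub>R v))"
    by (rule continuous_on_compose2[OF cont_u_x]) (use cl' in \<open>auto intro!: continuous_intros\<close>)
  moreover have "((\<lambda>s. u t (x + s *\<^sub>R v)) has_derivative (\<lambda>h. (h *\<^sub>R v) \<bullet> G t (x + s *\<^sub>R v))) (at s)"
    if "0 < s" "s < k" for s
    by (rule has_derivative_compose[of "\<lambda>s. x + s *\<^sub>R v" "\<lambda>h. h *\<^sub>R v" s UNIV "u t"])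
       (use grad[OF int[OF that], of t] in \<open>auto simp: gderiv_def intro!: derivative_eq_intros\<close>)
  ultimately obtain s where "0 < s" "s < k"
      "u t (x + k *\<^sub>R v) - u t (x + 0 *\<^sub>R v) = ((k - 0) *\<^sub>R v) \<bullet> G t (x + s *\<^sub>R v)"
    using mvt[OF k, of "\<lambda>s. u t (x + s *\<^sub>R v)" "\<lambda>s h. (h *\<^sub>R v) \<bullet> G t (x + s *\<^sub>R v)"] by blast
  then show ?thesis using that[of s] by (simp add: inner_commute)
qed

text \<open>The gradient is continuous up to the boundary, so the difference quotient along the normal is a
value of it near \<open>q\<close>.\<close>

lemma normal_derivative_zero:
  assumes q: "q \<in> frontier \<Omega>"
  shows "((\<lambda>s. u t (q + s *\<^sub>R n q)) has_real_derivative 0) (at 0 within {0..})"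
proof -
  have "((\<lambda>s. (u t (q + s *\<^sub>R n q) - u t q) / s) \<longlongrightarrow> 0) (at 0 within {0..})"
    unfolding tendsto_iff
  proof (intro allI impI)
    fix e :: real assume e: "0 < e"
    obtain d where d: "d > 0" "\<And>x. x \<in> closure \<Omega> \<Longrightarrow> dist x q < d \<Longrightarrow> dist (G t x) (G t q) < e"
      using cont_G_x[of t] e frontier_closure[OF q] unfolding continuous_on_iff by metis
    define d' where "d' = min d r0"
    have d': "0 < d'" "d' \<le> d" "d' \<le> r0" using d r0 by (auto simp: d'_def)
    have "dist ((u t (q + s *\<^sub>R n q) - u t q) / s) 0 < e" if s: "0 < s" "s < d'" for s
    proof -
      have ins: "q + \<sigma> *\<^sub>R n q \<in> \<Omega>" if "0 < \<sigma>" "\<sigma> \<le> s" for \<sigma>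
        using inward_inside(1)[OF q q, of \<sigma>] that s d' r0 by simp
      obtain \<sigma> where \<sigma>: "0 < \<sigma>" "\<sigma> < s" "u t (q + s *\<^sub>R n q) - u t q = s * (G t (q + \<sigma> *\<^sub>R n q) \<bullet> n q)"
        using u_mvt[of s q "n q" t] s ins dom_closure frontier_closure[OF q] by (metis less_eq_real_def)
      have "\<bar>(G t (q + \<sigma> *\<^sub>R n q) - G t q) \<bullet> n q\<bar> \<le> norm (G t (q + \<sigma> *\<^sub>R n q) - G t q) * norm (n q)"
        by (rule Cauchy_Schwarz_ineq2)
      also have "\<dots> < e"
        using d(2)[of "q + \<sigma> *\<^sub>R n q"] ins[of \<sigma>] dom_closure \<sigma> s d' norm_n[OF q] by (simp add: dist_norm)
      finally show ?thesis using \<sigma> s neumann[OF q] by (simp add: inner_diff_left)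
    qed
    then show "\<forall>\<^sub>F s in at 0 within {0..}. dist ((u t (q + s *\<^sub>R n q) - u t q) / s) 0 < e"
      unfolding eventually_at using d' by (intro exI[of _ d']) auto
  qed
  then show ?thesis unfolding has_field_derivative_iff by simp
qed

end


section \<open>Gradient bound up to the boundary\<close>

lemma GDERIV_translate:
  fixes g :: "'a::real_inner \<Rightarrow> real"
  assumes "GDERIV g (x + h) :> d"
  shows "GDERIV (\<lambda>y. g (y + h)) x :> d"
proof -
  have "((\<lambda>y. y + h) has_derivative (\<lambda>v. v)) (at x)" by (auto intro!: derivative_eq_intros)
  from has_derivative_compose[OF this] assms show ?thesis by (simp add: gderiv_def)
qed

context neumann_flow
begin

text \<open>Chosen so that \<open>A * barrier_const / r\<close> satisfies the three conditions on \<open>C\<close> in \<open>dirichlet_barrier\<close> at scale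
\<open>r \<le> 1\<close>, for \<open>A\<close> a bound of the gradient.\<close>

definition barrier_const :: real where "barrier_const = 2 + 16 * (1 + L) * sqrt (2 * r0) / r0"

text \<open>The factor in \<open>interior_gradient_estimate\<close>.\<close>

definition dim_const :: real where "dim_const = real DIM('a) * (1 + 2 * real DIM('a))"
definition modulus_const :: real where "modulus_const = dim_const * (2 * barrier_const * sqrt (3 * r0) + L)"

lemma barrier_const_ge_2: "2 \<le> barrier_const" using L r0 by (simp add: barrier_const_def)

lemma dim_const_ge_1: "1 \<le> dim_const"
proof -
  have d1: "1 \<le> real DIM('a)" by (simp add: Suc_leI)
  then have "1 * 1 \<le> real DIM('a) * (1 + 2 * real DIM('a))" by (intro mult_mono) auto
  then show ?thesis by (simp add: dim_const_def)
qed

lemma modulus_const_pos: "0 < modulus_const"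
  using dim_const_ge_1 barrier_const_ge_2 r0 L by (simp add: modulus_const_def add_nonneg_pos)

lemma small_radius:
  assumes "0 < r" "r \<le> r0 / (16 * real DIM('a))"
  shows "r \<le> r0 / 16"
proof -
  have d1: "1 \<le> real DIM('a)" by (simp add: Suc_leI)
  have "r0 / (16 * real DIM('a)) \<le> r0 / (16 * 1)" using d1 r0 by (intro divide_left_mono) auto
  then show ?thesis using assms by simp
qed

lemma normal_quotient:
  assumes p: "p \<in> frontier \<Omega>" and k: "0 < k" "k \<le> r0 / 4" and x: "x \<in> closure \<Omega>" "dist p x \<le> r0 / 4"
  obtains s where "0 < s" "s < k" "x + s *\<^sub>R n p \<in> \<Omega>"
    "(u t (x + k *\<^sub>R n p) - u t x) / k = G t (x + s *\<^sub>R n p) \<bullet> n p"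
proof -
  have ins: "x + s *\<^sub>R n p \<in> \<Omega>" if "0 < s" "s \<le> k" for s
    using shift_inside[OF p x] that k by auto
  obtain s where "0 < s" "s < k" "u t (x + k *\<^sub>R n p) - u t x = k * (G t (x + s *\<^sub>R n p) \<bullet> n p)"
    using u_mvt[of k x "n p" t] k ins dom_closure x by (metis less_eq_real_def)
  then show ?thesis using that[of s] ins[of s] k by auto
qed

text \<open>On the boundary the derivative in direction \<open>n p\<close> is \<open>G \<bullet> (n p - n x)\<close>, because \<open>G \<bullet> n x = 0\<close>, and hence is at
most \<open>A * |p - x| / r0\<close>. The barrier carries this into the domain. Difference
quotients replace the derivative because only they are regular enough for the maximum principle.\<close>

lemma normal_difference_bound:
  assumes p: "p \<in> frontier \<Omega>" and r: "0 < r" "r \<le> r0 / (16 * real DIM('a))" "r \<le> 1" and A: "0 < A"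
    and GA: "\<And>t x. t \<in> {t0 - 2 * r\<^sup>2..t0} \<Longrightarrow> x \<in> closure \<Omega> \<Longrightarrow> dist p x \<le> 2 * r \<Longrightarrow> norm (G t x) \<le> A"
    and e: "0 < e"
  shows "\<exists>k0>0. k0 \<le> r \<and> (\<forall>k t x. 0 < k \<and> k \<le> k0 \<and> t \<in> {t0 - r\<^sup>2..t0} \<and> x \<in> closure \<Omega> \<and> dist p x \<le> r \<longrightarrow>
    \<bar>(u t (x + k *\<^sub>R n p) - u t x) / k\<bar> \<le> A * barrier_const / r * sqrt (tangent_power p x) + e)"
proof -
  let ?I = "{t0 - 2 * r\<^sup>2..t0}"
  let ?K = "?I \<times> (closure \<Omega> \<inter> cball p (2 * r))"
  have rr: "r \<le> r0 / 16" by (rule small_radius[OF r(1,2)])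
  have "uniformly_continuous_on ?K (\<lambda>(t, x). G t x)"
    by (rule compact_uniformly_continuous[OF cont_G_sub]) (auto intro!: compact_Times closed_Int_compact)
  then obtain \<delta> where \<delta>: "\<delta> > 0"
     "\<And>y z. y \<in> ?K \<Longrightarrow> z \<in> ?K \<Longrightarrow> dist z y < \<delta> \<Longrightarrow> dist ((\<lambda>(t, x). G t x) z) ((\<lambda>(t, x). G t x) y) < e"
    using e unfolding uniformly_continuous_on_def by metis
  define k0 where "k0 = min (\<delta> / 2) r"
  have k0: "0 < k0" "k0 \<le> r" "k0 < \<delta>" using \<delta> r by (auto simp: k0_def)
  have main: "\<bar>(u t1 (x1 + k *\<^sub>R n p) - u t1 x1) / k\<bar> \<le> A * barrier_const / r * sqrt (tangent_power p x1) + e"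
    if k: "0 < k" "k \<le> k0" and t1: "t1 \<in> {t0 - r\<^sup>2..t0}" and x1: "x1 \<in> closure \<Omega>" "dist p x1 \<le> r" for k t1 x1
  proof -
    define v where "v = (\<lambda>t x. (u t (x + k *\<^sub>R n p) - u t x) / k)"
    have kr: "k \<le> r0 / 4" using k k0 rr r0 by linarith
    have sub: "{t1 - r\<^sup>2..t1} \<subseteq> ?I" using t1 by auto
    have vG: "\<exists>y. y \<in> \<Omega> \<and> dist p y \<le> 2 * r \<and> dist x y < \<delta> \<and> v t x = G t y \<bullet> n p"
      if x: "x \<in> closure \<Omega>" "dist p x \<le> r" for t x
    proof -
      have "dist p x \<le> r0 / 4" using x rr r0 by linarith
      from normal_quotient[OF p k(1) kr x(1) this, of t] obtain s where s: "0 < s" "s < k" "x + s *\<^sub>R n p \<in> \<Omega>"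
        "(u t (x + k *\<^sub>R n p) - u t x) / k = G t (x + s *\<^sub>R n p) \<bullet> n p" by blast
      have d: "dist x (x + s *\<^sub>R n p) = s" using s norm_n[OF p] by (simp add: dist_norm)
      have "dist p (x + s *\<^sub>R n p) \<le> 2 * r" "dist x (x + s *\<^sub>R n p) < \<delta>"
        using dist_triangle[of p "x + s *\<^sub>R n p" x] d x s k k0 by auto
      then show ?thesis using s unfolding v_def by blast
    qed
    have vA: "\<bar>v t x\<bar> \<le> A" if t: "t \<in> ?I" and x: "x \<in> closure \<Omega>" "dist p x \<le> r" for t x
    proof -
      obtain y where y: "y \<in> \<Omega>" "dist p y \<le> 2 * r" "v t x = G t y \<bullet> n p" using vG[OF x] by blast
      have "\<bar>G t y \<bullet> n p\<bar> \<le> norm (G t y) * norm (n p)" by (rule Cauchy_Schwarz_ineq2)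
      then show ?thesis using GA[OF t dom_closure[OF y(1)] y(2)] y norm_n[OF p] by simp
    qed
    have vB: "\<bar>v t x\<bar> \<le> A / r0 * dist p x + e" if t: "t \<in> ?I" and x: "x \<in> frontier \<Omega>" "dist p x \<le> r" for t x
    proof -
      obtain y where y: "y \<in> \<Omega>" "dist p y \<le> 2 * r" "dist x y < \<delta>" "v t x = G t y \<bullet> n p"
        using vG[OF frontier_closure[OF x(1)] x(2)] by blast
      have "dist (G t y) (G t x) < e"
        using \<delta>(2)[of "(t, x)" "(t, y)"] t x y dom_closure frontier_closure r by (simp add: dist_Pair_Pair dist_commute)
      then have "norm (G t y - G t x) \<le> e" by (simp add: dist_norm)
      moreover have "\<bar>(G t y - G t x) \<bullet> n p\<bar> \<le> norm (G t y - G t x) * norm (n p)" by (rule Cauchy_Schwarz_ineq2)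
      ultimately have 1: "\<bar>(G t y - G t x) \<bullet> n p\<bar> \<le> e" using norm_n[OF p] by simp
      have "\<bar>G t x \<bullet> (n p - n x)\<bar> \<le> norm (G t x) * norm (n p - n x)" by (rule Cauchy_Schwarz_ineq2)
      also have "\<dots> \<le> A * (dist p x / r0)"
        using GA[OF t frontier_closure[OF x(1)]] x(2) r normal_lipschitz[OF p x(1)] A by (intro mult_mono) auto
      finally have "\<bar>G t x \<bullet> n p\<bar> \<le> A / r0 * dist p x" using neumann[OF x(1)] by (simp add: inner_diff_right)
      then show ?thesis using 1 y(4) by (simp add: inner_diff_left)
    qed
    have vheat: "\<exists>s. heat_at v t x s \<and> \<bar>s\<bar> \<le> L * A" if t: "t \<in> ?I" and x: "x \<in> \<Omega>" "dist p x \<le> r" for t x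
    proof -
      have xk: "x + k *\<^sub>R n p \<in> \<Omega>" using shift_inside[OF p dom_closure[OF x(1)] _ k(1) kr] x rr r0 by auto
      have "heat_at (\<lambda>t x. (1 / k) * (u (t + 0) (x + k *\<^sub>R n p) - u t x)) t x ((1 / k) * (f (u t (x + k *\<^sub>R n p)) - f (u t x)))"
        by (intro heat_at_cmult heat_at_diff heat_at_translate) (use heat_u xk x in auto)
      then have h: "heat_at v t x ((1 / k) * (f (u t (x + k *\<^sub>R n p)) - f (u t x)))"
        by (simp add: v_def)
      have "\<bar>f (u t (x + k *\<^sub>R n p)) - f (u t x)\<bar> \<le> L * \<bar>u t (x + k *\<^sub>R n p) - u t x\<bar>"
        using f_lip u01 dom_closure xk x by blast
      then have "\<bar>(1 / k) * (f (u t (x + k *\<^sub>R n p)) - f (u t x))\<bar> \<le> L * \<bar>v t x\<bar>"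
        using k by (simp add: v_def abs_mult field_simps)
      also have "\<dots> \<le> L * A" using vA[OF t dom_closure[OF x(1)] x(2)] L by simp
      finally show ?thesis using h by blast
    qed
    have "continuous_on (UNIV \<times> (closure \<Omega> \<inter> cball p r)) (\<lambda>q. u (fst q) (snd q + k *\<^sub>R n p))"
    proof (rule continuous_on_compose2[OF cont_u, of _ "\<lambda>q. (fst q, snd q + k *\<^sub>R n p)", simplified])
      show "(\<lambda>q. (fst q, snd q + k *\<^sub>R n p)) ` (UNIV \<times> (closure \<Omega> \<inter> cball p r)) \<subseteq> UNIV \<times> closure \<Omega>"
        using shift_inside[OF p _ _ k(1) kr] rr r0 dom_closure by fastforce
    qed (intro continuous_intros)
    then have vcont: "continuous_on ({t1 - r\<^sup>2..t1} \<times> (closure \<Omega> \<inter> cball p r)) (\<lambda>(t, x). v t x)"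
      unfolding v_def case_prod_beta divide_inverse
      by (intro continuous_intros cont_u_sub[unfolded case_prod_beta]) (auto elim: continuous_on_subset)
    let ?C = "A * barrier_const / r"
    have C0: "0 \<le> ?C" using A barrier_const_ge_2 r by simp
    have sq2: "sqrt 2 \<le> 2" by (rule real_le_lsqrt) auto
    have C1: "sqrt 2 * A \<le> ?C * r"
    proof -
      have "sqrt 2 * A \<le> barrier_const * A" using sq2 barrier_const_ge_2 A by (intro mult_right_mono) auto
      then show ?thesis using r by (simp add: mult.commute)
    qed
    have C2: "sqrt 2 * (A / r0) \<le> ?C"
    proof -
      have "sqrt 2 * (A / r0) \<le> barrier_const * (A / r)"
        using sq2 barrier_const_ge_2 A r rr r0 by (intro mult_mono divide_left_mono) auto
      then show ?thesis by (simp add: mult.commute)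
    qed
    have C3: "8 * (A / r\<^sup>2 + L * A) * ((2 * r0 * r) * sqrt (2 * r0 * r)) < ?C * r0\<^sup>2"
    proof -
      have sr: "sqrt r \<le> 1" using r by simp
      have "L * r\<^sup>2 \<le> L * 1" using L r by (intro mult_left_mono) (auto simp: power_le_one)
      then have "L \<le> L / r\<^sup>2" using r by (simp add: pos_le_divide_eq)
      then have l: "(1 / r\<^sup>2 + L) \<le> (1 + L) / r\<^sup>2" by (simp add: add_divide_distrib)
      have "8 * (A / r\<^sup>2 + L * A) * ((2 * r0 * r) * sqrt (2 * r0 * r)) = (16 * A * r0 * r * sqrt (2 * r0)) * ((1 / r\<^sup>2 + L) * sqrt r)"
        using r r0 by (simp add: real_sqrt_mult algebra_simps)
      also have "\<dots> \<le> (16 * A * r0 * r * sqrt (2 * r0)) * ((1 + L) / r\<^sup>2 * 1)"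
        using A r r0 l sr L by (intro mult_left_mono mult_mono) auto
      also have "\<dots> = 16 * A * (1 + L) * sqrt (2 * r0) * r0 / r" using r by (simp add: power2_eq_square)
      also have "\<dots> < 2 * A * r0\<^sup>2 / r + 16 * A * (1 + L) * sqrt (2 * r0) * r0 / r"
        using A r r0 by simp
      also have "\<dots> = ?C * r0\<^sup>2" using r r0 unfolding barrier_const_def by (simp add: power2_eq_square field_simps)
      finally show ?thesis .
    qed
    have x1': "x1 \<in> closure \<Omega> \<inter> cball p r" using x1 by simp
    have r2: "0 < r\<^sup>2" using r by simp
    have up: "v t1 x1 \<le> ?C * sqrt (tangent_power p x1) + e"
    proof (rule dirichlet_barrier[OF p r(1,2) r2 C0 vcont _ _ _ _ _ _ _ C1 C2 C3 x1'])
      show "\<And>t x. t \<in> {t1 - r\<^sup>2..t1} \<Longrightarrow> x \<in> closure \<Omega> \<inter> cball p r \<Longrightarrow> v t x \<le> A"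
        using vA sub by (fastforce simp: abs_le_iff)
      show "\<And>t x. t \<in> {t1 - r\<^sup>2..t1} \<Longrightarrow> x \<in> frontier \<Omega> \<inter> cball p r \<Longrightarrow> v t x \<le> A / r0 * dist p x + e"
        using vB sub by (fastforce simp: abs_le_iff)
      show "\<exists>s. heat_at v t x s \<and> s \<le> L * A" if "t \<in> {t1 - r\<^sup>2<..t1}" "x \<in> \<Omega> \<inter> ball p r" for t x
      proof -
        have "t \<in> ?I" using that sub by auto
        then show ?thesis using vheat[of t x] that by (auto simp: abs_le_iff)
      qed
    qed (use A e L r0 in auto)
    have dn: "- v t1 x1 \<le> ?C * sqrt (tangent_power p x1) + e"
    proof (rule dirichlet_barrier[OF p r(1,2) r2 C0 _ _ _ _ _ _ _ _ C1 C2 C3 x1', of t1 "\<lambda>t x. - v t x"])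
      show "continuous_on ({t1 - r\<^sup>2..t1} \<times> (closure \<Omega> \<inter> cball p r)) (\<lambda>(t, x). - v t x)"
        using continuous_on_minus[OF vcont] by (simp add: case_prod_beta)
      show "\<And>t x. t \<in> {t1 - r\<^sup>2..t1} \<Longrightarrow> x \<in> closure \<Omega> \<inter> cball p r \<Longrightarrow> - v t x \<le> A"
        using vA sub by (fastforce simp: abs_le_iff)
      show "\<And>t x. t \<in> {t1 - r\<^sup>2..t1} \<Longrightarrow> x \<in> frontier \<Omega> \<inter> cball p r \<Longrightarrow> - v t x \<le> A / r0 * dist p x + e"
        using vB sub by (fastforce simp: abs_le_iff)
      show "\<exists>s. heat_at (\<lambda>t x. - v t x) t x s \<and> s \<le> L * A" if "t \<in> {t1 - r\<^sup>2<..t1}" "x \<in> \<Omega> \<inter> ball p r" for t x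
      proof -
        have "t \<in> ?I" using that sub by auto
        moreover have "x \<in> \<Omega>" "dist p x \<le> r" using that by auto
        ultimately obtain s where "heat_at v t x s" "\<bar>s\<bar> \<le> L * A" using vheat by blast
        then show ?thesis using heat_at_cmult[of v t x s "-1"] by (intro exI[of _ "-s"]) auto
      qed
    qed (use A e L r0 in auto)
    show ?thesis using up dn unfolding v_def by (simp add: abs_le_iff)
  qed
  then show ?thesis using k0 by blast
qed

text \<open>The interior gradient estimate for the difference quotient in direction \<open>n p\<close>, on a ball of radius
comparable to the depth \<open>s\<close>, where \<open>normal_difference_bound\<close> makes that quotient of order \<open>sqrt s\<close>. Its
gradient is the increment of \<open>G\<close> in direction \<open>n p\<close>, divided by the step.\<close>

lemma normal_hessian_bound:
  assumes p: "p \<in> frontier \<Omega>" and r: "0 < r" "r \<le> r0 / (16 * real DIM('a))" "r \<le> 1" and A: "0 < A"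
    and GA: "\<And>t x. t \<in> {t0 - 2 * r\<^sup>2..t0} \<Longrightarrow> x \<in> closure \<Omega> \<Longrightarrow> dist p x \<le> 2 * r \<Longrightarrow> norm (G t x) \<le> A"
    and s: "0 < s" "s \<le> r / 2"
  shows "norm (H t0 (p + s *\<^sub>R n p) (n p)) \<le> A * modulus_const / (r * sqrt s)"
proof -
  define x where "x = p + s *\<^sub>R n p"
  define \<rho> where "\<rho> = s / 2"
  have rr: "r \<le> r0 / 16" by (rule small_radius[OF r(1,2)])
  have sr0: "s \<le> r0" using s rr r r0 by linarith
  have \<rho>: "0 < \<rho>" "\<rho> \<le> r" using s r by (auto simp: \<rho>_def)
  have sub: "y \<in> \<Omega>" "dist p y \<le> 3 / 2 * s" if "y \<in> cball x \<rho>" for y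
  proof -
    have "y \<in> ball x s" using that s by (auto simp: \<rho>_def)
    then show "y \<in> \<Omega>" using depth_ball[OF p s(1) sr0] by (auto simp: x_def)
    have "dist p x = s" using s norm_n[OF p] by (simp add: x_def dist_norm)
    then show "dist p y \<le> 3 / 2 * s" using dist_triangle[of p y x] that by (auto simp: \<rho>_def)
  qed
  have xin: "x \<in> \<Omega>" using sub[of x] \<rho> by simp
  have Q: "tangent_power p y \<le> 3 * r0 * s" if "y \<in> cball x \<rho>" for y
  proof -
    have "tangent_power p y \<le> (3 / 2 * s)\<^sup>2 + r0 * (3 / 2 * s)" by (rule tangent_power_upper[OF p sub(2)[OF that]])
    also have "(3 / 2 * s)\<^sup>2 \<le> r0 * (3 / 2 * s)"
    proof -
      have "(3 / 2 * s) * (3 / 2 * s) \<le> r0 * (3 / 2 * s)" using s rr r0 by (intro mult_right_mono) auto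
      then show ?thesis by (simp add: power2_eq_square)
    qed
    finally show ?thesis by (simp add: mult.assoc)
  qed
  have bound: "norm (H t0 x (n p)) \<le> dim_const * ((A * barrier_const / r * sqrt (3 * r0 * s) + e) / \<rho> + L * A * \<rho>)" if e: "0 < e" for e
  proof -
    obtain k0 where k0: "k0 > 0" "k0 \<le> r" "\<And>k t x. 0 < k \<Longrightarrow> k \<le> k0 \<Longrightarrow> t \<in> {t0 - r\<^sup>2..t0} \<Longrightarrow> x \<in> closure \<Omega> \<Longrightarrow> dist p x \<le> r \<Longrightarrow>
        \<bar>(u t (x + k *\<^sub>R n p) - u t x) / k\<bar> \<le> A * barrier_const / r * sqrt (tangent_power p x) + e"
      using normal_difference_bound[OF p r A GA e] by blast
    show ?thesis
    proof (rule norm_directional_derivative_le[OF hess[OF xin] k0(1)])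
      fix k assume k: "0 < k" "k \<le> k0"
      have kr: "k \<le> r0 / 4" using k k0 rr r0 by linarith
      define w where "w = (\<lambda>t y. (1 / k) * (u (t + 0) (y + k *\<^sub>R n p) - u t y))"
      have yk: "y + \<sigma> *\<^sub>R n p \<in> \<Omega>" if "y \<in> cball x \<rho>" "0 < \<sigma>" "\<sigma> \<le> k" for y \<sigma>
        by (rule shift_inside[OF p dom_closure[OF sub(1)[OF that(1)]] _ that(2)])
           (use sub(2)[OF that(1)] s rr r0 kr that in auto)
      have dr: "dist p y \<le> r" if "y \<in> cball x \<rho>" for y using sub(2)[OF that] s by simp
      have r2: "\<rho>\<^sup>2 \<le> r\<^sup>2" using \<rho> by (intro power_mono) auto
      have wb: "\<bar>w t y\<bar> \<le> A * barrier_const / r * sqrt (3 * r0 * s) + e" if t: "t \<in> {t0 - \<rho>\<^sup>2..t0}" and y: "y \<in> cball x \<rho>" for t y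
      proof -
        have "\<bar>w t y\<bar> \<le> A * barrier_const / r * sqrt (tangent_power p y) + e"
          using k0(3)[OF k, of t y] t r2 dr[OF y] dom_closure[OF sub(1)[OF y]] by (simp add: w_def)
        also have "A * barrier_const / r * sqrt (tangent_power p y) \<le> A * barrier_const / r * sqrt (3 * r0 * s)"
          using Q[OF y] A barrier_const_ge_2 r by (intro mult_left_mono real_sqrt_le_mono) auto
        finally show ?thesis by simp
      qed
      have wA: "\<bar>w t y\<bar> \<le> A" if t: "t \<in> {t0 - \<rho>\<^sup>2..t0}" and y: "y \<in> cball x \<rho>" for t y
      proof -
        have "dist p y \<le> r0 / 4" using dr[OF y] rr r0 by linarith
        from normal_quotient[OF p k(1) kr dom_closure[OF sub(1)[OF y]] this, of t]
        obtain \<sigma> where \<sigma>: "0 < \<sigma>" "\<sigma> < k" "y + \<sigma> *\<^sub>R n p \<in> \<Omega>"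
          "(u t (y + k *\<^sub>R n p) - u t y) / k = G t (y + \<sigma> *\<^sub>R n p) \<bullet> n p" by blast
        have "dist y (y + \<sigma> *\<^sub>R n p) = \<sigma>" using \<sigma> norm_n[OF p] by (simp add: dist_norm)
        then have "dist p (y + \<sigma> *\<^sub>R n p) \<le> 2 * r"
          using dist_triangle[of p "y + \<sigma> *\<^sub>R n p" y] dr[OF y] \<sigma> k k0 by auto
        then have "norm (G t (y + \<sigma> *\<^sub>R n p)) \<le> A"
          using GA[of t] t r2 zero_le_power2[of r] dom_closure[OF \<sigma>(3)] by simp
        moreover have "\<bar>G t (y + \<sigma> *\<^sub>R n p) \<bullet> n p\<bar> \<le> norm (G t (y + \<sigma> *\<^sub>R n p)) * norm (n p)"
          by (rule Cauchy_Schwarz_ineq2)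
        ultimately show ?thesis using \<sigma>(4) norm_n[OF p] by (simp add: w_def)
      qed
      have "norm ((1 / k) *\<^sub>R (G t0 (x + k *\<^sub>R n p) - G t0 x)) \<le>
          real DIM('a) * (1 + 2 * real DIM('a)) * ((A * barrier_const / r * sqrt (3 * r0 * s) + e) / \<rho> + (L * A) * \<rho>)"
      proof (rule interior_gradient_estimate[OF \<rho>(1) _ wb])
        have "continuous_on ({t0 - \<rho>\<^sup>2..t0} \<times> cball x \<rho>) (\<lambda>q. u (fst q) (snd q + k *\<^sub>R n p))"
          by (rule continuous_on_compose2[OF cont_u, of _ "\<lambda>q. (fst q, snd q + k *\<^sub>R n p)", simplified])
             (use yk k dom_closure in \<open>auto intro!: continuous_intros\<close>)
        then show "continuous_on ({t0 - \<rho>\<^sup>2..t0} \<times> cball x \<rho>) (\<lambda>(t, x). w t x)"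
          unfolding w_def case_prod_beta
          by (intro continuous_intros cont_u_sub[unfolded case_prod_beta]) (use sub dom_closure in auto)
        show "\<exists>s. heat_at w t y s \<and> \<bar>s\<bar> \<le> L * A" if t: "t \<in> {t0 - \<rho>\<^sup>2<..t0}" and y: "y \<in> ball x \<rho>" for t y
        proof -
          have y': "y \<in> cball x \<rho>" using y by simp
          have yin: "y \<in> \<Omega>" "y + k *\<^sub>R n p \<in> \<Omega>" using sub(1)[OF y'] yk[OF y', of k] k by auto
          have h: "heat_at w t y ((1 / k) * (f (u t (y + k *\<^sub>R n p)) - f (u t y)))"
            unfolding w_def by (intro heat_at_cmult heat_at_diff heat_at_translate) (use heat_u yin in auto)
          have "\<bar>f (u t (y + k *\<^sub>R n p)) - f (u t y)\<bar> \<le> L * \<bar>u t (y + k *\<^sub>R n p) - u t y\<bar>"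
            using f_lip u01 dom_closure yin by blast
          then have "\<bar>(1 / k) * (f (u t (y + k *\<^sub>R n p)) - f (u t y))\<bar> \<le> L * \<bar>w t y\<bar>"
            using k by (simp add: w_def abs_mult field_simps)
          also have "\<dots> \<le> L * A" using wA[of t y] t y' L by simp
          finally show ?thesis using h by blast
        qed
        have "GDERIV (\<lambda>y. u t0 (y + k *\<^sub>R n p)) x :> G t0 (x + k *\<^sub>R n p)"
          by (intro GDERIV_translate grad yk) (use k \<rho> in auto)
        from GDERIV_mult[OF GDERIV_const GDERIV_diff[OF this grad[OF xin]], of "1 / k"]
        show "GDERIV (w t0) x :> (1 / k) *\<^sub>R (G t0 (x + k *\<^sub>R n p) - G t0 x)" by (simp add: w_def)
      qed
      then show "norm (G t0 (x + k *\<^sub>R n p) - G t0 x) \<le> k * (dim_const * ((A * barrier_const / r * sqrt (3 * r0 * s) + e) / \<rho> + L * A * \<rho>))"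
        using k unfolding dim_const_def by (simp add: divide_le_eq mult.commute)
    qed
  qed
  have "norm (H t0 x (n p)) \<le> dim_const * ((A * barrier_const / r * sqrt (3 * r0 * s)) / \<rho> + L * A * \<rho>) + e" if e: "0 < e" for e
  proof -
    have p: "0 < e * \<rho> / dim_const" using e \<rho> dim_const_ge_1 by simp
    have "dim_const * ((A * barrier_const / r * sqrt (3 * r0 * s) + e * \<rho> / dim_const) / \<rho> + L * A * \<rho>)
      = dim_const * ((A * barrier_const / r * sqrt (3 * r0 * s)) / \<rho> + L * A * \<rho>) + e"
      using \<rho> dim_const_ge_1 by (simp add: field_simps)
    then show ?thesis using bound[OF p] by simp
  qed
  then have "norm (H t0 x (n p)) \<le> dim_const * ((A * barrier_const / r * sqrt (3 * r0 * s)) / \<rho> + L * A * \<rho>)"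
    by (rule field_le_epsilon)
  also have "\<dots> \<le> dim_const * (A * (2 * barrier_const * sqrt (3 * r0)) / (r * sqrt s) + A * L / (r * sqrt s))"
  proof (intro mult_left_mono add_mono)
    have ss: "sqrt s * sqrt s = s" using s by simp
    have "sqrt (3 * r0 * s) / \<rho> = 2 * sqrt (3 * r0) / sqrt s"
      using s unfolding \<rho>_def real_sqrt_mult by (simp add: field_simps ss)
    then have "(A * barrier_const / r) * (sqrt (3 * r0 * s) / \<rho>) = A * barrier_const / r * (2 * sqrt (3 * r0) / sqrt s)" by (simp only:)
    then show "(A * barrier_const / r * sqrt (3 * r0 * s)) / \<rho> \<le> A * (2 * barrier_const * sqrt (3 * r0)) / (r * sqrt s)"
      by (simp add: mult.assoc mult.left_commute)
    have "\<rho> * (r * sqrt s) \<le> 1 * (1 * 1)"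
      using s r by (intro mult_mono) (auto simp: \<rho>_def)
    then have "\<rho> \<le> 1 / (r * sqrt s)" using r s by (simp add: pos_le_divide_eq)
    then have "L * A * \<rho> \<le> L * A * (1 / (r * sqrt s))" using L A by (intro mult_left_mono) auto
    then show "L * A * \<rho> \<le> A * L / (r * sqrt s)" by (simp add: mult.commute)
  qed (use dim_const_ge_1 in auto)
  also have "\<dots> = A * modulus_const / (r * sqrt s)" by (simp add: modulus_const_def add_divide_distrib algebra_simps)
  finally show ?thesis by (simp add: x_def)
qed

text \<open>The bound \<open>1 / sqrt s\<close> for the normal derivative of the gradient is integrable down to the boundary.\<close>

lemma normal_modulus:
  assumes p: "p \<in> frontier \<Omega>" and r: "0 < r" "r \<le> r0 / (16 * real DIM('a))" "r \<le> 1" and A: "0 < A"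
    and GA: "\<And>t x. t \<in> {t0 - 2 * r\<^sup>2..t0} \<Longrightarrow> x \<in> closure \<Omega> \<Longrightarrow> dist p x \<le> 2 * r \<Longrightarrow> norm (G t x) \<le> A"
    and s: "0 \<le> s" "s \<le> \<sigma>" "\<sigma> \<le> r / 2"
  shows "norm (G t0 (p + \<sigma> *\<^sub>R n p) - G t0 (p + s *\<^sub>R n p)) \<le> 2 * A * modulus_const / r * sqrt \<sigma>"
proof (cases "s = \<sigma>")
  case True
  then show ?thesis using A modulus_const_pos r s by simp
next
  case False
  then have ss: "s < \<sigma>" using s by simp
  have rr: "r \<le> r0 / 16" by (rule small_radius[OF r(1,2)])
  have ins: "p + \<tau> *\<^sub>R n p \<in> \<Omega>" if "0 < \<tau>" "\<tau> \<le> \<sigma>" for \<tau>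
    using inward_inside(1)[OF p p] that s rr r r0 by simp
  have cl: "p + \<tau> *\<^sub>R n p \<in> closure \<Omega>" if "\<tau> \<in> {s..\<sigma>}" for \<tau>
    using ins[of \<tau>] that s frontier_closure[OF p] dom_closure by (cases "\<tau> = 0") auto
  have "norm (G t0 (p + \<sigma> *\<^sub>R n p) - G t0 (p + s *\<^sub>R n p)) \<le> 2 * A * modulus_const / r * sqrt \<sigma> - 2 * A * modulus_const / r * sqrt s"
  proof (rule differentiable_bound_general[OF ss, where f = "\<lambda>\<tau>. G t0 (p + \<tau> *\<^sub>R n p)"
      and \<phi> = "\<lambda>\<tau>. 2 * A * modulus_const / r * sqrt \<tau>" and f' = "\<lambda>\<tau>. H t0 (p + \<tau> *\<^sub>R n p) (n p)" and \<phi>' = "\<lambda>\<tau>. A * modulus_const / (r * sqrt \<tau>)"])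
    show "continuous_on {s..\<sigma>} (\<lambda>\<tau>. G t0 (p + \<tau> *\<^sub>R n p))"
      by (rule continuous_on_compose2[OF cont_G_x]) (use cl in \<open>auto intro!: continuous_intros\<close>)
    show "continuous_on {s..\<sigma>} (\<lambda>\<tau>. 2 * A * modulus_const / r * sqrt \<tau>)" by (intro continuous_intros)
    fix \<tau> assume \<tau>: "s < \<tau>" "\<tau> < \<sigma>"
    have "((\<lambda>\<tau>. G t0 (p + \<tau> *\<^sub>R n p)) has_derivative (\<lambda>h. H t0 (p + \<tau> *\<^sub>R n p) (h *\<^sub>R n p))) (at \<tau>)"
      by (rule has_derivative_compose[of "\<lambda>\<tau>. p + \<tau> *\<^sub>R n p" "\<lambda>h. h *\<^sub>R n p" \<tau> UNIV "G t0"])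
         (use hess[OF ins[of \<tau>], of t0] \<tau> s in \<open>auto intro!: derivative_eq_intros\<close>)
    then show "((\<lambda>\<tau>. G t0 (p + \<tau> *\<^sub>R n p)) has_vector_derivative H t0 (p + \<tau> *\<^sub>R n p) (n p)) (at \<tau>)"
      by (simp add: has_vector_derivative_def blinfun.scaleR_right)
    have "((\<lambda>\<tau>. 2 * A * modulus_const / r * sqrt \<tau>) has_real_derivative 2 * A * modulus_const / r * (inverse (sqrt \<tau>) / 2)) (at \<tau>)"
      using \<tau> s by (intro DERIV_cmult DERIV_real_sqrt) auto
    then show "((\<lambda>\<tau>. 2 * A * modulus_const / r * sqrt \<tau>) has_vector_derivative A * modulus_const / (r * sqrt \<tau>)) (at \<tau>)"
      by (simp add: has_real_derivative_iff_has_vector_derivative field_simps)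
    show "norm (H t0 (p + \<tau> *\<^sub>R n p) (n p)) \<le> A * modulus_const / (r * sqrt \<tau>)"
      by (rule normal_hessian_bound[OF p r A GA]) (use \<tau> s in auto)
  qed
  moreover have "0 \<le> 2 * A * modulus_const / r * sqrt s" using A modulus_const_pos r s by simp
  ultimately show ?thesis by linarith
qed

lemma ball_gradient_bound:
  assumes "ball x \<sigma> \<subseteq> \<Omega>" "0 < \<sigma>" "\<sigma> \<le> 1"
  shows "norm (G t x) \<le> dim_const * (1 + L) / \<sigma>"
proof -
  have "cball x \<sigma> \<subseteq> closure \<Omega>" using closure_mono[OF assms(1)] assms by simp
  have xin: "x \<in> \<Omega>" using assms by auto
  have "norm (G t x) \<le> real DIM('a) * (1 + 2 * real DIM('a)) * (1 / \<sigma> + L * \<sigma>)"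
  proof (rule interior_gradient_estimate[OF assms(2)])
    show "continuous_on ({t - \<sigma>\<^sup>2..t} \<times> cball x \<sigma>) (\<lambda>(t, x). u t x)" by (rule cont_u_sub) fact
    show "\<bar>u s y\<bar> \<le> 1" if "s \<in> {t - \<sigma>\<^sup>2..t}" "y \<in> cball x \<sigma>" for s y
      using u01[of y s] that \<open>cball x \<sigma> \<subseteq> closure \<Omega>\<close> by auto
    show "\<exists>r. heat_at u s y r \<and> \<bar>r\<bar> \<le> L" if "s \<in> {t - \<sigma>\<^sup>2<..t}" "y \<in> ball x \<sigma>" for s y
      using heat_u[of y s] that assms(1) f_bound[OF u01[OF dom_closure, of y s]] by blast
  qed (rule grad[OF xin])
  also have "\<dots> \<le> dim_const * ((1 + L) / \<sigma>)" unfolding dim_const_def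
  proof (intro mult_left_mono)
    have "L * \<sigma> \<le> L * (1 / \<sigma>)" using L assms mult_le_one[of \<sigma> \<sigma>] by (intro mult_left_mono) (auto simp: pos_le_divide_eq)
    then show "1 / \<sigma> + L * \<sigma> \<le> (1 + L) / \<sigma>" by (simp add: add_divide_distrib)
  qed simp
  finally show ?thesis by simp
qed

text \<open>In a neighbourhood, of size a multiple of \<open>\<rho>\<close>, of a point where \<open>\<zeta>\<^sup>2 |G|\<close> is largest and the cutoff \<open>\<zeta>\<close> has
the value \<open>\<rho>\<close>, the gradient is at most four times as large as at that point. Moving inward by \<open>\<sigma> = \<kappa> \<rho>\<^sup>2\<close> changes the gradient by at
most half of its size if \<open>\<kappa>\<close> is small (\<open>normal_modulus\<close>), and at depth \<open>\<sigma>\<close> it is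
bounded by \<open>1 / \<sigma>\<close> up to a constant (\<open>ball_gradient_bound\<close>). So the maximum is bounded by a
constant that does not depend on the centre of the cutoff. The maximum exists because the
gradient is continuous up to the boundary.\<close>

lemma global_gradient_bound: "\<exists>\<Lambda>>0. \<forall>t. \<forall>x\<in>closure \<Omega>. norm (G t x) \<le> \<Lambda>"
proof -
  \<comment> \<open>\<open>\<kappa>0\<close> keeps the neighbourhood inside \<open>\<zeta> \<ge> \<rho> / 2\<close>; \<open>\<kappa>\<close> makes the change of the gradient at most half.\<close>
  define \<kappa>0 where "\<kappa>0 = min (1 / 16) (r0 / (16 * real DIM('a)))"
  have k0: "0 < \<kappa>0" "\<kappa>0 \<le> 1 / 16" "\<kappa>0 \<le> r0 / (16 * real DIM('a))" using r0 by (auto simp: \<kappa>0_def)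
  define \<kappa> where "\<kappa> = min (\<kappa>0 / 2) ((\<kappa>0 / (16 * modulus_const))\<^sup>2)"
  have k: "0 < \<kappa>" "\<kappa> \<le> \<kappa>0 / 2" using k0 modulus_const_pos by (auto simp: \<kappa>_def)
  have "sqrt \<kappa> \<le> sqrt ((\<kappa>0 / (16 * modulus_const))\<^sup>2)" by (rule real_sqrt_le_mono) (simp add: \<kappa>_def)
  then have sk: "sqrt \<kappa> \<le> \<kappa>0 / (16 * modulus_const)" using k0 modulus_const_pos by simp
  define \<Lambda> where "\<Lambda> = 2 * (dim_const * (1 + L) / \<kappa>)"
  have L0: "0 < \<Lambda>" using dim_const_ge_1 L k by (simp add: \<Lambda>_def)
  have "norm (G t0 p0) \<le> \<Lambda>" if p0: "p0 \<in> closure \<Omega>" for t0 p0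
  proof -
    define \<zeta> where "\<zeta> = (\<lambda>t x. 1 - dist p0 x - (t0 - t))"
    define K where "K = {t0 - 1..t0} \<times> (closure \<Omega> \<inter> cball p0 1) \<inter> {q. 0 \<le> \<zeta> (fst q) (snd q)}"
    have "closed {q::real \<times> 'a. 0 \<le> \<zeta> (fst q) (snd q)}"
      unfolding \<zeta>_def by (intro closed_Collect_le continuous_intros)
    then have K: "compact K" unfolding K_def
      by (intro compact_Int_closed compact_Times closed_Int_compact) auto
    have inK: "(t, x) \<in> K" if "t \<le> t0" "x \<in> closure \<Omega>" "0 \<le> \<zeta> t x" for t x
    proof -
      have "t0 - t \<le> 1 - dist p0 x" "0 \<le> dist p0 x" using that(3) by (auto simp: \<zeta>_def)
      then have "t0 - 1 \<le> t" "dist p0 x \<le> 1" using that(1) by linarith+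
      then show ?thesis using that by (auto simp: K_def)
    qed
    have "continuous_on K (\<lambda>q. (\<zeta> (fst q) (snd q))\<^sup>2 * norm (G (fst q) (snd q)))"
      unfolding \<zeta>_def
      by (intro continuous_intros continuous_on_subset[OF cont_G[unfolded case_prod_beta]]) (auto simp: K_def)
    moreover have p0K: "(t0, p0) \<in> K" by (rule inK) (use p0 in \<open>auto simp: \<zeta>_def\<close>)
    ultimately obtain m where m: "m \<in> K" "\<And>q. q \<in> K \<Longrightarrow> (\<zeta> (fst q) (snd q))\<^sup>2 * norm (G (fst q) (snd q)) \<le> (\<zeta> (fst m) (snd m))\<^sup>2 * norm (G (fst m) (snd m))"
      using continuous_attains_sup[OF K] by blast
    obtain t1 x1 where m1: "m = (t1, x1)" by force
    define S where "S = (\<zeta> t1 x1)\<^sup>2 * norm (G t1 x1)"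
    have mx: "(\<zeta> t x)\<^sup>2 * norm (G t x) \<le> S" if "(t, x) \<in> K" for t x
      using m(2)[OF that] m1 by (simp add: S_def)
    have x1: "x1 \<in> closure \<Omega>" "t1 \<le> t0" and z1: "0 \<le> \<zeta> t1 x1" using m(1) m1 by (auto simp: K_def)
    have G0: "norm (G t0 p0) \<le> S" using mx[OF p0K] by (simp add: \<zeta>_def)
    show ?thesis
    proof (cases "S = 0")
      case True
      then show ?thesis using G0 L0 by simp
    next
      case False
      define \<rho> where "\<rho> = \<zeta> t1 x1"
      have S0: "0 < S" using False by (simp add: S_def less_le)
      have "\<zeta> t1 x1 \<noteq> 0" using False by (auto simp: S_def)
      then have \<rho>: "0 < \<rho>" using z1 by (simp add: \<rho>_def)
      have "0 \<le> dist p0 x1" by simp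
      then have "\<zeta> t1 x1 \<le> 1" using x1(2) unfolding \<zeta>_def by linarith
      with \<rho> have \<rho>: "0 < \<rho>" "\<rho> \<le> 1" by (simp_all add: \<rho>_def)
      define r where "r = \<kappa>0 * \<rho>"
      have r: "0 < r" "r \<le> r0 / (16 * real DIM('a))" "r \<le> 1" "r \<le> \<rho> / 16"
      proof -
        have "\<kappa>0 * \<rho> \<le> \<kappa>0 * 1" using k0 \<rho> by (intro mult_left_mono) auto
        then show "r \<le> r0 / (16 * real DIM('a))" "r \<le> 1" using k0 unfolding r_def by linarith+
        have "\<kappa>0 * \<rho> \<le> 1 / 16 * \<rho>" using k0 \<rho> by (intro mult_right_mono) auto
        then show "r \<le> \<rho> / 16" by (simp add: r_def)
        show "0 < r" using k0 \<rho> by (simp add: r_def)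
      qed
      define \<sigma> where "\<sigma> = \<kappa> * \<rho>\<^sup>2"
      have \<rho>2: "\<rho>\<^sup>2 \<le> \<rho>" "0 < \<rho>\<^sup>2" using \<rho> by (auto simp: power2_eq_square mult_left_le)
      have \<sigma>: "0 < \<sigma>" "\<sigma> \<le> r / 2" "\<sigma> \<le> 1"
      proof -
        show "0 < \<sigma>" using k \<rho> by (simp add: \<sigma>_def)
        have "\<kappa> * \<rho>\<^sup>2 \<le> \<kappa>0 / 2 * \<rho>" using k \<rho>2 k0 by (intro mult_mono) auto
        then show "\<sigma> \<le> r / 2" by (simp add: \<sigma>_def r_def)
        then show "\<sigma> \<le> 1" using r by simp
      qed
      have rr: "r \<le> r0 / 16" by (rule small_radius[OF r(1,2)])
      have nb: "norm (G t1 x1) \<le> dim_const * (1 + L) / \<sigma> + S / (2 * \<rho>\<^sup>2)"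
      proof (cases "ball x1 \<sigma> \<subseteq> \<Omega>")
        case True
        have "0 \<le> S / (2 * \<rho>\<^sup>2)" using S0 by simp
        then show ?thesis using ball_gradient_bound[OF True \<sigma>(1,3), of t1] by linarith
      next
        case False
        obtain q where q: "q \<in> frontier \<Omega>" "dist x1 q < \<sigma>" "x1 = q + dist x1 q *\<^sub>R n q"
          using near_boundary_cases[OF x1(1) False \<sigma>(1)] .
        define A where "A = 4 * S / \<rho>\<^sup>2"
        have A0: "0 < A" using S0 \<rho> by (simp add: A_def)
        have GA: "norm (G t x) \<le> A" if t: "t \<in> {t1 - 2 * r\<^sup>2..t1}" and x: "x \<in> closure \<Omega>" "dist q x \<le> 2 * r" for t x
        proof -
          have d: "dist p0 x \<le> dist p0 x1 + dist x1 q + dist q x"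
            using dist_triangle[of p0 x x1] dist_triangle[of x1 x q] by simp
          have "r\<^sup>2 \<le> r" using r by (simp add: power2_eq_square mult_left_le)
          have "\<rho> / 2 \<le> \<rho> - (\<sigma> + 2 * r) - 2 * r\<^sup>2" using \<sigma> r \<open>r\<^sup>2 \<le> r\<close> by linarith
          also have "\<dots> \<le> \<zeta> t x" using d q(2) x(2) t unfolding \<rho>_def \<zeta>_def by auto
          finally have z: "\<rho> / 2 \<le> \<zeta> t x" .
          have "(\<rho> / 2)\<^sup>2 * norm (G t x) \<le> (\<zeta> t x)\<^sup>2 * norm (G t x)"
            using z \<rho> by (intro mult_right_mono power_mono) auto
          also have "\<dots> \<le> S" by (rule mx, rule inK) (use t x1 x z \<rho> in auto)
          finally show ?thesis using \<rho> by (simp add: A_def field_simps power2_eq_square)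
        qed
        have "norm (G t1 (q + \<sigma> *\<^sub>R n q) - G t1 (q + dist x1 q *\<^sub>R n q)) \<le> 2 * A * modulus_const / r * sqrt \<sigma>"
          by (rule normal_modulus[OF q(1) r(1,2,3) A0 GA]) (use q \<sigma> in auto)
        also have "\<dots> = 8 * S * modulus_const / (\<rho>\<^sup>2 * \<kappa>0) * sqrt \<kappa>"
          using \<rho> k0 by (simp add: A_def r_def \<sigma>_def real_sqrt_mult field_simps)
        also have "\<dots> \<le> 8 * S * modulus_const / (\<rho>\<^sup>2 * \<kappa>0) * (\<kappa>0 / (16 * modulus_const))"
          using S0 modulus_const_pos k0 \<rho> by (intro mult_left_mono sk) auto
        also have "\<dots> = S / (2 * \<rho>\<^sup>2)" using modulus_const_pos k0 by (simp add: field_simps)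
        finally have 1: "norm (G t1 (q + \<sigma> *\<^sub>R n q) - G t1 x1) \<le> S / (2 * \<rho>\<^sup>2)" using q(3) by simp
        have "ball (q + \<sigma> *\<^sub>R n q) \<sigma> \<subseteq> \<Omega>"
          by (rule depth_ball[OF q(1) \<sigma>(1)]) (use \<sigma> rr r r0 in auto)
        from ball_gradient_bound[OF this \<sigma>(1,3)] have "norm (G t1 (q + \<sigma> *\<^sub>R n q)) \<le> dim_const * (1 + L) / \<sigma>" .
        then show ?thesis using 1 norm_triangle_sub[of "G t1 x1" "G t1 (q + \<sigma> *\<^sub>R n q)"]
          by (simp add: norm_minus_commute)
      qed
      have "S = \<rho>\<^sup>2 * norm (G t1 x1)" by (simp add: S_def \<rho>_def)
      also have "\<dots> \<le> \<rho>\<^sup>2 * (dim_const * (1 + L) / \<sigma> + S / (2 * \<rho>\<^sup>2))" using nb by (intro mult_left_mono) auto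
      also have "\<dots> = dim_const * (1 + L) / \<kappa> + S / 2" using \<rho> k by (simp add: \<sigma>_def field_simps)
      finally have "S \<le> \<Lambda>" by (simp add: \<Lambda>_def)
      then show ?thesis using G0 by simp
    qed
  qed
  then show ?thesis using L0 by blast
qed

end


section \<open>Equicontinuous families and their limits\<close>

lemma tendsto_at_top_Cauchy:
  fixes g :: "real \<Rightarrow> 'b::complete_space"
  assumes "\<And>e. 0 < e \<Longrightarrow> \<exists>T. \<forall>s\<ge>T. \<forall>t\<ge>T. dist (g s) (g t) < e"
  shows "\<exists>l. (g \<longlongrightarrow> l) at_top"
proof -
  have "Cauchy (\<lambda>k. g (real k))"
    unfolding Cauchy_def
  proof (intro allI impI)
    fix e :: real assume "0 < e"
    then obtain T where T: "\<And>s t. T \<le> s \<Longrightarrow> T \<le> t \<Longrightarrow> dist (g s) (g t) < e" using assms by blast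
    obtain M where "T \<le> real M" using real_arch_simple by blast
    then show "\<exists>M. \<forall>m\<ge>M. \<forall>n\<ge>M. dist (g (real m)) (g (real n)) < e"
      by (intro exI[of _ M]) (auto intro!: T)
  qed
  then obtain l where l: "(\<lambda>k. g (real k)) \<longlonglongrightarrow> l"
    using Cauchy_convergent convergent_def by blast
  have "(g \<longlongrightarrow> l) at_top"
    unfolding tendsto_iff
  proof (intro allI impI)
    fix e :: real assume e: "0 < e"
    then obtain T where T: "\<And>s t. T \<le> s \<Longrightarrow> T \<le> t \<Longrightarrow> dist (g s) (g t) < e / 2" using assms[of "e / 2"] by auto
    obtain M where M: "\<And>k. k \<ge> M \<Longrightarrow> dist (g (real k)) l < e / 2"
      using l e unfolding lim_sequentially by (meson half_gt_zero)
    obtain M' where M': "T \<le> real M'" using real_arch_simple by blast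
    have "dist (g t) l < e" if "T \<le> t" for t
    proof -
      have "dist (g t) (g (real (max M M'))) < e / 2" using T that M' by simp
      moreover have "dist (g (real (max M M'))) l < e / 2" by (rule M) simp
      ultimately show ?thesis using dist_triangle[of "g t" l "g (real (max M M'))"] by linarith
    qed
    then show "\<forall>\<^sub>F t in at_top. dist (g t) l < e"
      unfolding eventually_at_top_linorder by blast
  qed
  then show ?thesis by blast
qed

definition equicont_on :: "'a::metric_space set \<Rightarrow> (real \<Rightarrow> 'a \<Rightarrow> 'b::metric_space) \<Rightarrow> bool" where
  "equicont_on S g \<longleftrightarrow> (\<forall>x\<in>S. \<forall>e>0. \<exists>d>0. \<forall>t. \<forall>y\<in>S. dist y x < d \<longrightarrow> dist (g t y) (g t x) < e)"

lemma equicont_limit_continuous: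
  assumes eq: "equicont_on S g" and lim: "\<And>x. x \<in> S \<Longrightarrow> ((\<lambda>t. g t x) \<longlongrightarrow> h x) at_top"
  shows "continuous_on S h"
  unfolding continuous_on_iff
proof (intro ballI allI impI)
  fix x and e :: real assume x: "x \<in> S" and e: "0 < e"
  obtain d where d: "d > 0" "\<And>t y. y \<in> S \<Longrightarrow> dist y x < d \<Longrightarrow> dist (g t y) (g t x) < e / 2"
    using eq x e unfolding equicont_on_def by (meson half_gt_zero)
  have "dist (h y) (h x) < e" if y: "y \<in> S" "dist y x < d" for y
  proof -
    have "((\<lambda>t. dist (g t y) (g t x)) \<longlongrightarrow> dist (h y) (h x)) at_top"
      by (intro tendsto_dist lim x y)
    then have "dist (h y) (h x) \<le> e / 2"
      by (rule tendsto_upperbound) (use d(2)[OF y] in \<open>auto intro!: always_eventually less_imp_le\<close>)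
    then show ?thesis using e by simp
  qed
  then show "\<exists>d>0. \<forall>x'\<in>S. dist x' x < d \<longrightarrow> dist (h x') (h x) < e" using d(1) by blast
qed

lemma equicont_limit_uniform:
  assumes C: "compact C" "C \<subseteq> S" and eq: "equicont_on S g"
    and lim: "\<And>x. x \<in> S \<Longrightarrow> ((\<lambda>t. g t x) \<longlongrightarrow> h x) at_top"
  shows "uniform_limit C g h at_top"
  unfolding uniform_limit_iff
proof (intro allI impI)
  fix e :: real assume e: "0 < e"
  have "\<exists>d>0. (\<forall>t. \<forall>y\<in>S. dist y x < d \<longrightarrow> dist (g t y) (g t x) < e / 3) \<and> (\<forall>y\<in>S. dist y x < d \<longrightarrow> dist (h y) (h x) < e / 3)"
    if x: "x \<in> S" for x
  proof -
    have e3: "0 < e / 3" using e by simp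
    obtain d where d: "d > 0" "\<forall>t. \<forall>y\<in>S. dist y x < d \<longrightarrow> dist (g t y) (g t x) < e / 3"
      using eq x e3 unfolding equicont_on_def by blast
    obtain d' where d': "d' > 0" "\<forall>y\<in>S. dist y x < d' \<longrightarrow> dist (h y) (h x) < e / 3"
      using equicont_limit_continuous[OF eq lim] x e3 unfolding continuous_on_iff by blast
    show ?thesis by (rule exI[of _ "min d d'"]) (use d d' in auto)
  qed
  then obtain d where d: "\<And>x. x \<in> S \<Longrightarrow> 0 < d x"
    "\<And>x t y. x \<in> S \<Longrightarrow> y \<in> S \<Longrightarrow> dist y x < d x \<Longrightarrow> dist (g t y) (g t x) < e / 3"
    "\<And>x y. x \<in> S \<Longrightarrow> y \<in> S \<Longrightarrow> dist y x < d x \<Longrightarrow> dist (h y) (h x) < e / 3"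
    by metis
  have "C \<subseteq> (\<Union>x\<in>C. ball x (d x))" using d(1) C by force
  then obtain F where F: "F \<subseteq> C" "finite F" "C \<subseteq> (\<Union>x\<in>F. ball x (d x))"
    using compactE_image[OF C(1), of C "\<lambda>x. ball x (d x)"] by auto
  have "\<forall>\<^sub>F t in at_top. \<forall>x\<in>F. dist (g t x) (h x) < e / 3"
  proof (rule eventually_ball_finite[OF F(2)], rule ballI)
    fix x assume "x \<in> F"
    then have "x \<in> S" using F C by blast
    from lim[OF this] show "\<forall>\<^sub>F t in at_top. dist (g t x) (h x) < e / 3"
      using e by (intro tendstoD) auto
  qed
  then show "\<forall>\<^sub>F t in at_top. \<forall>x\<in>C. dist (g t x) (h x) < e"
  proof eventually_elim
    case (elim t)
    show ?case
    proof
      fix y assume y: "y \<in> C"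
      then obtain x where x: "x \<in> F" "dist y x < d x" using F(3) by (auto simp: dist_commute)
      have "x \<in> S" "y \<in> S" using x y F C by blast+
      then have "dist (g t y) (g t x) < e / 3" "dist (h y) (h x) < e / 3" using d x by blast+
      moreover have "dist (g t x) (h x) < e / 3" using elim x by blast
      ultimately show "dist (g t y) (h y) < e"
        using dist_triangle[of "g t y" "h y" "g t x"] dist_triangle[of "g t x" "h y" "h x"] by (simp add: dist_commute)
    qed
  qed
qed

lemma equicont_limit_at_closure:
  fixes g :: "real \<Rightarrow> 'a::metric_space \<Rightarrow> 'b::complete_space"
  assumes eq: "equicont_on (closure S) g" and x: "x \<in> closure S"
    and lim: "\<And>y. y \<in> S \<Longrightarrow> \<exists>l. ((\<lambda>t. g t y) \<longlongrightarrow> l) at_top"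
  shows "\<exists>l. ((\<lambda>t. g t x) \<longlongrightarrow> l) at_top"
proof (rule tendsto_at_top_Cauchy)
  fix e :: real assume e: "0 < e"
  have e4: "0 < e / 4" using e by simp
  obtain d where d: "d > 0" "\<And>t y. y \<in> closure S \<Longrightarrow> dist y x < d \<Longrightarrow> dist (g t y) (g t x) < e / 4"
    using eq x e4 unfolding equicont_on_def by meson
  obtain y where y: "y \<in> S" "dist y x < d" using x d(1) unfolding closure_approachable by blast
  obtain l where "((\<lambda>t. g t y) \<longlongrightarrow> l) at_top" using lim[OF y(1)] by blast
  then obtain T where T: "\<And>t. T \<le> t \<Longrightarrow> dist (g t y) l < e / 4"
    using e4 unfolding tendsto_iff eventually_at_top_linorder by blast
  have "dist (g s x) (g t x) < e" if "T \<le> s" "T \<le> t" for s t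
  proof -
    have "dist (g s y) (g s x) < e / 4" "dist (g t y) (g t x) < e / 4"
      using d(2) y closure_subset by blast+
    moreover have "dist (g s y) l < e / 4" "dist (g t y) l < e / 4" using T that by blast+
    ultimately show ?thesis
      using dist_triangle[of "g s x" "g t x" "g s y"] dist_triangle[of "g s y" "g t x" l]
        dist_triangle[of l "g t x" "g t y"] by (simp add: dist_commute)
  qed
  then show "\<exists>T. \<forall>s\<ge>T. \<forall>t\<ge>T. dist (g s x) (g t x) < e" by blast
qed

text \<open>With a uniform second-order remainder, the differential is a difference quotient up to a
uniformly small error, so it inherits convergence from the function.\<close>

lemma taylor_limit_exists:
  fixes g :: "real \<Rightarrow> 'a::real_normed_vector \<Rightarrow> 'b::banach"
  assumes \<rho>: "0 < \<rho>" and C: "0 \<le> C"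
    and lin: "\<And>t. linear (D t)"
    and T: "\<And>t h. norm h \<le> \<rho> \<Longrightarrow> norm (g t (x + h) - g t x - D t h) \<le> C * (norm h)\<^sup>2"
    and lim: "\<And>h. norm h \<le> \<rho> \<Longrightarrow> \<exists>l. ((\<lambda>t. g t (x + h)) \<longlongrightarrow> l) at_top"
  shows "\<exists>l. ((\<lambda>t. D t v) \<longlongrightarrow> l) at_top"
proof (rule tendsto_at_top_Cauchy)
  fix e :: real assume e: "0 < e"
  \<comment> \<open>The step \<open>\<eta>\<close> is so small that the Taylor remainder is below \<open>\<eta> e\<close>; after that, times are chosen so
    late that the values at the two points have settled.\<close>
  define N where "N = norm v + 1"
  have N: "1 \<le> N" "norm v \<le> N" by (auto simp: N_def)
  define \<eta> where "\<eta> = min (\<rho> / N) (e / (4 * (C + 1) * N\<^sup>2))"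
  have \<eta>: "0 < \<eta>" using \<rho> N e C by (simp add: \<eta>_def)
  have "\<eta> * norm v \<le> \<rho> / N * N" using N \<rho> \<eta> by (intro mult_mono) (auto simp: \<eta>_def)
  then have h: "norm (\<eta> *\<^sub>R v) \<le> \<rho>" using N \<eta> by simp
  have small: "2 * (C * (norm (\<eta> *\<^sub>R v))\<^sup>2) \<le> \<eta> * (e / 2)"
  proof -
    have "(norm (\<eta> *\<^sub>R v))\<^sup>2 \<le> \<eta>\<^sup>2 * N\<^sup>2" using N \<eta> by (simp add: power_mult_distrib power_mono)
    then have "2 * (C * (norm (\<eta> *\<^sub>R v))\<^sup>2) \<le> 2 * ((C + 1) * (\<eta>\<^sup>2 * N\<^sup>2))" using C by (intro mult_left_mono mult_mono) auto
    also have "\<dots> = \<eta> * (\<eta> * (2 * (C + 1) * N\<^sup>2))" by (simp add: power2_eq_square algebra_simps)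
    also have "\<dots> \<le> \<eta> * (e / (4 * (C + 1) * N\<^sup>2) * (2 * (C + 1) * N\<^sup>2))"
      using C N \<eta> by (intro mult_left_mono mult_right_mono) (auto simp: \<eta>_def)
    also have "e / (4 * (C + 1) * N\<^sup>2) * (2 * (C + 1) * N\<^sup>2) = e / 2"
    proof -
      have "e / (4 * M) * (2 * M) = e / 2" if "0 < M" for M :: real using that by simp
      moreover have "0 < (C + 1) * N\<^sup>2" using C N by simp
      ultimately have "e / (4 * ((C + 1) * N\<^sup>2)) * (2 * ((C + 1) * N\<^sup>2)) = e / 2" by blast
      then show ?thesis by (simp only: mult.assoc)
    qed
    finally show ?thesis .
  qed
  have ex: "\<exists>T. \<forall>t\<ge>T. dist (g t (x + k)) l < \<eta> * e / 16" if "((\<lambda>t. g t (x + k)) \<longlongrightarrow> l) at_top" for k l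
    using tendstoD[OF that, of "\<eta> * e / 16"] \<eta> e unfolding eventually_at_top_linorder by simp
  obtain l1 where l1: "((\<lambda>t. g t (x + \<eta> *\<^sub>R v)) \<longlongrightarrow> l1) at_top" using lim[OF h] by blast
  obtain l0 where l0: "((\<lambda>t. g t (x + 0)) \<longlongrightarrow> l0) at_top" using lim[of 0] \<rho> by auto
  obtain T1 where T1: "\<And>t. T1 \<le> t \<Longrightarrow> dist (g t (x + \<eta> *\<^sub>R v)) l1 < \<eta> * e / 16" using ex[OF l1] by blast
  obtain T0 where T0: "\<And>t. T0 \<le> t \<Longrightarrow> dist (g t (x + 0)) l0 < \<eta> * e / 16" using ex[OF l0] by blast
  have "dist (D s v) (D t v) < e" if s: "max T0 T1 \<le> s" and t: "max T0 T1 \<le> t" for s t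
  proof -
    let ?h = "\<eta> *\<^sub>R v"
    have a: "norm (g s (x + ?h) - g t (x + ?h)) < \<eta> * e / 8"
      using dist_triangle2[of "g s (x + ?h)" "g t (x + ?h)" l1] T1[of s] T1[of t] s t by (simp add: dist_norm)
    have b: "norm (g s x - g t x) < \<eta> * e / 8"
      using dist_triangle2[of "g s x" "g t x" l0] T0[of s] T0[of t] s t by (simp add: dist_norm)
    have "D s ?h - D t ?h = (g s (x + ?h) - g t (x + ?h)) - (g s x - g t x)
        - (g s (x + ?h) - g s x - D s ?h) + (g t (x + ?h) - g t x - D t ?h)" by simp
    also have "norm \<dots> \<le> norm (g s (x + ?h) - g t (x + ?h)) + norm (g s x - g t x)
        + norm (g s (x + ?h) - g s x - D s ?h) + norm (g t (x + ?h) - g t x - D t ?h)"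
    proof -
      have "norm (a - b - c + d) \<le> norm a + norm b + norm c + norm d" for a b c d :: 'b
        using norm_triangle_ineq[of "a - b - c" d] norm_triangle_ineq4[of "a - b" c] norm_triangle_ineq4[of a b] by linarith
      then show ?thesis .
    qed
    also have "\<dots> < \<eta> * e / 8 + \<eta> * e / 8 + C * (norm ?h)\<^sup>2 + C * (norm ?h)\<^sup>2"
      using a b T[OF h, of s] T[OF h, of t] by linarith
    also have "\<dots> \<le> \<eta> * e"
    proof -
      have "0 < \<eta> * e" "\<eta> * (e / 2) = \<eta> * e / 2" using \<eta> e by simp_all
      with small show ?thesis by linarith
    qed
    finally have "norm (D s ?h - D t ?h) < \<eta> * e" .
    moreover have "D s ?h - D t ?h = \<eta> *\<^sub>R (D s v - D t v)"
      by (simp add: linear_scale[OF lin] scaleR_diff_right)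
    ultimately show ?thesis using \<eta> by (simp add: dist_norm)
  qed
  then show "\<exists>T. \<forall>s\<ge>T. \<forall>t\<ge>T. dist (D s v) (D t v) < e" by blast
qed

lemma taylor_imp_derivative:
  assumes "bounded_linear D" and \<rho>: "0 < \<rho>"
    and T: "\<And>h. norm h \<le> \<rho> \<Longrightarrow> norm (g (x + h) - g x - D h) \<le> C * (norm h)\<^sup>2"
  shows "(g has_derivative D) (at x)"
  unfolding has_derivative_at_alt
proof (intro conjI assms allI impI)
  fix e :: real assume e: "0 < e"
  define d where "d = min \<rho> (e / (\<bar>C\<bar> + 1))"
  have d: "0 < d" "d \<le> \<rho>" using \<rho> e by (auto simp: d_def)
  have "norm (g y - g x - D (y - x)) \<le> e * norm (y - x)" if y: "norm (y - x) < d" for y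
  proof -
    have "norm (g (x + (y - x)) - g x - D (y - x)) \<le> C * (norm (y - x))\<^sup>2" by (rule T) (use y d in linarith)
    also have "\<dots> \<le> (\<bar>C\<bar> + 1) * (norm (y - x))\<^sup>2" by (intro mult_right_mono) auto
    also have "\<dots> = ((\<bar>C\<bar> + 1) * norm (y - x)) * norm (y - x)" by (simp add: power2_eq_square)
    also have "\<dots> \<le> ((\<bar>C\<bar> + 1) * (e / (\<bar>C\<bar> + 1))) * norm (y - x)"
      using y by (intro mult_right_mono mult_left_mono) (auto simp: d_def)
    also have "\<dots> = e * norm (y - x)" by simp
    finally show ?thesis by simp
  qed
  then show "\<exists>d>0. \<forall>y. norm (y - x) < d \<longrightarrow> norm (g y - g x - D (y - x)) \<le> e * norm (y - x)"
    using d by blast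
qed

text \<open>Two points near the boundary are joined by going inward along the normals to a fixed depth; there
interior equicontinuity applies, since the normals depend continuously on their foot points.\<close>

lemma (in two_sided_ball) boundary_equicontinuity:
  fixes g :: "real \<Rightarrow> 'a \<Rightarrow> 'b::real_normed_vector"
  assumes int: "equicont_on \<Omega> g"
    and nor: "\<And>e. 0 < e \<Longrightarrow> \<exists>\<sigma>>0. \<forall>s t p. p \<in> frontier \<Omega> \<and> 0 \<le> s \<and> s \<le> \<sigma> \<longrightarrow>
        norm (g t (p + \<sigma> *\<^sub>R n p) - g t (p + s *\<^sub>R n p)) \<le> e \<and> \<sigma> \<le> r0"
  shows "equicont_on (closure \<Omega>) g"
  unfolding equicont_on_def
proof (intro ballI allI impI)
  fix x and e :: real assume x: "x \<in> closure \<Omega>" and e: "0 < e"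
  show "\<exists>d>0. \<forall>t. \<forall>y\<in>closure \<Omega>. dist y x < d \<longrightarrow> dist (g t y) (g t x) < e"
  proof (cases "x \<in> \<Omega>")
    case True
    obtain d where d: "d > 0" "\<And>t y. y \<in> \<Omega> \<Longrightarrow> dist y x < d \<Longrightarrow> dist (g t y) (g t x) < e"
      using int True e unfolding equicont_on_def by meson
    obtain d' where d': "d' > 0" "ball x d' \<subseteq> \<Omega>" using open_dom True open_contains_ball by blast
    show ?thesis by (rule exI[of _ "min d d'"]) (use d d' in \<open>auto simp: dist_commute subset_iff\<close>)
  next
    case False
    then have xf: "x \<in> frontier \<Omega>" using x closure_cases by blast
    have e4: "0 < e / 4" using e by simp
    obtain \<sigma> where \<sigma>: "\<sigma> > 0" "\<And>s t p. p \<in> frontier \<Omega> \<Longrightarrow> 0 \<le> s \<Longrightarrow> s \<le> \<sigma> \<Longrightarrow>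
        norm (g t (p + \<sigma> *\<^sub>R n p) - g t (p + s *\<^sub>R n p)) \<le> e / 4 \<and> \<sigma> \<le> r0"
      using nor[OF e4] by blast
    have \<sigma>r: "\<sigma> \<le> r0" using \<sigma>(2)[OF xf, of 0] \<sigma>(1) by simp
    let ?x1 = "x + \<sigma> *\<^sub>R n x"
    have "?x1 \<in> \<Omega>" using inward_inside(1)[OF xf xf _ \<sigma>(1) \<sigma>r] r0 by simp
    then obtain d1 where d1: "d1 > 0" "\<And>t y. y \<in> \<Omega> \<Longrightarrow> dist y ?x1 < d1 \<Longrightarrow> dist (g t y) (g t ?x1) < e / 4"
      using int e4 unfolding equicont_on_def by meson
    define d where "d = min \<sigma> (d1 / 5)"
    have d: "0 < d" "d \<le> \<sigma>" "d \<le> d1 / 5" using \<sigma>(1) d1(1) by (auto simp: d_def)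
    have "dist (g t y) (g t x) < e" if y: "y \<in> closure \<Omega>" "dist y x < d" for t y
    proof -
      have "x \<in> ball y d" using y by simp
      then have nb: "\<not> ball y d \<subseteq> \<Omega>" using False by blast
      obtain q where q: "q \<in> frontier \<Omega>" "dist y q < d" "y = q + dist y q *\<^sub>R n q"
        using near_boundary_cases[OF y(1) nb d(1)] .
      have qx: "dist q x \<le> 2 * d" using dist_triangle[of q x y] q(2) y(2) by (simp add: dist_commute)
      have "(q + \<sigma> *\<^sub>R n q) - ?x1 = (q - x) + \<sigma> *\<^sub>R (n q - n x)" by (simp add: algebra_simps)
      also have "norm \<dots> \<le> norm (q - x) + norm (\<sigma> *\<^sub>R (n q - n x))" by (rule norm_triangle_ineq)
      also have "norm (\<sigma> *\<^sub>R (n q - n x)) \<le> r0 * (dist q x / r0)"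
        unfolding norm_scaleR using normal_lipschitz[OF q(1) xf] \<sigma>(1) \<sigma>r by (intro mult_mono) auto
      also have "\<dots> = dist q x" using r0 by simp
      finally have "dist (q + \<sigma> *\<^sub>R n q) ?x1 < d1" using qx d d1 by (simp add: dist_norm)
      moreover have "q + \<sigma> *\<^sub>R n q \<in> \<Omega>" using inward_inside(1)[OF q(1) q(1) _ \<sigma>(1) \<sigma>r] r0 by simp
      ultimately have 1: "dist (g t (q + \<sigma> *\<^sub>R n q)) (g t ?x1) < e / 4" by (rule d1(2)[rotated])
      have 2: "dist (g t (q + \<sigma> *\<^sub>R n q)) (g t y) \<le> e / 4"
        using \<sigma>(2)[OF q(1), of "dist y q" t] q(2,3) d by (simp add: dist_norm)
      have 3: "dist (g t ?x1) (g t x) \<le> e / 4"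
        using \<sigma>(2)[OF xf, of 0 t] \<sigma>(1) by (simp add: dist_norm)
      show ?thesis
        using dist_triangle[of "g t y" "g t x" "g t (q + \<sigma> *\<^sub>R n q)"]
          dist_triangle[of "g t (q + \<sigma> *\<^sub>R n q)" "g t x" "g t ?x1"] 1 2 3 e by (simp add: dist_commute)
    qed
    then show ?thesis using d(1) by blast
  qed
qed

section \<open>Uniform interior regularity\<close>

context neumann_flow
begin

definition grad_bound :: real where
  "grad_bound = (SOME \<Lambda>. 0 < \<Lambda> \<and> (\<forall>t. \<forall>x\<in>closure \<Omega>. norm (G t x) \<le> \<Lambda>))"

lemma grad_bound_pos: "0 < grad_bound" and grad_le: "x \<in> closure \<Omega> \<Longrightarrow> norm (G t x) \<le> grad_bound"
proof -
  have "0 < grad_bound \<and> (\<forall>t. \<forall>x\<in>closure \<Omega>. norm (G t x) \<le> grad_bound)"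
    unfolding grad_bound_def by (rule someI_ex) (use global_gradient_bound in blast)
  then show "0 < grad_bound" "x \<in> closure \<Omega> \<Longrightarrow> norm (G t x) \<le> grad_bound" by blast+
qed

text \<open>The Lipschitz constants of the gradient and of the Hessian at a point whose distance from the boundary
is a multiple of \<open>\<rho>\<close>.\<close>

definition grad_lip :: "real \<Rightarrow> real" where "grad_lip \<rho> = dim_const * (grad_bound / \<rho> + L * grad_bound * \<rho>)"
definition hess_lip :: "real \<Rightarrow> real" where "hess_lip \<rho> = dim_const * (grad_lip \<rho> / \<rho> + (L * grad_lip \<rho> + 2 * L * grad_bound\<^sup>2) * \<rho>)"

lemma grad_lip_pos: "0 < \<rho> \<Longrightarrow> 0 < grad_lip \<rho>"
  using dim_const_ge_1 grad_bound_pos L by (simp add: grad_lip_def add_pos_pos)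

lemma hess_lip_pos: "0 < \<rho> \<Longrightarrow> 0 < hess_lip \<rho>"
  using dim_const_ge_1 grad_bound_pos L grad_lip_pos[of \<rho>] by (simp add: hess_lip_def add_pos_pos)

lemma u_increment:
  assumes "\<And>s. 0 < s \<Longrightarrow> s < 1 \<Longrightarrow> y + s *\<^sub>R h \<in> \<Omega>" "y \<in> closure \<Omega>" "y + h \<in> closure \<Omega>"
  obtains s where "0 < s" "s < 1" "u t (y + h) - u t y = G t (y + s *\<^sub>R h) \<bullet> h"
  using u_mvt[of 1 y h t] assms by auto

lemma u_lipschitz:
  assumes "\<And>s. 0 < s \<Longrightarrow> s < 1 \<Longrightarrow> y + s *\<^sub>R h \<in> \<Omega>" "y \<in> closure \<Omega>" "y + h \<in> closure \<Omega>"
  shows "\<bar>u t (y + h) - u t y\<bar> \<le> grad_bound * norm h"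
proof -
  obtain s where s: "0 < s" "s < 1" "u t (y + h) - u t y = G t (y + s *\<^sub>R h) \<bullet> h"
    using u_increment[OF assms] by blast
  have "\<bar>G t (y + s *\<^sub>R h) \<bullet> h\<bar> \<le> norm (G t (y + s *\<^sub>R h)) * norm h" by (rule Cauchy_Schwarz_ineq2)
  also have "\<dots> \<le> grad_bound * norm h" using grad_le[OF dom_closure[OF assms(1)[OF s(1,2)]]] by (intro mult_right_mono) auto
  finally show ?thesis using s(3) by simp
qed

lemma add_in_cball:
  assumes "cball x R \<subseteq> \<Omega>" "dist x y \<le> a" "norm h \<le> b" "a + b \<le> R" "0 \<le> s" "s \<le> 1"
  shows "y + s *\<^sub>R h \<in> \<Omega>" "dist x (y + s *\<^sub>R h) \<le> a + b"
proof -
  have "norm (s *\<^sub>R h) \<le> norm h" using assms by (simp add: mult_left_le_one_le)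
  moreover have "dist y (y + s *\<^sub>R h) = norm (s *\<^sub>R h)" by (simp add: dist_norm)
  ultimately show d: "dist x (y + s *\<^sub>R h) \<le> a + b"
    using dist_triangle[of x "y + s *\<^sub>R h" y] assms by linarith
  then show "y + s *\<^sub>R h \<in> \<Omega>" using assms by (auto simp: subset_iff)
qed

lemma cont_u_shift:
  assumes "\<And>y. y \<in> K \<Longrightarrow> y + h \<in> closure \<Omega>"
  shows "continuous_on (I \<times> K) (\<lambda>q. u (fst q) (snd q + h))"
  by (rule continuous_on_compose2[OF cont_u, of _ "\<lambda>q. (fst q, snd q + h)", simplified])
     (use assms in \<open>auto intro!: continuous_intros\<close>)

text \<open>The interior gradient estimate for the difference \<open>u(x + h) - u(x)\<close>, which solves a linear equation and is of
order \<open>|h|\<close>.\<close>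

lemma grad_lipschitz:
  assumes \<rho>: "0 < \<rho>" and b: "cball x (2 * \<rho>) \<subseteq> \<Omega>" and h: "norm h \<le> \<rho>"
  shows "norm (G t (x + h) - G t x) \<le> grad_lip \<rho> * norm h"
proof -
  define w where "w = (\<lambda>t y. u (t + 0) (y + h) - u t y)"
  have seg: "y + s *\<^sub>R h \<in> \<Omega>" if "y \<in> cball x \<rho>" "0 \<le> s" "s \<le> 1" for y s
    by (rule add_in_cball(1)[OF b _ h _ that(2,3)]) (use that in auto)
  have in0: "y \<in> \<Omega>" "y + h \<in> \<Omega>" if "y \<in> cball x \<rho>" for y
    using seg[OF that, of 0] seg[OF that, of 1] by auto
  have wb: "\<bar>w t y\<bar> \<le> grad_bound * norm h" if "y \<in> cball x \<rho>" for t y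
    using u_lipschitz[of y h t] seg[OF that] in0[OF that] dom_closure by (simp add: w_def)
  have xin: "x \<in> \<Omega>" "x + h \<in> \<Omega>" using in0[of x] \<rho> by auto
  have "norm (G t (x + h) - G t x) \<le> real DIM('a) * (1 + 2 * real DIM('a)) * (grad_bound * norm h / \<rho> + L * grad_bound * norm h * \<rho>)"
  proof (rule interior_gradient_estimate[OF \<rho> _ wb])
    show "continuous_on ({t - \<rho>\<^sup>2..t} \<times> cball x \<rho>) (\<lambda>(t, x). w t x)"
      unfolding w_def case_prod_beta add_0_right
      by (intro continuous_on_diff cont_u_shift cont_u_sub[unfolded case_prod_beta]) (use in0 dom_closure in auto)
    fix s y assume y: "y \<in> ball x \<rho>"
    then have y': "y \<in> cball x \<rho>" by simp
    have h: "heat_at w s y (f (u s (y + h)) - f (u s y))"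
      unfolding w_def by (intro heat_at_diff heat_at_translate) (use heat_u in0[OF y'] in auto)
    have "\<bar>f (u s (y + h)) - f (u s y)\<bar> \<le> L * \<bar>u s (y + h) - u s y\<bar>"
      using f_lip u01 dom_closure in0[OF y'] by blast
    also have "\<dots> \<le> L * (grad_bound * norm h)" using wb[OF y', of s] L by (simp add: w_def)
    finally show "\<exists>r. heat_at w s y r \<and> \<bar>r\<bar> \<le> L * grad_bound * norm h" using h by (auto simp: mult.assoc)
  next
    show "GDERIV (w t) x :> G t (x + h) - G t x"
      unfolding w_def add_0_right by (intro GDERIV_diff GDERIV_translate grad xin)
  qed
  also have "\<dots> = grad_lip \<rho> * norm h" by (simp add: grad_lip_def dim_const_def algebra_simps)
  finally show ?thesis .
qed

text \<open>The same estimate for second differences. They are of order \<open>|h| |k|\<close> by \<open>grad_lipschitz\<close>, and so is the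
second difference of \<open>f(u)\<close> because \<open>f'\<close> is Lipschitz.\<close>

lemma grad_second_difference:
  assumes \<rho>: "0 < \<rho>" and b: "cball x (4 * \<rho>) \<subseteq> \<Omega>" and h: "norm h \<le> \<rho>" and k: "norm k \<le> \<rho>"
  shows "norm (G t (x + h + k) - G t (x + h) - (G t (x + k) - G t x)) \<le> hess_lip \<rho> * norm h * norm k"
proof -
  define w where "w = (\<lambda>t y. (u (t + 0) (y + (h + k)) - u (t + 0) (y + h)) - (u (t + 0) (y + k) - u t y))"
  have seg: "y + s *\<^sub>R h \<in> \<Omega>" "dist x (y + s *\<^sub>R h) \<le> 2 * \<rho>" if "y \<in> cball x \<rho>" "0 \<le> s" "s \<le> 1" for y s
    using add_in_cball[OF b _ h _ that(2,3), of y \<rho>] that \<rho> by auto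
  have seg2: "y + s *\<^sub>R k \<in> \<Omega>" if "dist x y \<le> 2 * \<rho>" "0 \<le> s" "s \<le> 1" for y s
    by (rule add_in_cball(1)[OF b _ k _ that(2,3), of _ "2 * \<rho>"]) (use that \<rho> in auto)
  have in0: "y \<in> \<Omega>" "y + h \<in> \<Omega>" "y + k \<in> \<Omega>" "y + (h + k) \<in> \<Omega>" if "y \<in> cball x \<rho>" for y
    using seg[OF that, of 0] seg[OF that, of 1] seg2[of y 1] seg2[of "y + h" 1] \<rho> that
    by (auto simp: algebra_simps)
  have xin: "x \<in> \<Omega>" "x + h \<in> \<Omega>" "x + k \<in> \<Omega>" "x + (h + k) \<in> \<Omega>" using in0[of x] \<rho> by auto
  have wb: "\<bar>w t y\<bar> \<le> grad_lip \<rho> * norm h * norm k" if y: "y \<in> cball x \<rho>" for t y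
  proof -
    have d: "((\<lambda>s. u t (y + k + s *\<^sub>R h) - u t (y + s *\<^sub>R h)) has_derivative
        (\<lambda>a. (a *\<^sub>R h) \<bullet> G t (y + k + s *\<^sub>R h) - (a *\<^sub>R h) \<bullet> G t (y + s *\<^sub>R h))) (at s)"
      if s: "0 \<le> s" "s \<le> 1" for s
    proof (rule has_derivative_diff)
      have "y + k + s *\<^sub>R h \<in> \<Omega>" using seg2[OF seg(2)[OF y s], of 1] by (simp add: algebra_simps)
      from grad[OF this, of t] show "((\<lambda>s. u t (y + k + s *\<^sub>R h)) has_derivative (\<lambda>a. (a *\<^sub>R h) \<bullet> G t (y + k + s *\<^sub>R h))) (at s)"
        by (intro has_derivative_compose[of "\<lambda>s. y + k + s *\<^sub>R h" "\<lambda>a. a *\<^sub>R h" s UNIV "u t"])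
           (auto simp: gderiv_def intro!: derivative_eq_intros)
      from grad[OF seg(1)[OF y s], of t] show "((\<lambda>s. u t (y + s *\<^sub>R h)) has_derivative (\<lambda>a. (a *\<^sub>R h) \<bullet> G t (y + s *\<^sub>R h))) (at s)"
        by (intro has_derivative_compose[of "\<lambda>s. y + s *\<^sub>R h" "\<lambda>a. a *\<^sub>R h" s UNIV "u t"])
           (auto simp: gderiv_def intro!: derivative_eq_intros)
    qed
    have "continuous_on {0..1} (\<lambda>s. u t (y + k + s *\<^sub>R h) - u t (y + s *\<^sub>R h))"
      by (intro continuous_at_imp_continuous_on ballI has_derivative_continuous[OF d]) auto
    note cont = this
    obtain s where s: "0 < s" "s < 1" "(u t (y + k + 1 *\<^sub>R h) - u t (y + 1 *\<^sub>R h)) - (u t (y + k + 0 *\<^sub>R h) - u t (y + 0 *\<^sub>R h))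
       = ((1 - 0) *\<^sub>R h) \<bullet> G t (y + k + s *\<^sub>R h) - ((1 - 0) *\<^sub>R h) \<bullet> G t (y + s *\<^sub>R h)"
      using mvt[OF zero_less_one cont d[OF less_imp_le less_imp_le]] by blast
    let ?z = "y + s *\<^sub>R h"
    have "cball ?z (2 * \<rho>) \<subseteq> \<Omega>"
    proof
      fix z assume "z \<in> cball ?z (2 * \<rho>)"
      then have "dist x z \<le> 4 * \<rho>" using dist_triangle[of x z ?z] seg(2)[OF y, of s] s by simp
      then show "z \<in> \<Omega>" using b by auto
    qed
    from grad_lipschitz[OF \<rho> this k, of t] have g: "norm (G t (?z + k) - G t ?z) \<le> grad_lip \<rho> * norm k" .
    have "w t y = h \<bullet> (G t (?z + k) - G t ?z)" using s(3) by (simp add: w_def inner_diff_right algebra_simps)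
    also have "\<bar>\<dots>\<bar> \<le> norm h * norm (G t (?z + k) - G t ?z)" by (rule Cauchy_Schwarz_ineq2)
    also have "\<dots> \<le> norm h * (grad_lip \<rho> * norm k)" using g by (intro mult_left_mono) auto
    finally show ?thesis by (simp add: mult_ac)
  qed
  have "norm ((G t (x + (h + k)) - G t (x + h)) - (G t (x + k) - G t x)) \<le> real DIM('a) * (1 + 2 * real DIM('a)) *
      (grad_lip \<rho> * norm h * norm k / \<rho> + (L * grad_lip \<rho> + 2 * L * grad_bound\<^sup>2) * norm h * norm k * \<rho>)"
  proof (rule interior_gradient_estimate[OF \<rho> _ wb])
    show "continuous_on ({t - \<rho>\<^sup>2..t} \<times> cball x \<rho>) (\<lambda>(t, x). w t x)"
      unfolding w_def case_prod_beta add_0_right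
      by (intro continuous_on_diff cont_u_shift cont_u_sub[unfolded case_prod_beta]) (use in0 dom_closure in auto)
    fix s y assume y: "y \<in> ball x \<rho>"
    then have y': "y \<in> cball x \<rho>" by simp
    let ?a = "u s (y + (h + k))" and ?b = "u s (y + h)" and ?c = "u s (y + k)" and ?d = "u s y"
    have ht: "heat_at w s y (f ?a - f ?b - (f ?c - f ?d))"
      unfolding w_def by (intro heat_at_diff heat_at_translate) (use heat_u in0[OF y'] in auto)
    have ab: "\<bar>?a - ?b\<bar> \<le> grad_bound * norm k"
      using u_lipschitz[of "y + h" k s] seg2[of "y + h"] seg(2)[OF y', of 1] in0[OF y'] dom_closure by (simp add: add.assoc)
    have cd_diff: "\<bar>?c - ?d\<bar> \<le> grad_bound * norm k"
      using u_lipschitz[of y k s] seg2[of y] y' \<rho> in0[OF y'] dom_closure by simp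
    have bd: "\<bar>?b - ?d\<bar> \<le> grad_bound * norm h"
      using u_lipschitz[of y h s] seg[OF y'] in0[OF y'] dom_closure by simp
    have "\<bar>f ?a - f ?b - (f ?c - f ?d)\<bar> \<le> L * \<bar>?a - ?b - (?c - ?d)\<bar> + L * (\<bar>?c - ?d\<bar> + \<bar>?a - ?b\<bar>) * \<bar>?b - ?d\<bar>"
      using f_second u01 dom_closure in0[OF y'] by blast
    also have "\<dots> \<le> L * (grad_lip \<rho> * norm h * norm k) + L * (grad_bound * norm k + grad_bound * norm k) * (grad_bound * norm h)"
      using wb[OF y', of s] ab bd cd_diff L grad_bound_pos by (intro add_mono mult_mono mult_left_mono) (auto simp: w_def)
    also have "\<dots> = (L * grad_lip \<rho> + 2 * L * grad_bound\<^sup>2) * norm h * norm k" by (simp add: power2_eq_square algebra_simps)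
    finally show "\<exists>r. heat_at w s y r \<and> \<bar>r\<bar> \<le> (L * grad_lip \<rho> + 2 * L * grad_bound\<^sup>2) * norm h * norm k" using ht by blast
  next
    show "GDERIV (w t) x :> (G t (x + (h + k)) - G t (x + h)) - (G t (x + k) - G t x)"
      unfolding w_def add_0_right by (intro GDERIV_diff GDERIV_translate grad xin)
  qed
  also have "\<dots> = hess_lip \<rho> * norm h * norm k" by (simp add: hess_lip_def dim_const_def algebra_simps)
  finally show ?thesis by (simp add: add.assoc)
qed

lemma hess_lipschitz:
  assumes \<rho>: "0 < \<rho>" and b: "cball x (4 * \<rho>) \<subseteq> \<Omega>" and k: "norm k \<le> \<rho>"
  shows "norm (H t (x + k) - H t x) \<le> hess_lip \<rho> * norm k"
proof (rule norm_blinfun_bound)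
  show "0 \<le> hess_lip \<rho> * norm k" using hess_lip_pos[OF \<rho>] by simp
  fix v
  have xin: "x \<in> \<Omega>" "x + k \<in> \<Omega>" using b \<rho> k by (auto simp: subset_iff dist_norm)
  have "((\<lambda>y. G t (y + k)) has_derivative H t (x + k)) (at x)"
    by (rule has_derivative_compose[of "\<lambda>y. y + k" "\<lambda>h. h" x UNIV "G t"])
       (use hess[OF xin(2), of t] in \<open>auto intro!: derivative_eq_intros\<close>)
  then have d: "((\<lambda>y. G t (y + k) - G t y) has_derivative (\<lambda>v. H t (x + k) v - H t x v)) (at x)"
    by (intro has_derivative_diff hess xin)
  show "norm (blinfun_apply (H t (x + k) - H t x) v) \<le> hess_lip \<rho> * norm k * norm v"
  proof (cases "v = 0")
    case False
    have "norm (H t (x + k) v - H t x v) \<le> hess_lip \<rho> * norm k * norm v"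
    proof (rule norm_directional_derivative_le[OF d])
      show "0 < \<rho> / norm v" using \<rho> False by simp
      fix s assume s: "0 < s" "s \<le> \<rho> / norm v"
      then have "norm (s *\<^sub>R v) \<le> \<rho>" using False by (simp add: pos_le_divide_eq)
      from grad_second_difference[OF \<rho> b this k, of t]
      have "norm (G t (x + s *\<^sub>R v + k) - G t (x + s *\<^sub>R v) - (G t (x + k) - G t x)) \<le> hess_lip \<rho> * norm (s *\<^sub>R v) * norm k" .
      then show "norm ((G t (x + s *\<^sub>R v + k) - G t (x + s *\<^sub>R v)) - (G t (x + k) - G t x)) \<le> s * (hess_lip \<rho> * norm k * norm v)"
        using s by (simp add: algebra_simps)
    qed
    then show ?thesis by (simp add: blinfun.diff_left)
  qed simp
qed

lemma taylor_u:
  assumes \<rho>: "0 < \<rho>" and b: "cball x (4 * \<rho>) \<subseteq> \<Omega>" and h: "norm h \<le> \<rho>"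
  shows "norm (u t (x + h) - u t x - h \<bullet> G t x) \<le> grad_lip \<rho> * (norm h)\<^sup>2"
proof -
  have seg: "x + s *\<^sub>R h \<in> \<Omega>" "dist x (x + s *\<^sub>R h) \<le> \<rho>" if "0 \<le> s" "s \<le> 1" for s
    using add_in_cball[OF b _ h _ that, of x 0] \<rho> by auto
  obtain s where s: "0 < s" "s < 1" "u t (x + h) - u t x = G t (x + s *\<^sub>R h) \<bullet> h"
    using u_increment[of x h t] seg(1) seg(1)[of 0] seg(1)[of 1] dom_closure by auto
  have b2: "cball x (2 * \<rho>) \<subseteq> \<Omega>" using b \<rho> by (auto simp: subset_iff)
  have "norm (s *\<^sub>R h) \<le> norm h" using s by (simp add: mult_left_le_one_le)
  have "norm (G t (x + s *\<^sub>R h) - G t x) \<le> grad_lip \<rho> * norm (s *\<^sub>R h)"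
    by (rule grad_lipschitz[OF \<rho> b2]) (use \<open>norm (s *\<^sub>R h) \<le> norm h\<close> h in linarith)
  also have "\<dots> \<le> grad_lip \<rho> * norm h" using \<open>norm (s *\<^sub>R h) \<le> norm h\<close> grad_lip_pos[OF \<rho>] by (intro mult_left_mono) auto
  finally have g: "norm (G t (x + s *\<^sub>R h) - G t x) \<le> grad_lip \<rho> * norm h" .
  have "u t (x + h) - u t x - h \<bullet> G t x = (G t (x + s *\<^sub>R h) - G t x) \<bullet> h"
    using s(3) by (simp add: inner_diff_left inner_commute[of h])
  also have "norm \<dots> \<le> norm (G t (x + s *\<^sub>R h) - G t x) * norm h" by (simp add: Cauchy_Schwarz_ineq2)
  also have "\<dots> \<le> grad_lip \<rho> * norm h * norm h" using g by (intro mult_right_mono) auto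
  finally show ?thesis by (simp add: power2_eq_square mult.assoc)
qed

lemma taylor_G:
  assumes \<rho>: "0 < \<rho>" and b: "cball x (4 * \<rho>) \<subseteq> \<Omega>" and h: "norm h \<le> \<rho>"
  shows "norm (G t (x + h) - G t x - H t x h) \<le> hess_lip \<rho> * (norm h)\<^sup>2"
proof -
  have seg: "x + s *\<^sub>R h \<in> \<Omega>" if "0 \<le> s" "s \<le> 1" for s
    using add_in_cball[OF b _ h _ that, of x 0] \<rho> by auto
  have d: "((\<lambda>s. G t (x + s *\<^sub>R h) - s *\<^sub>R H t x h) has_vector_derivative (H t (x + s *\<^sub>R h) h - H t x h)) (at s)"
    if s: "0 \<le> s" "s \<le> 1" for s
  proof -
    have "((\<lambda>s. G t (x + s *\<^sub>R h)) has_derivative (\<lambda>a. H t (x + s *\<^sub>R h) (a *\<^sub>R h))) (at s)"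
      by (rule has_derivative_compose[of "\<lambda>s. x + s *\<^sub>R h" "\<lambda>a. a *\<^sub>R h" s UNIV "G t"])
         (use hess[OF seg[OF s], of t] in \<open>auto intro!: derivative_eq_intros\<close>)
    then have "((\<lambda>s. G t (x + s *\<^sub>R h)) has_vector_derivative H t (x + s *\<^sub>R h) h) (at s)"
      by (simp add: has_vector_derivative_def blinfun.scaleR_right)
    moreover have "((\<lambda>s. s *\<^sub>R H t x h) has_vector_derivative H t x h) (at s)"
      by (auto simp: has_vector_derivative_def intro!: derivative_eq_intros)
    ultimately show ?thesis by (rule has_vector_derivative_diff)
  qed
  have "norm ((G t (x + 1 *\<^sub>R h) - 1 *\<^sub>R H t x h) - (G t (x + 0 *\<^sub>R h) - 0 *\<^sub>R H t x h))
      \<le> hess_lip \<rho> * (norm h)\<^sup>2 * 1 - hess_lip \<rho> * (norm h)\<^sup>2 * 0"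
  proof (rule differentiable_bound_general[OF zero_less_one, where \<phi> = "\<lambda>s. hess_lip \<rho> * (norm h)\<^sup>2 * s"])
    show "continuous_on {0..1} (\<lambda>s. G t (x + s *\<^sub>R h) - s *\<^sub>R H t x h)"
      by (intro continuous_at_imp_continuous_on ballI has_vector_derivative_continuous[OF d]) auto
    show "continuous_on {0..1} (\<lambda>s. hess_lip \<rho> * (norm h)\<^sup>2 * s)" by (intro continuous_intros)
    fix s :: real assume s: "0 < s" "s < 1"
    show "((\<lambda>s. G t (x + s *\<^sub>R h) - s *\<^sub>R H t x h) has_vector_derivative (H t (x + s *\<^sub>R h) h - H t x h)) (at s)"
      using d s by simp
    show "((\<lambda>s. hess_lip \<rho> * (norm h)\<^sup>2 * s) has_vector_derivative hess_lip \<rho> * (norm h)\<^sup>2) (at s)"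
      by (auto simp: has_vector_derivative_def intro!: derivative_eq_intros)
    have sh: "norm (s *\<^sub>R h) \<le> norm h" using s by (simp add: mult_left_le_one_le)
    have "norm (H t (x + s *\<^sub>R h) - H t x) \<le> hess_lip \<rho> * norm (s *\<^sub>R h)"
      by (rule hess_lipschitz[OF \<rho> b]) (use sh h in linarith)
    also have "\<dots> \<le> hess_lip \<rho> * norm h" using sh hess_lip_pos[OF \<rho>] by (intro mult_left_mono) auto
    finally have "norm (H t (x + s *\<^sub>R h) - H t x) * norm h \<le> hess_lip \<rho> * norm h * norm h" by (intro mult_right_mono) auto
    then show "norm (H t (x + s *\<^sub>R h) h - H t x h) \<le> hess_lip \<rho> * (norm h)\<^sup>2"
      using norm_blinfun[of "H t (x + s *\<^sub>R h) - H t x" h] by (simp add: blinfun.diff_left power2_eq_square mult.assoc)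
  qed
  then show ?thesis by (simp add: algebra_simps)
qed

lemma interior_radius:
  assumes "x \<in> \<Omega>" obtains \<rho> where "0 < \<rho>" "cball x (4 * \<rho>) \<subseteq> \<Omega>"
proof -
  obtain e where "0 < e" "cball x e \<subseteq> \<Omega>" using open_dom assms open_contains_cball by blast
  then show ?thesis using that[of "e / 4"] by simp
qed

lemma lipschitz_equicont:
  fixes g :: "real \<Rightarrow> 'a \<Rightarrow> 'b::real_normed_vector"
  assumes "\<And>x. x \<in> \<Omega> \<Longrightarrow> \<exists>\<rho>>0. \<exists>C>0. \<forall>t h. norm h \<le> \<rho> \<longrightarrow> norm (g t (x + h) - g t x) \<le> C * norm h"
  shows "equicont_on \<Omega> g"
  unfolding equicont_on_def
proof (intro ballI allI impI)
  fix x and e :: real assume x: "x \<in> \<Omega>" and e: "0 < e"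
  obtain \<rho> C where \<rho>: "\<rho> > 0" "C > 0" "\<And>t h. norm h \<le> \<rho> \<Longrightarrow> norm (g t (x + h) - g t x) \<le> C * norm h"
    using assms[OF x] by blast
  define d where "d = min \<rho> (e / C)"
  have d: "0 < d" "d \<le> \<rho>" "d \<le> e / C" using \<rho> e by (auto simp: d_def)
  have "dist (g t y) (g t x) < e" if y: "dist y x < d" for t y
  proof -
    have "norm (g t (x + (y - x)) - g t x) \<le> C * norm (y - x)"
      by (rule \<rho>(3)) (use y d in \<open>simp add: dist_norm\<close>)
    also have "\<dots> < C * (e / C)" using y d \<rho> by (intro mult_strict_left_mono) (auto simp: dist_norm)
    finally show ?thesis using \<rho> by (simp add: dist_norm)
  qed
  then show "\<exists>d>0. \<forall>t. \<forall>y\<in>\<Omega>. dist y x < d \<longrightarrow> dist (g t y) (g t x) < e" using d by blast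
qed

lemma equicont_H: "equicont_on \<Omega> H"
proof (rule lipschitz_equicont)
  fix x assume "x \<in> \<Omega>"
  then obtain \<rho> where \<rho>: "0 < \<rho>" "cball x (4 * \<rho>) \<subseteq> \<Omega>" by (rule interior_radius)
  show "\<exists>\<rho>>0. \<exists>C>0. \<forall>t h. norm h \<le> \<rho> \<longrightarrow> norm (H t (x + h) - H t x) \<le> C * norm h"
    using \<rho> hess_lip_pos[OF \<rho>(1)] hess_lipschitz[OF \<rho>] by blast
qed

lemma equicont_G: "equicont_on (closure \<Omega>) G"
proof (rule boundary_equicontinuity)
  show "equicont_on \<Omega> G"
  proof (rule lipschitz_equicont)
    fix x assume "x \<in> \<Omega>"
    then obtain \<rho> where \<rho>: "0 < \<rho>" "cball x (4 * \<rho>) \<subseteq> \<Omega>" by (rule interior_radius)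
    have b: "cball x (2 * \<rho>) \<subseteq> \<Omega>" using \<rho> by (auto simp: subset_iff)
    show "\<exists>\<rho>>0. \<exists>C>0. \<forall>t h. norm h \<le> \<rho> \<longrightarrow> norm (G t (x + h) - G t x) \<le> C * norm h"
      using \<rho> grad_lip_pos[OF \<rho>(1)] grad_lipschitz[OF \<rho>(1) b] by blast
  qed
  fix e :: real assume e: "0 < e"
  define r where "r = min 1 (r0 / (16 * real DIM('a)))"
  have r: "0 < r" "r \<le> r0 / (16 * real DIM('a))" "r \<le> 1" using r0 by (auto simp: r_def)
  have rr: "r \<le> r0 / 16" by (rule small_radius[OF r(1,2)])
  define \<sigma> where "\<sigma> = min (r / 2) ((e * r / (2 * grad_bound * modulus_const))\<^sup>2)"
  have \<sigma>: "0 < \<sigma>" "\<sigma> \<le> r / 2" using r e grad_bound_pos modulus_const_pos by (auto simp: \<sigma>_def)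
  have "sqrt \<sigma> \<le> sqrt ((e * r / (2 * grad_bound * modulus_const))\<^sup>2)" by (rule real_sqrt_le_mono) (simp add: \<sigma>_def)
  then have s: "sqrt \<sigma> \<le> e * r / (2 * grad_bound * modulus_const)" using e r grad_bound_pos modulus_const_pos by simp
  have "2 * grad_bound * modulus_const / r * sqrt \<sigma> \<le> 2 * grad_bound * modulus_const / r * (e * r / (2 * grad_bound * modulus_const))"
    using s grad_bound_pos modulus_const_pos r by (intro mult_left_mono) auto
  also have "\<dots> = e" using grad_bound_pos modulus_const_pos r by simp
  finally have le: "2 * grad_bound * modulus_const / r * sqrt \<sigma> \<le> e" .
  have "norm (G t (p + \<sigma> *\<^sub>R n p) - G t (p + s *\<^sub>R n p)) \<le> e" if "p \<in> frontier \<Omega>" "0 \<le> s" "s \<le> \<sigma>" for p s t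
    using normal_modulus[OF that(1) r grad_bound_pos grad_le that(2,3) \<sigma>(2), of t] le by (meson order_trans)
  moreover have "\<sigma> \<le> r0" using \<sigma> rr r r0 by linarith
  ultimately show "\<exists>\<sigma>>0. \<forall>s t p. p \<in> frontier \<Omega> \<and> 0 \<le> s \<and> s \<le> \<sigma> \<longrightarrow>
        norm (G t (p + \<sigma> *\<^sub>R n p) - G t (p + s *\<^sub>R n p)) \<le> e \<and> \<sigma> \<le> r0"
    using \<sigma>(1) by blast
qed

lemma equicont_u: "equicont_on (closure \<Omega>) u"
proof (rule boundary_equicontinuity)
  show "equicont_on \<Omega> u"
  proof (rule lipschitz_equicont)
    fix x assume "x \<in> \<Omega>"
    then obtain \<rho> where \<rho>: "0 < \<rho>" "cball x (4 * \<rho>) \<subseteq> \<Omega>" by (rule interior_radius)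
    have "norm (u t (x + h) - u t x) \<le> grad_bound * norm h" if h: "norm h \<le> \<rho>" for t h
    proof -
      have seg: "x + s *\<^sub>R h \<in> \<Omega>" if "0 \<le> s" "s \<le> 1" for s
        using add_in_cball[OF \<rho>(2) _ h _ that, of x 0] \<rho> by auto
      show ?thesis using u_lipschitz[of x h t] seg seg[of 0] seg[of 1] dom_closure by simp
    qed
    then show "\<exists>\<rho>>0. \<exists>C>0. \<forall>t h. norm h \<le> \<rho> \<longrightarrow> norm (u t (x + h) - u t x) \<le> C * norm h"
      using \<rho>(1) grad_bound_pos by blast
  qed
  fix e :: real assume e: "0 < e"
  define \<sigma> where "\<sigma> = min r0 (e / grad_bound)"
  have \<sigma>: "0 < \<sigma>" "\<sigma> \<le> r0" "grad_bound * \<sigma> \<le> e"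
  proof -
    show "0 < \<sigma>" "\<sigma> \<le> r0" using r0 e grad_bound_pos by (auto simp: \<sigma>_def)
    have "grad_bound * \<sigma> \<le> grad_bound * (e / grad_bound)" using grad_bound_pos by (intro mult_left_mono) (auto simp: \<sigma>_def)
    then show "grad_bound * \<sigma> \<le> e" using grad_bound_pos by simp
  qed
  have "norm (u t (p + \<sigma> *\<^sub>R n p) - u t (p + s *\<^sub>R n p)) \<le> e" if p: "p \<in> frontier \<Omega>" and s: "0 \<le> s" "s \<le> \<sigma>" for p s t
  proof -
    have ins: "p + \<tau> *\<^sub>R n p \<in> \<Omega>" if "0 < \<tau>" "\<tau> \<le> \<sigma>" for \<tau>
      using inward_inside(1)[OF p p, of \<tau>] that \<sigma> r0 by simp
    have cl: "p + s *\<^sub>R n p \<in> closure \<Omega>" using ins[of s] s frontier_closure[OF p] dom_closure by (cases "s = 0") auto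
    have "\<bar>u t (p + s *\<^sub>R n p + (\<sigma> - s) *\<^sub>R n p) - u t (p + s *\<^sub>R n p)\<bar> \<le> grad_bound * norm ((\<sigma> - s) *\<^sub>R n p)"
    proof (cases "s = \<sigma>")
      case False
      then have ss: "s < \<sigma>" using s by simp
      show ?thesis
      proof (rule u_lipschitz)
        fix a :: real assume a: "0 < a" "a < 1"
        have "s + a * (\<sigma> - s) \<le> s + 1 * (\<sigma> - s)" using a ss by (intro add_left_mono mult_right_mono) auto
        moreover have "0 < s + a * (\<sigma> - s)" using a ss s by (simp add: add_nonneg_pos)
        ultimately have "p + (s + a * (\<sigma> - s)) *\<^sub>R n p \<in> \<Omega>" by (intro ins) auto
        then show "p + s *\<^sub>R n p + a *\<^sub>R (\<sigma> - s) *\<^sub>R n p \<in> \<Omega>" by (simp add: algebra_simps)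
      next
        show "p + s *\<^sub>R n p + (\<sigma> - s) *\<^sub>R n p \<in> closure \<Omega>"
          using ins[of \<sigma>] \<sigma> dom_closure by (simp add: algebra_simps)
      qed (fact cl)
    qed simp
    moreover have "grad_bound * norm ((\<sigma> - s) *\<^sub>R n p) \<le> grad_bound * \<sigma>" using s norm_n[OF p] grad_bound_pos by simp
    ultimately show ?thesis using \<sigma>(3) by (simp add: algebra_simps)
  qed
  then show "\<exists>\<sigma>>0. \<forall>s t p. p \<in> frontier \<Omega> \<and> 0 \<le> s \<and> s \<le> \<sigma> \<longrightarrow>
        norm (u t (p + \<sigma> *\<^sub>R n p) - u t (p + s *\<^sub>R n p)) \<le> e \<and> \<sigma> \<le> r0"
    using \<sigma>(1,2) by blast
qed

end


section \<open>The limit for large times\<close>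

context neumann_flow
begin

lemma grad_limit_interior:
  assumes lim: "\<And>x. x \<in> \<Omega> \<Longrightarrow> \<exists>l. ((\<lambda>t. u t x) \<longlongrightarrow> l) at_top" and x: "x \<in> \<Omega>"
  shows "\<exists>l. ((\<lambda>t. G t x) \<longlongrightarrow> l) at_top"
proof -
  obtain \<rho> where \<rho>: "0 < \<rho>" "cball x (4 * \<rho>) \<subseteq> \<Omega>" using interior_radius[OF x] .
  have "\<exists>l. ((\<lambda>t. v \<bullet> G t x) \<longlongrightarrow> l) at_top" for v
  proof (rule taylor_limit_exists[OF \<rho>(1), of "grad_lip \<rho>" "\<lambda>t h. h \<bullet> G t x" u x v])
    show "linear (\<lambda>h. h \<bullet> G t x)" for t by (rule linearI) (auto simp: inner_add_left)
    show "\<exists>l. ((\<lambda>t. u t (x + h)) \<longlongrightarrow> l) at_top" if "norm h \<le> \<rho>" for h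
      by (rule lim) (use that \<rho> in \<open>auto simp: subset_iff dist_norm\<close>)
  qed (use taylor_u[OF \<rho>] grad_lip_pos[OF \<rho>(1)] in auto)
  then obtain l where l: "\<And>v. ((\<lambda>t. v \<bullet> G t x) \<longlongrightarrow> l v) at_top" by metis
  have "((\<lambda>t. \<Sum>b\<in>Basis. (b \<bullet> G t x) *\<^sub>R b) \<longlongrightarrow> (\<Sum>b\<in>Basis. l b *\<^sub>R b)) at_top"
    by (intro tendsto_sum tendsto_scaleR l tendsto_const)
  then show ?thesis by (auto simp: inner_commute[of _ "G _ x"] euclidean_representation)
qed

lemma hess_limit:
  assumes lim: "\<And>x. x \<in> \<Omega> \<Longrightarrow> \<exists>l. ((\<lambda>t. G t x) \<longlongrightarrow> l) at_top" and x: "x \<in> \<Omega>"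
  shows "\<exists>l. ((\<lambda>t. H t x) \<longlongrightarrow> l) at_top"
proof -
  obtain \<rho> where \<rho>: "0 < \<rho>" "cball x (4 * \<rho>) \<subseteq> \<Omega>" using interior_radius[OF x] .
  have "\<exists>l. ((\<lambda>t. H t x v) \<longlongrightarrow> l) at_top" for v
  proof (rule taylor_limit_exists[OF \<rho>(1), of "hess_lip \<rho>" "\<lambda>t. blinfun_apply (H t x)" G x v])
    show "linear (blinfun_apply (H t x))" for t
      by (rule bounded_linear.linear) (rule blinfun.bounded_linear_right)
    show "\<exists>l. ((\<lambda>t. G t (x + h)) \<longlongrightarrow> l) at_top" if "norm h \<le> \<rho>" for h
      by (rule lim) (use that \<rho> in \<open>auto simp: subset_iff dist_norm\<close>)
  qed (use taylor_G[OF \<rho>] hess_lip_pos[OF \<rho>(1)] in auto)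
  then obtain l where l: "\<And>v. ((\<lambda>t. H t x v) \<longlongrightarrow> l v) at_top" by metis
  have "((\<lambda>t. blinfun_of_matrix (\<lambda>i j. H t x j \<bullet> i)) \<longlongrightarrow> blinfun_of_matrix (\<lambda>i j. l j \<bullet> i)) at_top"
    by (intro tendsto_blinfun_of_matrix tendsto_inner l tendsto_const)
  then show ?thesis by (auto simp: blinfun_of_matrix_works)
qed

text \<open>Monotone convergence of \<open>u\<close> gives convergence of the gradient and of the Hessian by
\<open>taylor_limit_exists\<close>, and the limits are the derivatives of the limit because the Taylor
estimates pass to it. The time derivative then converges as well, and only to \<open>0\<close> since \<open>u\<close> is bounded.\<close>

lemma long_time_limit:
  assumes mono: "\<And>s t x. s \<le> t \<Longrightarrow> x \<in> closure \<Omega> \<Longrightarrow> u s x \<le> u t x"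
  obtains v Gv Hv where
    "\<And>x. x \<in> closure \<Omega> \<Longrightarrow> ((\<lambda>t. u t x) \<longlongrightarrow> v x) at_top"
    "\<And>x. x \<in> closure \<Omega> \<Longrightarrow> ((\<lambda>t. G t x) \<longlongrightarrow> Gv x) at_top"
    "has_grad_hess v Gv Hv \<Omega>" "continuous_on (closure \<Omega>) v" "continuous_on (closure \<Omega>) Gv" "continuous_on \<Omega> Hv"
    "\<And>C. compact C \<Longrightarrow> C \<subseteq> \<Omega> \<Longrightarrow> uniform_limit C u v at_top \<and> uniform_limit C G Gv at_top \<and> uniform_limit C H Hv at_top"
    "\<And>x. x \<in> \<Omega> \<Longrightarrow> trace_of (Hv x) + f (v x) = 0"
proof -
  have "\<exists>l. ((\<lambda>t. u t x) \<longlongrightarrow> l) at_top" if x: "x \<in> closure \<Omega>" for x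
  proof -
    have bdd: "bdd_above (range (\<lambda>t. u t x))" using u01[OF x] by (intro bdd_aboveI[of _ 1]) auto
    have "((\<lambda>t. u t x) \<longlongrightarrow> (SUP t. u t x)) at_top"
    proof (rule increasing_tendsto)
      show "\<forall>\<^sub>F t in at_top. u t x \<le> (SUP t. u t x)"
        by (intro always_eventually allI cSUP_upper bdd) auto
      fix a assume "a < (SUP t. u t x)"
      then obtain s where "a < u s x" using less_cSUP_iff[OF _ bdd] by auto
      then show "\<forall>\<^sub>F t in at_top. a < u t x"
        unfolding eventually_at_top_linorder using mono[OF _ x] by (meson less_le_trans)
    qed
    then show ?thesis by blast
  qed
  then obtain v where v: "\<And>x. x \<in> closure \<Omega> \<Longrightarrow> ((\<lambda>t. u t x) \<longlongrightarrow> v x) at_top" by metis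
  have ul: "\<exists>l. ((\<lambda>t. u t x) \<longlongrightarrow> l) at_top" if "x \<in> \<Omega>" for x using v dom_closure that by blast
  have Gi: "\<exists>l. ((\<lambda>t. G t x) \<longlongrightarrow> l) at_top" if "x \<in> \<Omega>" for x
    by (rule grad_limit_interior[OF ul that])
  have "\<exists>l. ((\<lambda>t. G t x) \<longlongrightarrow> l) at_top" if "x \<in> closure \<Omega>" for x
    by (rule equicont_limit_at_closure[OF equicont_G that Gi])
  then obtain Gv where Gv: "\<And>x. x \<in> closure \<Omega> \<Longrightarrow> ((\<lambda>t. G t x) \<longlongrightarrow> Gv x) at_top" by metis
  obtain Hv where Hv: "\<And>x. x \<in> \<Omega> \<Longrightarrow> ((\<lambda>t. H t x) \<longlongrightarrow> Hv x) at_top" using hess_limit[OF Gi] by metis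
  have equ: "equicont_on \<Omega> u" "equicont_on \<Omega> G"
    using equicont_u equicont_G dom_closure unfolding equicont_on_def by meson+
  have gh: "has_grad_hess v Gv Hv \<Omega>"
    unfolding has_grad_hess_def
  proof (intro ballI conjI)
    fix x assume x: "x \<in> \<Omega>"
    obtain \<rho> where \<rho>: "0 < \<rho>" "cball x (4 * \<rho>) \<subseteq> \<Omega>" using interior_radius[OF x] .
    have inn: "x + h \<in> \<Omega>" if "norm h \<le> \<rho>" for h using that \<rho> by (auto simp: subset_iff dist_norm)
    show "GDERIV v x :> Gv x"
      unfolding gderiv_def
    proof (rule taylor_imp_derivative[OF _ \<rho>(1), where C = "grad_lip \<rho>"])
      show "bounded_linear (\<lambda>h. h \<bullet> Gv x)" by (rule bounded_linear_inner_left)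
      fix h :: 'a assume h: "norm h \<le> \<rho>"
      have "((\<lambda>t. norm (u t (x + h) - u t x - h \<bullet> G t x)) \<longlongrightarrow> norm (v (x + h) - v x - h \<bullet> Gv x)) at_top"
        by (intro tendsto_norm tendsto_diff tendsto_inner v Gv tendsto_const) (use x inn[OF h] dom_closure in auto)
      then show "norm (v (x + h) - v x - h \<bullet> Gv x) \<le> grad_lip \<rho> * (norm h)\<^sup>2"
        by (rule tendsto_upperbound) (use taylor_u[OF \<rho> h] in auto)
    qed
    show "(Gv has_derivative blinfun_apply (Hv x)) (at x)"
    proof (rule taylor_imp_derivative[OF _ \<rho>(1), where C = "hess_lip \<rho>"])
      show "bounded_linear (blinfun_apply (Hv x))" by (rule blinfun.bounded_linear_right)
      fix h :: 'a assume h: "norm h \<le> \<rho>"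
      have "((\<lambda>t. norm (G t (x + h) - G t x - H t x h)) \<longlongrightarrow> norm (Gv (x + h) - Gv x - Hv x h)) at_top"
        by (intro tendsto_norm tendsto_diff blinfun.tendsto Hv Gv tendsto_const) (use x inn[OF h] dom_closure in auto)
      then show "norm (Gv (x + h) - Gv x - Hv x h) \<le> hess_lip \<rho> * (norm h)\<^sup>2"
        by (rule tendsto_upperbound) (use taylor_G[OF \<rho> h] in auto)
    qed
  qed
  have eqn: "trace_of (Hv x) + f (v x) = 0" if x: "x \<in> \<Omega>" for x
  proof -
    have xc: "x \<in> closure \<Omega>" using dom_closure[OF x] .
    have v01: "v x \<in> {0..1}"
    proof -
      have "0 \<le> v x" by (rule tendsto_lowerbound[OF v[OF xc]]) (use u01[OF xc] in auto)
      moreover have "v x \<le> 1" by (rule tendsto_upperbound[OF v[OF xc]]) (use u01[OF xc] in auto)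
      ultimately show ?thesis by simp
    qed
    have "((\<lambda>t. L * \<bar>u t x - v x\<bar>) \<longlongrightarrow> L * \<bar>v x - v x\<bar>) at_top" by (intro tendsto_intros v xc)
    then have "((\<lambda>t. f (u t x) - f (v x)) \<longlongrightarrow> 0) at_top"
      by (intro Lim_null_comparison[of "\<lambda>t. f (u t x) - f (v x)" "\<lambda>t. L * \<bar>u t x - v x\<bar>"])
         (use f_lip[OF u01[OF xc] v01] in auto)
    then have fl: "((\<lambda>t. f (u t x)) \<longlongrightarrow> f (v x)) at_top" by (rule Lim_null[THEN iffD2])
    have tr: "((\<lambda>t. trace_of (H t x)) \<longlongrightarrow> trace_of (Hv x)) at_top"
      unfolding trace_of_def by (intro tendsto_sum tendsto_inner blinfun.tendsto Hv x tendsto_const)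
    define \<kappa> where "\<kappa> = trace_of (Hv x) + f (v x)"
    have "u_t t x = trace_of (H t x) + f (u t x)" for t using pde[OF x, of t] by simp
    then have lim: "((\<lambda>t. u_t t x) \<longlongrightarrow> \<kappa>) at_top" unfolding \<kappa>_def using tendsto_add[OF tr fl] by simp
    have "\<kappa> = 0"
    proof (rule ccontr)
      assume k: "\<kappa> \<noteq> 0"
      then have "\<forall>\<^sub>F t in at_top. dist (u_t t x) \<kappa> < \<bar>\<kappa>\<bar> / 2" by (intro tendstoD[OF lim]) simp
      then obtain T where T: "\<And>t. T \<le> t \<Longrightarrow> dist (u_t t x) \<kappa> < \<bar>\<kappa>\<bar> / 2"
        unfolding eventually_at_top_linorder by blast
      have p: "0 < 4 / \<bar>\<kappa>\<bar>" using k by simp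
      obtain s where s: "T < s" "u (T + 4 / \<bar>\<kappa>\<bar>) x - u T x = (T + 4 / \<bar>\<kappa>\<bar> - T) * u_t s x"
        using MVT2[of T "T + 4 / \<bar>\<kappa>\<bar>" "\<lambda>t. u t x" "\<lambda>t. u_t t x"] p time_deriv[OF x] by auto
      have "\<bar>\<kappa>\<bar> / 2 \<le> \<bar>u_t s x\<bar>" using T[of s] s(1) unfolding dist_real_def by linarith
      then have "4 / \<bar>\<kappa>\<bar> * (\<bar>\<kappa>\<bar> / 2) \<le> 4 / \<bar>\<kappa>\<bar> * \<bar>u_t s x\<bar>" using p by (intro mult_left_mono) auto
      also have "\<dots> = \<bar>u (T + 4 / \<bar>\<kappa>\<bar>) x - u T x\<bar>" using s(2) by (simp add: abs_mult)
      also have "\<dots> \<le> 1" using u01[OF xc, of T] u01[OF xc, of "T + 4 / \<bar>\<kappa>\<bar>"] by auto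
      finally show False using k by simp
    qed
    then show ?thesis by (simp add: \<kappa>_def)
  qed
  show ?thesis
  proof (rule that[of v Gv Hv])
    show "continuous_on (closure \<Omega>) v" by (rule equicont_limit_continuous[OF equicont_u v])
    show "continuous_on (closure \<Omega>) Gv" by (rule equicont_limit_continuous[OF equicont_G Gv])
    show "continuous_on \<Omega> Hv" by (rule equicont_limit_continuous[OF equicont_H Hv])
    show "uniform_limit C u v at_top \<and> uniform_limit C G Gv at_top \<and> uniform_limit C H Hv at_top"
      if "compact C" "C \<subseteq> \<Omega>" for C
      using equicont_limit_uniform[OF that equ(1) v] equicont_limit_uniform[OF that equ(2) Gv]
        equicont_limit_uniform[OF that equicont_H Hv] dom_closure by blast
  qed (use v Gv gh eqn in auto)
qed

end

section \<open>The bistable nonlinearity\<close>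

lemma bistable_derivative_properties:
  assumes "bistable f \<theta>"
  obtains L where "0 < L"
    "\<And>a b. a \<in> {0..1} \<Longrightarrow> b \<in> {0..1} \<Longrightarrow> \<bar>f a - f b\<bar> \<le> L * \<bar>a - b\<bar>"
    "\<And>a b c d. a \<in> {0..1} \<Longrightarrow> b \<in> {0..1} \<Longrightarrow> c \<in> {0..1} \<Longrightarrow> d \<in> {0..1} \<Longrightarrow>
        \<bar>f a - f b - (f c - f d)\<bar> \<le> L * \<bar>a - b - (c - d)\<bar> + L * (\<bar>c - d\<bar> + \<bar>a - b\<bar>) * \<bar>b - d\<bar>"
proof -
  obtain f' K where f': "\<And>s. s \<in> {0..1} \<Longrightarrow> (f has_real_derivative f' s) (at s within {0..1})"
    and K: "K-lipschitz_on {0..1} f'"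
    using assms unfolding bistable_def by blast
  have K0: "0 \<le> K" using K lipschitz_on_nonneg by blast
  have Kl: "\<bar>f' a - f' b\<bar> \<le> K * \<bar>a - b\<bar>" if "a \<in> {0..1}" "b \<in> {0..1}" for a b
    using lipschitz_onD[OF K that] by (simp add: dist_real_def)
  define L where "L = \<bar>f' 0\<bar> + K + 1"
  have L: "0 < L" "K \<le> L" using K0 by (auto simp: L_def)
  have fb: "\<bar>f' s\<bar> \<le> L" if "s \<in> {0..1}" for s
  proof -
    have "\<bar>f' s - f' 0\<bar> \<le> K * \<bar>s - 0\<bar>" by (rule Kl) (use that in auto)
    also have "\<dots> \<le> K * 1" using that K0 by (intro mult_left_mono) auto
    finally show ?thesis by (simp add: L_def)
  qed
  have chain: "((\<lambda>s. f (p + s * (q - p))) has_real_derivative f' (p + s * (q - p)) * (q - p)) (at s within {0..1})"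
    if pq: "p \<in> {0..1}" "q \<in> {0..1}" and s: "s \<in> {0..1}" for p q s
  proof -
    have im: "p + r * (q - p) \<in> {0..1}" if "r \<in> {0..1}" for r
    proof -
      have "(1 - r) * p + r * q \<in> {0..1}"
        using convex_bound_le[of p 1 q "1 - r" r] that pq by auto
      then show ?thesis by (simp add: algebra_simps)
    qed
    have "((\<lambda>r. p + r * (q - p)) has_real_derivative (q - p)) (at s within {0..1})"
      by (auto intro!: derivative_eq_intros)
    moreover have "(f has_real_derivative f' (p + s * (q - p))) (at (p + s * (q - p)) within (\<lambda>r. p + r * (q - p)) ` {0..1})"
      by (rule DERIV_subset[OF f'[OF im[OF s]]]) (use im in auto)
    ultimately show ?thesis using DERIV_image_chain[of f _ "\<lambda>r. p + r * (q - p)" s "{0..1}"] by (simp add: o_def)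
  qed
  have im: "p + r * (q - p) \<in> {0..1}" if "r \<in> {0..1}" "p \<in> {0..1}" "q \<in> {0..1}" for p q r :: real
  proof -
    have "(1 - r) * p + r * q \<in> {0..1}"
      using convex_bound_le[of p 1 q "1 - r" r] that by auto
    then show ?thesis by (simp add: algebra_simps)
  qed
  have lip: "\<bar>f a - f b\<bar> \<le> L * \<bar>a - b\<bar>" if ab: "a \<in> {0..1}" "b \<in> {0..1}" for a b
  proof -
    obtain s where s: "s \<in> {0<..<1}" "f (b + 1 * (a - b)) - f (b + 0 * (a - b)) = f' (b + s * (a - b)) * (a - b) * (1 - 0)"
      using mvt_simple[of 0 1 "\<lambda>s. f (b + s * (a - b))" "\<lambda>s h. f' (b + s * (a - b)) * (a - b) * h"]
        chain[OF ab(2,1)] by (auto simp: has_field_derivative_def)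
    then have "\<bar>f a - f b\<bar> = \<bar>f' (b + s * (a - b))\<bar> * \<bar>a - b\<bar>" by (simp add: abs_mult)
    also have "\<dots> \<le> L * \<bar>a - b\<bar>" using s ab by (intro mult_right_mono fb im) auto
    finally show ?thesis .
  qed
  have second: "\<bar>f a - f b - (f c - f d)\<bar> \<le> L * \<bar>a - b - (c - d)\<bar> + L * (\<bar>c - d\<bar> + \<bar>a - b\<bar>) * \<bar>b - d\<bar>"
    if abcd: "a \<in> {0..1}" "b \<in> {0..1}" "c \<in> {0..1}" "d \<in> {0..1}" for a b c d
  proof -
    let ?h = "\<lambda>s. f (c + s * (a - c)) - f (d + s * (b - d))"
    let ?p = "\<lambda>s. c + s * (a - c)" and ?q = "\<lambda>s. d + s * (b - d)"
    have "(?h has_real_derivative f' (?p s) * (a - c) - f' (?q s) * (b - d)) (at s within {0..1})" if "s \<in> {0..1}" for s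
      by (rule DERIV_diff[OF chain[OF abcd(3,1) that] chain[OF abcd(4,2) that]])
    then obtain s where s: "s \<in> {0<..<1}" "?h 1 - ?h 0 = (f' (?p s) * (a - c) - f' (?q s) * (b - d)) * (1 - 0)"
      using mvt_simple[of 0 1 ?h "\<lambda>s h. (f' (?p s) * (a - c) - f' (?q s) * (b - d)) * h"]
      by (auto simp: has_field_derivative_def)
    have "f a - f b - (f c - f d) = f' (?p s) * (a - b - (c - d)) + (f' (?p s) - f' (?q s)) * (b - d)"
      using s(2) by (simp add: algebra_simps)
    also have "\<bar>\<dots>\<bar> \<le> \<bar>f' (?p s)\<bar> * \<bar>a - b - (c - d)\<bar> + \<bar>f' (?p s) - f' (?q s)\<bar> * \<bar>b - d\<bar>"
      by (metis abs_mult abs_triangle_ineq)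
    also have "\<dots> \<le> L * \<bar>a - b - (c - d)\<bar> + L * (\<bar>c - d\<bar> + \<bar>a - b\<bar>) * \<bar>b - d\<bar>"
    proof (intro add_mono mult_right_mono)
      show "\<bar>f' (?p s)\<bar> \<le> L" using s abcd by (intro fb im) auto
      have "\<bar>f' (?p s) - f' (?q s)\<bar> \<le> K * \<bar>?p s - ?q s\<bar>" using s abcd by (intro Kl im) auto
      also have "?p s - ?q s = (1 - s) * (c - d) + s * (a - b)" by (simp add: algebra_simps)
      also have "K * \<bar>\<dots>\<bar> \<le> L * (\<bar>c - d\<bar> + \<bar>a - b\<bar>)"
      proof (rule mult_mono)
        have "\<bar>(1 - s) * (c - d) + s * (a - b)\<bar> \<le> \<bar>(1 - s) * (c - d)\<bar> + \<bar>s * (a - b)\<bar>" by (rule abs_triangle_ineq)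
        also have "\<dots> \<le> 1 * \<bar>c - d\<bar> + 1 * \<bar>a - b\<bar>" unfolding abs_mult using s by (intro add_mono mult_right_mono) auto
        finally show "\<bar>(1 - s) * (c - d) + s * (a - b)\<bar> \<le> \<bar>c - d\<bar> + \<bar>a - b\<bar>" by simp
      qed (use L in auto)
      finally show "\<bar>f' (?p s) - f' (?q s)\<bar> \<le> L * (\<bar>c - d\<bar> + \<bar>a - b\<bar>)" .
    qed auto
    finally show ?thesis .
  qed
  show ?thesis using that[OF L(1) lip second] .
qed

text \<open>Near \<open>0\<close> and near \<open>1\<close> the derivative of \<open>f\<close> stays below \<open>- \<gamma>\<close>, so differences of solutions that stay there decay.\<close>

lemma bistable_stable_zones:
  assumes "bistable f \<theta>"
  obtains \<kappa> \<gamma> where "0 < \<kappa>" "\<kappa> < 1 / 2" "0 < \<gamma>"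
    "\<And>a b. 0 \<le> b \<Longrightarrow> b \<le> a \<Longrightarrow> a \<le> \<kappa> \<Longrightarrow> f a - f b \<le> - \<gamma> * (a - b)"
    "\<And>a b. 1 - \<kappa> \<le> b \<Longrightarrow> b \<le> a \<Longrightarrow> a \<le> 1 \<Longrightarrow> f a - f b \<le> - \<gamma> * (a - b)"
proof -
  obtain f' K where f': "\<And>s. s \<in> {0..1} \<Longrightarrow> (f has_real_derivative f' s) (at s within {0..1})"
    and K: "K-lipschitz_on {0..1} f'" and neg: "f' 0 < 0" "f' 1 < 0"
    using assms unfolding bistable_def by blast
  have K0: "0 \<le> K" using K lipschitz_on_nonneg by blast
  have Kl: "\<bar>f' a - f' b\<bar> \<le> K * \<bar>a - b\<bar>" if "a \<in> {0..1}" "b \<in> {0..1}" for a b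
    using lipschitz_onD[OF K that] by (simp add: dist_real_def)
  define \<gamma> where "\<gamma> = min (- f' 0) (- f' 1) / 2"
  define \<kappa> where "\<kappa> = min (1 / 4) (\<gamma> / (K + 1))"
  have \<gamma>: "0 < \<gamma>" "f' 0 \<le> - 2 * \<gamma>" "f' 1 \<le> - 2 * \<gamma>" using neg by (auto simp: \<gamma>_def min_def)
  have \<kappa>: "0 < \<kappa>" "\<kappa> < 1 / 2" using \<gamma> K0 by (auto simp: \<kappa>_def)
  have K\<kappa>: "K * \<kappa> \<le> \<gamma>"
  proof -
    have "K * \<kappa> \<le> (K + 1) * (\<gamma> / (K + 1))" using K0 \<kappa> by (intro mult_mono) (auto simp: \<kappa>_def)
    then show ?thesis using K0 by simp
  qed
  have d0: "f' s \<le> - \<gamma>" if "0 \<le> s" "s \<le> \<kappa>" for s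
  proof -
    have "\<bar>f' s - f' 0\<bar> \<le> K * \<bar>s - 0\<bar>" by (rule Kl) (use that \<kappa> in auto)
    also have "\<dots> \<le> K * \<kappa>" using that K0 by (intro mult_left_mono) auto
    finally show ?thesis using K\<kappa> \<gamma> by linarith
  qed
  have d1: "f' s \<le> - \<gamma>" if "1 - \<kappa> \<le> s" "s \<le> 1" for s
  proof -
    have "\<bar>f' s - f' 1\<bar> \<le> K * \<bar>s - 1\<bar>" by (rule Kl) (use that \<kappa> in auto)
    also have "\<dots> \<le> K * \<kappa>" using that K0 by (intro mult_left_mono) auto
    finally show ?thesis using K\<kappa> \<gamma> by linarith
  qed
  have mv: "f a - f b \<le> - \<gamma> * (a - b)" if ab: "b \<le> a" "0 \<le> b" "a \<le> 1" and d: "\<And>s. b \<le> s \<Longrightarrow> s \<le> a \<Longrightarrow> f' s \<le> - \<gamma>" for a b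
  proof (cases "a = b")
    case False
    then have lt: "b < a" using ab by simp
    have "(f has_derivative (\<lambda>h. f' s * h)) (at s within {b..a})" if "b \<le> s" "s \<le> a" for s
      using DERIV_subset[OF f', of s "{b..a}"] that ab by (auto simp: has_field_derivative_def)
    then obtain s where s: "s \<in> {b<..<a}" "f a - f b = f' s * (a - b)"
      using mvt_simple[OF lt, of f "\<lambda>s h. f' s * h"] by auto
    have "f' s * (a - b) \<le> - \<gamma> * (a - b)" using d[of s] s lt by (intro mult_right_mono) auto
    then show ?thesis using s by simp
  qed simp
  show ?thesis by (rule that[OF \<kappa> \<gamma>(1)]; rule mv) (use d0 d1 \<kappa> in auto)
qed

lemma bistable_continuous: "bistable f \<theta> \<Longrightarrow> continuous_on {0..1} f"
  unfolding bistable_def by (meson DERIV_continuous_on)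

section \<open>The travelling front\<close>

text \<open>Uniqueness for the front equation at a rest point \<open>a\<close>, by a Gronwall argument for the squared
distance to \<open>(a, 0)\<close> in the phase plane, in both directions.\<close>

lemma front_zero_uniqueness:
  assumes d1: "\<And>z. (\<phi> has_real_derivative \<phi>1 z) (at z)" and d2: "\<And>z. (\<phi>1 has_real_derivative \<phi>2 z) (at z)"
    and ode: "\<And>z. \<phi>2 z + c * \<phi>1 z + f (\<phi> z) = 0" and c: "0 < c" and L: "0 < L"
    and lip: "\<And>z. \<bar>f (\<phi> z)\<bar> \<le> L * \<bar>\<phi> z - a\<bar>" and z0: "\<phi> z0 = a" "\<phi>1 z0 = 0"
  shows "\<phi> z = a"
proof -
  define N where "N = (\<lambda>z. (\<phi> z - a)\<^sup>2 + (\<phi>1 z)\<^sup>2)"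
  define N' where "N' = (\<lambda>z. 2 * (\<phi> z - a) * \<phi>1 z + 2 * \<phi>1 z * \<phi>2 z)"
  define K where "K = 1 + 2 * c + L"
  have dN: "(N has_real_derivative N' z) (at z)" for z
    unfolding N_def N'_def by (auto intro!: derivative_eq_intros d1 d2)
  have bd: "\<bar>N' z\<bar> \<le> K * N z" for z
  proof -
    have xy: "2 * \<bar>x * y\<bar> \<le> x\<^sup>2 + y\<^sup>2" for x y :: real
      using sum_squares_bound[of "\<bar>x\<bar>" "\<bar>y\<bar>"] by (simp add: abs_mult)
    have p2: "\<phi>2 z = - c * \<phi>1 z - f (\<phi> z)" using ode[of z] by simp
    have "N' z = 2 * ((\<phi> z - a) * \<phi>1 z) - 2 * c * (\<phi>1 z)\<^sup>2 - 2 * (\<phi>1 z * f (\<phi> z))"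
      unfolding N'_def p2 by (simp add: algebra_simps power2_eq_square)
    also have "\<bar>\<dots>\<bar> \<le> 2 * \<bar>(\<phi> z - a) * \<phi>1 z\<bar> + 2 * c * (\<phi>1 z)\<^sup>2 + 2 * \<bar>\<phi>1 z * f (\<phi> z)\<bar>"
    proof -
      have "\<bar>2 * p - q - 2 * r\<bar> \<le> 2 * \<bar>p\<bar> + q + 2 * \<bar>r\<bar>" if "0 \<le> q" for p q r :: real using that by linarith
      then show ?thesis using c by simp
    qed
    also have "\<dots> \<le> N z + 2 * c * N z + L * N z"
    proof (intro add_mono)
      show "2 * \<bar>(\<phi> z - a) * \<phi>1 z\<bar> \<le> N z" unfolding N_def by (rule xy)
      show "2 * c * (\<phi>1 z)\<^sup>2 \<le> 2 * c * N z" using c by (intro mult_left_mono) (auto simp: N_def)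
      have "2 * \<bar>\<phi>1 z * f (\<phi> z)\<bar> \<le> 2 * (\<bar>\<phi>1 z\<bar> * (L * \<bar>\<phi> z - a\<bar>))"
        unfolding abs_mult by (intro mult_left_mono lip) auto
      also have "\<dots> = L * (2 * \<bar>(\<phi> z - a) * \<phi>1 z\<bar>)" by (simp add: abs_mult)
      also have "\<dots> \<le> L * N z" unfolding N_def using L by (intro mult_left_mono xy) auto
      finally show "2 * \<bar>\<phi>1 z * f (\<phi> z)\<bar> \<le> L * N z" .
    qed
    also have "\<dots> = K * N z" by (simp add: K_def algebra_simps)
    finally show ?thesis .
  qed
  have N0: "N z0 = 0" using z0 by (simp add: N_def)
  have Nn: "0 \<le> N z" for z by (simp add: N_def)
  have "N z \<le> 0"
  proof (cases "z0 \<le> z")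
    case True
    have "(\<lambda>z. N z * exp (- K * z)) z \<le> (\<lambda>z. N z * exp (- K * z)) z0"
    proof (rule DERIV_nonpos_imp_nonincreasing[OF True])
      fix x
      have "((\<lambda>z. N z * exp (- K * z)) has_real_derivative (N' x - K * N x) * exp (- K * x)) (at x)"
        by (auto intro!: derivative_eq_intros dN simp: algebra_simps)
      moreover have "(N' x - K * N x) * exp (- K * x) \<le> 0"
        using bd[of x] by (intro mult_nonpos_nonneg) (auto simp: abs_le_iff)
      ultimately show "\<exists>y. ((\<lambda>z. N z * exp (- K * z)) has_real_derivative y) (at x) \<and> y \<le> 0" by blast
    qed
    then show ?thesis using N0 by (simp add: mult_le_0_iff)
  next
    case False
    then have le: "z \<le> z0" by simp
    have "(\<lambda>z. N z * exp (K * z)) z \<le> (\<lambda>z. N z * exp (K * z)) z0"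
    proof (rule DERIV_nonneg_imp_nondecreasing[OF le])
      fix x
      have "((\<lambda>z. N z * exp (K * z)) has_real_derivative (N' x + K * N x) * exp (K * x)) (at x)"
        by (auto intro!: derivative_eq_intros dN simp: algebra_simps)
      moreover have "0 \<le> (N' x + K * N x) * exp (K * x)"
        using bd[of x] by (intro mult_nonneg_nonneg) (auto simp: abs_le_iff)
      ultimately show "\<exists>y. ((\<lambda>z. N z * exp (K * z)) has_real_derivative y) (at x) \<and> 0 \<le> y" by blast
    qed
    then show ?thesis using N0 by (simp add: mult_le_0_iff)
  qed
  then have "(\<phi> z - a)\<^sup>2 \<le> 0" unfolding N_def using zero_le_power2[of "\<phi>1 z"] by linarith
  then show ?thesis by simp
qed

text \<open>The energy \<open>\<phi>'\<^sup>2 / 2 + F(\<phi>)\<close>, with \<open>F\<close> the primitive of \<open>f\<close>, does not increase and is at least \<open>F(\<phi>)\<close>, which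
tends to \<open>F 0 = 0\<close>; so it is nonnegative. At a critical point this gives \<open>F(\<phi>) \<ge> 0\<close>, hence \<open>\<phi> > \<theta>\<close> and \<open>\<phi>'' = - f(\<phi>) < 0\<close>.
So every critical point is a strict local maximum; since \<open>\<phi> \<rightarrow> 1\<close> at \<open>- \<infinity>\<close>, there would
have to be a local minimum to its left, so there is none. The bound of \<open>\<phi>'\<close> comes from the energy too:
in every unit interval the mean value theorem gives a point where \<open>|\<phi>'| \<le> 1\<close>.\<close>

lemma front_decreasing:
  assumes b: "bistable f \<theta>" and tf: "travelling_front f \<theta> \<phi> c"
  obtains \<phi>1 \<phi>2 P where "\<And>z. (\<phi> has_real_derivative \<phi>1 z) (at z)" "\<And>z. (\<phi>1 has_real_derivative \<phi>2 z) (at z)"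
    "\<And>z. \<phi>2 z + c * \<phi>1 z + f (\<phi> z) = 0" "\<And>z. \<phi>1 z < 0" "\<And>z. \<bar>\<phi>1 z\<bar> \<le> P"
proof -
  have c: "0 < c" and rng: "\<And>z. 0 \<le> \<phi> z \<and> \<phi> z \<le> 1" and bot: "(\<phi> \<longlongrightarrow> 1) at_bot" and top: "(\<phi> \<longlongrightarrow> 0) at_top"
    and \<phi>0: "\<phi> 0 = \<theta>" using tf unfolding travelling_front_def by auto
  have th: "0 < \<theta>" "\<theta> < 1" and f0: "f 0 = 0" "f 1 = 0" and fneg: "\<And>s. 0 < s \<Longrightarrow> s < \<theta> \<Longrightarrow> f s < 0"
    and fpos: "\<And>s. \<theta> < s \<Longrightarrow> s < 1 \<Longrightarrow> 0 < f s" using b unfolding bistable_def by auto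
  obtain \<phi>1 \<phi>2 where d1: "\<And>z. (\<phi> has_real_derivative \<phi>1 z) (at z)" and d2: "\<And>z. (\<phi>1 has_real_derivative \<phi>2 z) (at z)"
    and ode: "\<And>z. \<phi>2 z + c * \<phi>1 z + f (\<phi> z) = 0" using tf unfolding travelling_front_def by blast
  obtain L where L: "0 < L" "\<And>a b. a \<in> {0..1} \<Longrightarrow> b \<in> {0..1} \<Longrightarrow> \<bar>f a - f b\<bar> \<le> L * \<bar>a - b\<bar>"
    using bistable_derivative_properties[OF b] by metis
  have contf: "continuous_on {0..1} f" by (rule bistable_continuous[OF b])
  have cont\<phi>: "continuous_on S \<phi>" for S
    by (intro continuous_at_imp_continuous_on ballI DERIV_isCont[OF d1])
  have cont\<phi>1: "continuous_on S \<phi>1" for S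
    by (intro continuous_at_imp_continuous_on ballI DERIV_isCont[OF d2])
  define F where "F = (\<lambda>s. integral {0..s} f)"
  have dF: "(F has_real_derivative f s) (at s within {0..1})" if "s \<in> {0..1}" for s
    unfolding F_def by (rule integral_has_real_derivative[OF contf that])
  have F0: "F 0 = 0" by (simp add: F_def)
  have contF: "continuous_on {0..1} F" using dF by (meson DERIV_continuous_on)
  have dFp: "((\<lambda>z. F (\<phi> z)) has_real_derivative f (\<phi> z) * \<phi>1 z) (at z)" for z
  proof -
    have "(F has_real_derivative f (\<phi> z)) (at (\<phi> z) within range \<phi>)"
      by (rule DERIV_subset[OF dF]) (use rng in auto)
    from DERIV_image_chain[OF this d1[of z]] show ?thesis by (simp add: o_def)
  qed
  define E where "E = (\<lambda>z. (\<phi>1 z)\<^sup>2 / 2 + F (\<phi> z))"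
  have dE: "(E has_real_derivative - c * (\<phi>1 z)\<^sup>2) (at z)" for z
  proof -
    have "(E has_real_derivative (\<phi>1 z * \<phi>2 z + f (\<phi> z) * \<phi>1 z)) (at z)"
      unfolding E_def by (auto intro!: derivative_eq_intros d2 dFp)
    moreover have p2: "\<phi>2 z = - c * \<phi>1 z - f (\<phi> z)" using ode[of z] by simp
    have "\<phi>1 z * \<phi>2 z + f (\<phi> z) * \<phi>1 z = - c * (\<phi>1 z)\<^sup>2"
      unfolding p2 by (simp add: algebra_simps power2_eq_square)
    ultimately show ?thesis by simp
  qed
  have Edec: "E y \<le> E x" if "x \<le> y" for x y
  proof (rule DERIV_nonpos_imp_nonincreasing[OF that])
    fix z show "\<exists>y. (E has_real_derivative y) (at z) \<and> y \<le> 0" using dE[of z] c by (intro exI[of _ "- c * (\<phi>1 z)\<^sup>2"]) simp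
  qed
  have Fl: "((\<lambda>z. F (\<phi> z)) \<longlongrightarrow> F 0) at_top"
  proof (rule continuous_on_tendsto_compose[OF contF top])
    show "\<forall>\<^sub>F z in at_top. \<phi> z \<in> {0..1}" using rng by (intro always_eventually) auto
  qed auto
  have Epos: "0 \<le> E z" for z
  proof -
    have "F 0 \<le> E z"
    proof (rule tendsto_upperbound[OF Fl])
      show "\<forall>\<^sub>F x in at_top. F (\<phi> x) \<le> E z"
        unfolding eventually_at_top_linorder
      proof (intro exI[of _ z] allI impI)
        fix x assume "z \<le> x"
        have "F (\<phi> x) \<le> E x" by (simp add: E_def)
        then show "F (\<phi> x) \<le> E z" using Edec[OF \<open>z \<le> x\<close>] by simp
      qed
    qed simp
    then show ?thesis by (simp add: F0)
  qed
  have Fneg: "F s < 0" if s: "0 < s" "s \<le> \<theta>" for s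
  proof -
    have "F s < F 0"
    proof (rule DERIV_neg_imp_decreasing_open[OF s(1)])
      fix x assume x: "0 < x" "x < s"
      have "(F has_real_derivative f x) (at x)"
        using dF[of x] x s th at_within_interior[of x "{0..1}"] by simp
      then show "\<exists>y. (F has_real_derivative y) (at x) \<and> y < 0" using fneg[of x] x s by auto
    next
      show "continuous_on {0..s} F" by (rule continuous_on_subset[OF contF]) (use s th in auto)
    qed
    then show ?thesis by (simp add: F0)
  qed
  have not_eq: "\<phi> z \<noteq> a" if a: "a \<in> {0, 1}" for z a
  proof
    assume za: "\<phi> z = a"
    have "\<phi>1 z = 0"
    proof (cases "a = 0")
      case True
      show ?thesis by (rule DERIV_local_min[OF d1[of z], of 1]) (use za True rng in auto)
    next
      case False
      then show ?thesis by (intro DERIV_local_max[OF d1[of z], of 1]) (use za a rng in auto)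
    qed
    have "\<phi> 0 = a"
    proof (rule front_zero_uniqueness[OF d1 d2 ode c L(1) _ za \<open>\<phi>1 z = 0\<close>])
      fix z show "\<bar>f (\<phi> z)\<bar> \<le> L * \<bar>\<phi> z - a\<bar>"
        using L(2)[of "\<phi> z" a] rng[of z] a f0 by auto
    qed
    then show False using \<phi>0 th a by auto
  qed
  have open01: "0 < \<phi> z" "\<phi> z < 1" for z using not_eq[of 0 z] not_eq[of 1 z] rng[of z] by auto
  have crit: "\<phi>2 z < 0" if z: "\<phi>1 z = 0" for z
  proof -
    have "0 \<le> F (\<phi> z)" using Epos[of z] z by (simp add: E_def)
    then have "\<theta> < \<phi> z" using Fneg[of "\<phi> z"] open01[of z] by force
    then have "0 < f (\<phi> z)" using fpos open01 by blast
    then show ?thesis using ode[of z] z by simp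
  qed
  have left_lower: "\<exists>d>0. \<forall>y. z - d < y \<and> y < z \<longrightarrow> \<phi> y < \<phi> z" if z: "\<phi>1 z = 0" for z
  proof -
    obtain d where d: "d > 0" "\<And>h. 0 < h \<Longrightarrow> h < d \<Longrightarrow> \<phi>1 z < \<phi>1 (z - h)"
      using DERIV_neg_dec_left[OF d2 crit[OF z]] by blast
    have "\<phi> y < \<phi> z" if y: "z - d < y" "y < z" for y
    proof (rule DERIV_pos_imp_increasing_open[OF y(2)])
      fix x assume "y < x" "x < z"
      then show "\<exists>r. (\<phi> has_real_derivative r) (at x) \<and> 0 < r" using d1[of x] d(2)[of "z - x"] y z by auto
    qed (rule cont\<phi>)
    then show ?thesis using d(1) by blast
  qed
  have nz: "\<phi>1 z \<noteq> 0" for z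
  proof
    assume z: "\<phi>1 z = 0"
    obtain d where d: "d > 0" "\<And>y. z - d < y \<Longrightarrow> y < z \<Longrightarrow> \<phi> y < \<phi> z" using left_lower[OF z] by blast
    define z1 where "z1 = z - d / 2"
    have z1: "z1 < z" "\<phi> z1 < \<phi> z" using d by (auto simp: z1_def)
    have "\<forall>\<^sub>F y in at_bot. \<phi> z1 < \<phi> y" using order_tendstoD(1)[OF bot, of "\<phi> z1"] open01 by blast
    then obtain B where B: "\<And>y. y \<le> B \<Longrightarrow> \<phi> z1 < \<phi> y" unfolding eventually_at_bot_linorder by blast
    define z2 where "z2 = min B (z1 - 1)"
    have z2: "z2 < z1" "\<phi> z1 < \<phi> z2" using B[of z2] by (auto simp: z2_def)
    obtain m where m: "m \<in> {z2..z}" "\<And>y. y \<in> {z2..z} \<Longrightarrow> \<phi> m \<le> \<phi> y"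
      using continuous_attains_inf[of "{z2..z}" \<phi>] cont\<phi> z1 z2 by auto
    have "\<phi> m \<le> \<phi> z1" using m(2)[of z1] z1 z2 by simp
    then have mm: "z2 < m" "m < z" using m(1) z1 z2 by (auto simp: less_le)
    have "\<phi>1 m = 0"
    proof (rule DERIV_local_min[OF d1[of m], of "min (m - z2) (z - m)"])
      show "\<forall>y. \<bar>m - y\<bar> < min (m - z2) (z - m) \<longrightarrow> \<phi> m \<le> \<phi> y"
        by (intro allI impI m(2)) (auto simp: abs_if split: if_splits)
    qed (use mm in auto)
    then obtain d' where d': "d' > 0" "\<And>y. m - d' < y \<Longrightarrow> y < m \<Longrightarrow> \<phi> y < \<phi> m" using left_lower by blast
    define y where "y = m - min d' (m - z2) / 2"
    have "m - d' < y" "y < m" "z2 \<le> y" using d' mm by (auto simp: y_def min_def field_simps)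
    then show False using d'(2)[of y] m(2)[of y] mm by auto
  qed
  have "\<exists>\<xi>. \<phi>1 \<xi> < 0"
  proof -
    have "\<forall>\<^sub>F y in at_bot. \<phi> 0 < \<phi> y" using order_tendstoD(1)[OF bot, of "\<phi> 0"] open01 by blast
    then obtain B where B: "\<And>y. y \<le> B \<Longrightarrow> \<phi> 0 < \<phi> y" unfolding eventually_at_bot_linorder by blast
    define y where "y = min B (-1)"
    have y: "y < 0" "\<phi> 0 < \<phi> y" using B[of y] by (auto simp: y_def)
    obtain \<xi> where "\<phi> 0 - \<phi> y = (0 - y) * \<phi>1 \<xi>" using MVT2[OF y(1), of \<phi> \<phi>1] d1 by blast
    then have "(- y) * \<phi>1 \<xi> < 0" using y by simp
    then have "0 < y * \<phi>1 \<xi>" by simp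
    then have "\<phi>1 \<xi> < 0" using y by (auto simp: zero_less_mult_iff)
    then show ?thesis by blast
  qed
  then obtain \<xi> where \<xi>: "\<phi>1 \<xi> < 0" by blast
  have neg: "\<phi>1 z < 0" for z
  proof (rule ccontr)
    assume "\<not> \<phi>1 z < 0"
    then have z: "0 < \<phi>1 z" using nz[of z] by simp
    have "\<exists>x. \<phi>1 x = 0"
    proof (cases "\<xi> \<le> z")
      case True
      then show ?thesis using IVT'[of \<phi>1 \<xi> 0 z] \<xi> z cont\<phi>1 by auto
    next
      case False
      then show ?thesis using IVT2'[of \<phi>1 \<xi> 0 z] \<xi> z cont\<phi>1 by auto
    qed
    then show False using nz by blast
  qed
  obtain B where B: "\<And>s. s \<in> {0..1} \<Longrightarrow> \<bar>F s\<bar> \<le> B"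
  proof -
    have "bounded (F ` {0..1})"
      by (rule compact_imp_bounded[OF compact_continuous_image[OF contF compact_Icc]])
    then obtain a where "\<forall>x\<in>F ` {0..1}. norm x \<le> a" unfolding bounded_iff by blast
    then show ?thesis by (intro that[of a]) simp
  qed
  have bd: "\<bar>\<phi>1 z\<bar> \<le> 2 + 4 * B" for z
  proof -
    obtain y where y: "z - 1 < y" "y < z" "\<phi> z - \<phi> (z - 1) = (z - (z - 1)) * \<phi>1 y"
      using MVT2[of "z - 1" z \<phi> \<phi>1] d1 by auto
    have "\<bar>\<phi>1 y\<bar> \<le> 1" using y(3) rng[of z] rng[of "z - 1"] by auto
    then have 1: "(\<phi>1 y)\<^sup>2 \<le> 1" by (simp add: abs_square_le_1)
    have "E z \<le> E y" by (rule Edec) (use y in simp)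
    then have "(\<phi>1 z)\<^sup>2 / 2 \<le> (\<phi>1 y)\<^sup>2 / 2 + F (\<phi> y) - F (\<phi> z)" by (simp add: E_def)
    moreover have "\<bar>F (\<phi> y)\<bar> \<le> B" "\<bar>F (\<phi> z)\<bar> \<le> B" using B rng by auto
    ultimately have sq: "(\<phi>1 z)\<^sup>2 \<le> 1 + 4 * B" using 1 by linarith
    have "0 \<le> (\<bar>\<phi>1 z\<bar> - 1)\<^sup>2" by simp
    also have "\<dots> = (\<phi>1 z)\<^sup>2 - 2 * \<bar>\<phi>1 z\<bar> + 1" by (simp add: power2_eq_square algebra_simps)
    finally show ?thesis using sq B[of 0] by (simp add: F0)
  qed
  show ?thesis by (rule that[OF d1 d2 ode neg bd])
qed

lemma front_strict_antimono:
  assumes d1: "\<And>z. (\<phi> has_real_derivative \<phi>1 z) (at z)" and neg: "\<And>z. \<phi>1 z < 0" and "x < y"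
  shows "\<phi> y < \<phi> (x::real)"
  by (rule DERIV_neg_imp_decreasing[OF assms(3)]) (use d1 neg in blast)

section \<open>Monotonicity in time\<close>

text \<open>In the transition zone of the front, \<open>u(t + h) > u(t)\<close> for very negative \<open>t\<close>, as the shifted front is larger
there by a fixed amount. Where \<open>w = u(t) - u(t + h)\<close> is positive one is therefore in a zone in which \<open>f\<close> decreases with slope
\<open>- \<gamma>\<close>, and \<open>w \<le> exp(- \<gamma> (t - T))\<close> for all earlier \<open>T\<close>.\<close>

lemma (in neumann_flow) increasing_in_time:
  assumes b: "bistable f \<theta>" and tf: "travelling_front f \<theta> \<phi> c"
    and lim: "uniform_limit (closure \<Omega>) (\<lambda>t x. u t x - \<phi> (\<xi> x - c * t)) (\<lambda>_. 0) at_bot"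
    and st: "s \<le> t" and x: "x \<in> closure \<Omega>"
  shows "u s x \<le> u t x"
proof (cases "s = t")
  case False
  define h where "h = t - s"
  have h: "0 < h" using False st by (simp add: h_def)
  have c: "0 < c" and bot: "(\<phi> \<longlongrightarrow> 1) at_bot" and top: "(\<phi> \<longlongrightarrow> 0) at_top"
    using tf unfolding travelling_front_def by auto
  have ch: "0 < c * h" using c h by simp
  obtain \<phi>1 where d1: "\<And>z. (\<phi> has_real_derivative \<phi>1 z) (at z)" and neg: "\<And>z. \<phi>1 z < 0"
    using front_decreasing[OF b tf] by metis
  have dec: "\<phi> y < \<phi> z" if "z < y" for y z by (rule front_strict_antimono[OF d1 neg that])
  have dec': "\<phi> y \<le> \<phi> z" if "z \<le> y" for y z using dec[of z y] that by (cases "z = y") auto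
  obtain \<kappa> \<gamma> where \<kappa>: "0 < \<kappa>" "\<kappa> < 1 / 2" and \<gamma>: "0 < \<gamma>"
    and z0: "\<And>a b. 0 \<le> b \<Longrightarrow> b \<le> a \<Longrightarrow> a \<le> \<kappa> \<Longrightarrow> f a - f b \<le> - \<gamma> * (a - b)"
    and z1: "\<And>a b. 1 - \<kappa> \<le> b \<Longrightarrow> b \<le> a \<Longrightarrow> a \<le> 1 \<Longrightarrow> f a - f b \<le> - \<gamma> * (a - b)"
    using bistable_stable_zones[OF b] by blast
  have "\<forall>\<^sub>F y in at_top. \<phi> y < \<kappa> / 2" using order_tendstoD(2)[OF top, of "\<kappa> / 2"] \<kappa> by simp
  then obtain Y0 where Y0: "\<And>y. Y0 \<le> y \<Longrightarrow> \<phi> y < \<kappa> / 2" unfolding eventually_at_top_linorder by blast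
  have "\<forall>\<^sub>F y in at_bot. 1 - \<kappa> / 2 < \<phi> y" using order_tendstoD(1)[OF bot, of "1 - \<kappa> / 2"] \<kappa> by simp
  then obtain Y1 where Y1: "\<And>y. y \<le> Y1 \<Longrightarrow> 1 - \<kappa> / 2 < \<phi> y" unfolding eventually_at_bot_linorder by blast
  define Y where "Y = max (Y0 + c * h) (Y1 + 1)"
  have cont: "continuous_on S \<phi>" for S
    by (intro continuous_at_imp_continuous_on ballI DERIV_isCont[OF d1])
  have "continuous_on {Y1..Y} (\<lambda>z. \<phi> (z - c * h) - \<phi> z)"
    by (intro continuous_intros continuous_on_compose2[OF cont]) auto
  moreover have "{Y1..Y} \<noteq> {}" by (simp add: Y_def)
  ultimately obtain m where m: "\<And>z. z \<in> {Y1..Y} \<Longrightarrow> \<phi> (m - c * h) - \<phi> m \<le> \<phi> (z - c * h) - \<phi> z"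
    using continuous_attains_inf[OF compact_Icc] by blast
  define k where "k = \<phi> (m - c * h) - \<phi> m"
  have k: "0 < k" using dec[of "m - c * h" m] ch by (simp add: k_def)
  define \<epsilon> where "\<epsilon> = min (\<kappa> / 2) (k / 4)"
  have \<epsilon>: "0 < \<epsilon>" "\<epsilon> \<le> \<kappa> / 2" "\<epsilon> \<le> k / 4" using \<kappa> k by (auto simp: \<epsilon>_def)
  have "\<forall>\<^sub>F t in at_bot. \<forall>x\<in>closure \<Omega>. dist (u t x - \<phi> (\<xi> x - c * t)) 0 < \<epsilon>"
    using lim \<epsilon>(1) unfolding uniform_limit_iff by blast
  then obtain T1 where T1: "\<And>t x. t \<le> T1 \<Longrightarrow> x \<in> closure \<Omega> \<Longrightarrow> \<bar>u t x - \<phi> (\<xi> x - c * t)\<bar> < \<epsilon>"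
    unfolding eventually_at_bot_linorder by (auto simp: dist_real_def)
  define T0 where "T0 = min T1 (T1 - h)"
  define w where "w = (\<lambda>t x. u (t + 0) (x + 0) - u (t + h) (x + 0))"
  have heatw: "heat_at w t x (f (u t x) - f (u (t + h) x))" if "x \<in> \<Omega>" for t x
    unfolding w_def by (intro heat_at_diff heat_at_translate) (use heat_u that in auto)
  have contw: "continuous_on (I \<times> closure \<Omega>) (\<lambda>(t, x). w t x)" for I
  proof -
    have "continuous_on (I \<times> closure \<Omega>) (\<lambda>q. u (fst q + h) (snd q))"
      by (rule continuous_on_compose2[OF cont_u, of _ "\<lambda>q. (fst q + h, snd q)", simplified]) (auto intro!: continuous_intros)
    then show ?thesis unfolding w_def case_prod_beta add_0_right
      by (intro continuous_on_diff cont_u_sub[unfolded case_prod_beta]) auto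
  qed
  have ndw: "((\<lambda>s. w t (q + s *\<^sub>R n q)) has_real_derivative 0) (at 0 within {0..})" if "q \<in> frontier \<Omega>" for t q
    unfolding w_def add_0_right
    using DERIV_diff[OF normal_derivative_zero[OF that] normal_derivative_zero[OF that], of t "t + h"] by simp
  have w1: "w t x \<le> 1" if "x \<in> closure \<Omega>" for t x
    using u01[OF that, of t] u01[OF that, of "t + h"] by (auto simp: w_def)
  have early: "w t x \<le> 0" if t: "t \<le> T0" and x: "x \<in> closure \<Omega>" for t x
  proof -
    have "w t x \<le> 1 * exp (- \<gamma> * (t - T))" if T: "T \<le> t" for T
    proof (rule neumann_comparison[OF contw w1 ndw _ w1])
      fix \<tau> y assume \<tau>: "\<tau> \<in> {T<..t}" and y: "y \<in> \<Omega>" and pos: "0 < w \<tau> y"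
      let ?z = "\<xi> y - c * \<tau>" and ?a = "u \<tau> y" and ?b = "u (\<tau> + h) y"
      have yc: "y \<in> closure \<Omega>" by (rule dom_closure[OF y])
      have a: "\<bar>?a - \<phi> ?z\<bar> < \<epsilon>" by (rule T1[OF _ yc]) (use \<tau> t in \<open>auto simp: T0_def\<close>)
      have "\<bar>?b - \<phi> (\<xi> y - c * (\<tau> + h))\<bar> < \<epsilon>" by (rule T1[OF _ yc]) (use \<tau> t in \<open>auto simp: T0_def\<close>)
      then have b: "\<bar>?b - \<phi> (?z - c * h)\<bar> < \<epsilon>" by (simp add: algebra_simps)
      have ab: "?b < ?a" using pos by (simp add: w_def)
      have a01: "?a \<in> {0..1}" "?b \<in> {0..1}" using u01[OF yc] by auto
      have "f ?a - f ?b \<le> - \<gamma> * (?a - ?b)"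
      proof (cases "?z \<in> {Y1..Y}")
        case True
        have "k \<le> \<phi> (?z - c * h) - \<phi> ?z" using m[OF True] by (simp add: k_def)
        then have False using a b ab \<epsilon> k by linarith
        then show ?thesis ..
      next
        case False
        show ?thesis
        proof (cases "?z < Y1")
          case True
          have "1 - \<kappa> / 2 < \<phi> ?z" "1 - \<kappa> / 2 < \<phi> (?z - c * h)" using True ch by (auto intro!: Y1)
          then have "1 - \<kappa> \<le> ?b" using b \<epsilon> by linarith
          then show ?thesis using z1[of ?b ?a] ab a01 by auto
        next
          case False
          with \<open>?z \<notin> {Y1..Y}\<close> have "Y < ?z" by auto
          then have "\<phi> ?z < \<kappa> / 2" using ch by (intro Y0) (auto simp: Y_def)
          then have "?a \<le> \<kappa>" using a \<epsilon> by linarith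
          then show ?thesis using z0[of ?b ?a] ab a01 by auto
        qed
      qed
      then show "\<exists>s. heat_at w \<tau> y s \<and> s \<le> - \<gamma> * w \<tau> y" using heatw[OF y, of \<tau>] by (auto simp: w_def)
    qed (use T x in auto)
    then have ub: "\<forall>\<^sub>F T in at_bot. w t x \<le> exp (- \<gamma> * (t - T))"
      unfolding eventually_at_bot_linorder by (auto intro!: exI[of _ t])
    have "filterlim (\<lambda>T. \<gamma> * (T - t)) at_bot at_bot"
    proof (rule filterlim_at_bot[THEN iffD2], rule allI)
      fix Z show "\<forall>\<^sub>F T in at_bot. \<gamma> * (T - t) \<le> Z"
        unfolding eventually_at_bot_linorder
      proof (intro exI[of _ "t + Z / \<gamma>"] allI impI)
        fix T assume "T \<le> t + Z / \<gamma>"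
        then have "\<gamma> * (T - t) \<le> \<gamma> * (Z / \<gamma>)" using \<gamma> by (intro mult_left_mono) auto
        then show "\<gamma> * (T - t) \<le> Z" using \<gamma> by simp
      qed
    qed
    from filterlim_compose[OF exp_at_bot this] have "((\<lambda>T. exp (- \<gamma> * (t - T))) \<longlongrightarrow> 0) at_bot"
      by (simp add: algebra_simps)
    then show ?thesis by (rule tendsto_lowerbound[OF _ ub]) simp
  qed
  have "w s x \<le> 0"
  proof (cases "s \<le> T0")
    case True
    then show ?thesis by (rule early[OF _ x])
  next
    case False
    have "w s x \<le> 0 * exp (L * (s - T0))"
    proof (rule neumann_comparison[OF contw w1 ndw])
      fix \<tau> y assume y: "y \<in> \<Omega>" and pos: "0 < w \<tau> y"
      have "\<bar>f (u \<tau> y) - f (u (\<tau> + h) y)\<bar> \<le> L * \<bar>u \<tau> y - u (\<tau> + h) y\<bar>"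
        by (rule f_lip) (use u01 dom_closure[OF y] in auto)
      also have "\<dots> = L * w \<tau> y" using pos by (simp add: w_def)
      finally show "\<exists>s. heat_at w \<tau> y s \<and> s \<le> L * w \<tau> y" using heatw[OF y, of \<tau>] by (auto simp: abs_le_iff)
    qed (use False x early in auto)
    then show ?thesis by simp
  qed
  then show ?thesis by (simp add: w_def h_def)
qed simp


section \<open>A slowly moving compactly supported subsolution\<close>

text \<open>Here \<open>\<phi> - \<eta>\<close> is the profile, \<open>a\<close> stands for the squared length of the gradient of the bent distance, and \<open>\<delta>\<close>
collects the costs of curvature and motion. Written as
\<open>(a c - \<delta>) (- \<phi>') + (1 - a) f(\<phi>) + (f(\<phi> - \<eta>) - f(\<phi>))\<close>, the expression is positive: the last bracket is at least \<open>\<gamma> \<eta>\<close> on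
both tails, and the first term wins on the compact remainder. To the left of \<open>Y\<close> the middle term is
nonnegative for every \<open>a\<close>; this takes care of the centre of the bump, where \<open>a = 0\<close>.\<close>

lemma front_slack:
  assumes b: "bistable f \<theta>" and top: "(\<phi> \<longlongrightarrow> 0) at_top" and bot: "(\<phi> \<longlongrightarrow> 1) at_bot"
    and rng: "\<And>z. 0 \<le> \<phi> z \<and> \<phi> z \<le> (1::real)" and c: "0 < c"
    and d1: "\<And>z. (\<phi> has_real_derivative \<phi>1 z) (at z)" and d2: "\<And>z. (\<phi>1 has_real_derivative \<phi>2 z) (at z)"
    and neg: "\<And>z. \<phi>1 z < 0" and P: "\<And>z. \<bar>\<phi>1 z\<bar> \<le> P"
  obtains \<eta> \<delta> a0 Y where "0 < \<eta>" "\<eta> < \<theta>" "0 < \<delta>" "0 \<le> a0" "a0 < (1::real)"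
    "\<And>y a. y \<le> Y \<Longrightarrow> 0 \<le> a \<Longrightarrow> a \<le> 1 \<Longrightarrow> 0 < \<delta> * \<phi>1 y - a * (c * \<phi>1 y + f (\<phi> y)) + f (\<phi> y - \<eta>)"
    "\<And>y a. Y \<le> y \<Longrightarrow> \<eta> \<le> \<phi> y \<Longrightarrow> a0 \<le> a \<Longrightarrow> a \<le> 1 \<Longrightarrow> 0 < \<delta> * \<phi>1 y - a * (c * \<phi>1 y + f (\<phi> y)) + f (\<phi> y - \<eta>)"
proof -
  have th: "0 < \<theta>" "\<theta> < 1" and f0: "f 0 = 0" "f 1 = 0"
    using b unfolding bistable_def by auto
  obtain L where L: "0 < L" "\<And>a b. a \<in> {0..1} \<Longrightarrow> b \<in> {0..1} \<Longrightarrow> \<bar>f a - f b\<bar> \<le> L * \<bar>a - b\<bar>"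
    using bistable_derivative_properties[OF b] by metis
  have fb: "\<bar>f s\<bar> \<le> L" if "s \<in> {0..1}" for s
  proof -
    have "\<bar>f s - f 0\<bar> \<le> L * \<bar>s - 0\<bar>" by (rule L(2)) (use that in auto)
    also have "\<dots> \<le> L * 1" using that L by (intro mult_left_mono) auto
    finally show ?thesis by (simp add: f0)
  qed
  obtain \<kappa> \<gamma> where \<kappa>: "0 < \<kappa>" "\<kappa> < 1 / 2" and \<gamma>: "0 < \<gamma>"
    and z0: "\<And>a b. 0 \<le> b \<Longrightarrow> b \<le> a \<Longrightarrow> a \<le> \<kappa> \<Longrightarrow> f a - f b \<le> - \<gamma> * (a - b)"
    and z1: "\<And>a b. 1 - \<kappa> \<le> b \<Longrightarrow> b \<le> a \<Longrightarrow> a \<le> 1 \<Longrightarrow> f a - f b \<le> - \<gamma> * (a - b)"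
    using bistable_stable_zones[OF b] by blast
  have "\<forall>\<^sub>F y in at_top. \<phi> y < \<kappa>" using order_tendstoD(2)[OF top, of \<kappa>] \<kappa> by simp
  then obtain Y0 where Y0: "\<And>y. Y0 \<le> y \<Longrightarrow> \<phi> y < \<kappa>" unfolding eventually_at_top_linorder by blast
  have "\<forall>\<^sub>F y in at_bot. 1 - \<kappa> / 2 < \<phi> y" using order_tendstoD(1)[OF bot, of "1 - \<kappa> / 2"] \<kappa> by simp
  then obtain Y where Y: "\<And>y. y \<le> Y \<Longrightarrow> 1 - \<kappa> / 2 < \<phi> y" unfolding eventually_at_bot_linorder by blast
  define Y' where "Y' = max Y0 Y"
  have "continuous_on {Y..Y'} \<phi>1"
    by (intro continuous_at_imp_continuous_on ballI DERIV_isCont[OF d2])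
  moreover have "{Y..Y'} \<noteq> {}" by (simp add: Y'_def)
  ultimately obtain m where m: "\<And>z. z \<in> {Y..Y'} \<Longrightarrow> \<phi>1 z \<le> \<phi>1 m"
    using continuous_attains_sup[OF compact_Icc] by blast
  define k where "k = - \<phi>1 m"
  have k: "0 < k" using neg[of m] by (simp add: k_def)
  have P0: "0 < P" using P[of 0] neg[of 0] by linarith
  define \<eta> where "\<eta> = Min {\<kappa> / 2, c * k / (8 * L), \<theta> / 2}"
  have \<eta>: "0 < \<eta>" "\<eta> \<le> \<kappa> / 2" "\<eta> \<le> c * k / (8 * L)" "\<eta> < \<theta>" using \<kappa> c k L th by (auto simp: \<eta>_def)
  have L\<eta>: "L * \<eta> \<le> c * k / 8" using \<eta>(3) L by (simp add: field_simps)
  define \<delta> where "\<delta> = min (c / 4) (\<gamma> * \<eta> / (2 * P))"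
  have \<delta>: "0 < \<delta>" "\<delta> \<le> c / 4" "\<delta> \<le> \<gamma> * \<eta> / (2 * P)" using c \<gamma> \<eta> P0 by (auto simp: \<delta>_def)
  have \<gamma>\<eta>: "0 < \<gamma> * \<eta>" using \<gamma> \<eta> by simp
  have \<delta>P: "\<delta> * P < \<gamma> * \<eta>"
  proof -
    have "\<delta> * P \<le> \<gamma> * \<eta> / (2 * P) * P" using \<delta> P0 by (intro mult_right_mono) auto
    also have "\<dots> = \<gamma> * \<eta> / 2" using P0 by simp
    finally show ?thesis using \<gamma>\<eta> by simp
  qed
  define s where "s = Min {1 / 2, \<gamma> * \<eta> / (2 * L), c * k / (16 * L)}"
  have s: "0 < s" "s \<le> 1 / 2" "s \<le> \<gamma> * \<eta> / (2 * L)" "s \<le> c * k / (16 * L)" using \<gamma>\<eta> L c k by (auto simp: s_def)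
  have sL: "s * L \<le> \<gamma> * \<eta> / 2" "s * L \<le> c * k / 16"
    using s(3,4) L by (simp_all add: field_simps)
  have form: "\<delta> * \<phi>1 y - a * (c * \<phi>1 y + f (\<phi> y)) + f (\<phi> y - \<eta>)
      = (a * c - \<delta>) * (- \<phi>1 y) + (1 - a) * f (\<phi> y) + (f (\<phi> y - \<eta>) - f (\<phi> y))" for y a
    by (simp add: algebra_simps)
  show ?thesis
  proof (rule that[of \<eta> \<delta> "1 - s" Y])
    fix y a :: real assume y: "y \<le> Y" and a: "0 \<le> a" "a \<le> 1"
    have ph: "1 - \<kappa> / 2 < \<phi> y" by (rule Y[OF y])
    have "f (\<phi> y) - f (\<phi> y - \<eta>) \<le> - \<gamma> * (\<phi> y - (\<phi> y - \<eta>))" by (rule z1) (use ph \<eta> rng in auto)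
    then have 1: "\<gamma> * \<eta> \<le> f (\<phi> y - \<eta>) - f (\<phi> y)" by simp
    have "f 1 - f (\<phi> y) \<le> - \<gamma> * (1 - \<phi> y)" by (rule z1) (use ph \<kappa> rng in auto)
    moreover have "0 \<le> \<gamma> * (1 - \<phi> y)" using \<gamma> rng by simp
    ultimately have "0 \<le> f (\<phi> y)" using f0 by simp
    then have 2: "0 \<le> (1 - a) * f (\<phi> y)" using a by simp
    have "(- \<delta>) * (- \<phi>1 y) \<le> (a * c - \<delta>) * (- \<phi>1 y)"
      using a c neg[of y] by (intro mult_right_mono) auto
    moreover have "\<delta> * (- \<phi>1 y) \<le> \<delta> * P" using P[of y] \<delta> by (intro mult_left_mono) auto
    ultimately have 3: "- (\<delta> * P) \<le> (a * c - \<delta>) * (- \<phi>1 y)" by linarith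
    show "0 < \<delta> * \<phi>1 y - a * (c * \<phi>1 y + f (\<phi> y)) + f (\<phi> y - \<eta>)"
      unfolding form using 1 2 3 \<delta>P by linarith
  next
    fix y a :: real assume y: "Y \<le> y" and ph: "\<eta> \<le> \<phi> y" and a: "1 - s \<le> a" "a \<le> 1"
    have "(1 / 2) * c \<le> a * c" using a s c by (intro mult_right_mono) auto
    then have ac: "c / 4 \<le> a * c - \<delta>" using \<delta> by linarith
    have "(1 - a) * \<bar>f (\<phi> y)\<bar> \<le> s * L" using a s fb[of "\<phi> y"] rng L by (intro mult_mono) auto
    moreover have "\<bar>(1 - a) * f (\<phi> y)\<bar> = (1 - a) * \<bar>f (\<phi> y)\<bar>" using a by (simp add: abs_mult)
    ultimately have 2: "- (s * L) \<le> (1 - a) * f (\<phi> y)" by linarith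
    show "0 < \<delta> * \<phi>1 y - a * (c * \<phi>1 y + f (\<phi> y)) + f (\<phi> y - \<eta>)"
    proof (cases "y \<le> Y'")
      case True
      have "\<phi>1 y \<le> - k" using m[of y] y True by (simp add: k_def)
      then have "c / 4 * k \<le> (a * c - \<delta>) * (- \<phi>1 y)" using ac c k by (intro mult_mono) auto
      moreover have "\<bar>f (\<phi> y - \<eta>) - f (\<phi> y)\<bar> \<le> L * \<bar>\<phi> y - \<eta> - \<phi> y\<bar>"
        by (rule L(2)) (use ph rng[of y] \<eta> in auto)
      then have "- (L * \<eta>) \<le> f (\<phi> y - \<eta>) - f (\<phi> y)" using \<eta> by simp
      moreover have "0 < c * k" using c k by simp
      ultimately show ?thesis unfolding form using 2 sL(2) L\<eta> by linarith
    next
      case False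
      then have "\<phi> y < \<kappa>" by (intro Y0) (simp add: Y'_def)
      then have "f (\<phi> y) - f (\<phi> y - \<eta>) \<le> - \<gamma> * (\<phi> y - (\<phi> y - \<eta>))" by (intro z0) (use ph \<eta> in auto)
      then have 1: "\<gamma> * \<eta> \<le> f (\<phi> y - \<eta>) - f (\<phi> y)" by simp
      have "0 \<le> (a * c - \<delta>) * (- \<phi>1 y)" using ac c neg[of y] by (intro mult_nonneg_nonneg) auto
      then show ?thesis unfolding form using 1 2 sL(1) \<gamma>\<eta> by linarith
    qed
  qed (use \<eta> \<delta> s in auto)
qed

text \<open>The profile \<open>\<phi> - \<eta>\<close> of the regularised distance \<open>sqrt (|x - xc|\<^sup>2 + B\<^sup>2)\<close>, which is smooth at the centre. A
large \<open>B\<close> makes the curvature term \<open>d / B\<close> small, and a large shift \<open>s0\<close> puts the transition zone where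
the regularised distance has gradient almost of length \<open>1\<close>. It vanishes where \<open>\<phi> = \<eta>\<close>, which defines \<open>R0\<close>.\<close>

lemma moving_subsolution:
  assumes b: "bistable f \<theta>" and tf: "travelling_front f \<theta> \<phi> c"
  obtains R0 \<epsilon> \<eta> :: real and V V1 :: "real \<Rightarrow> real" where "0 < R0" "0 < \<epsilon>" "0 < \<eta>" "\<eta> < 1"
    "\<And>q. 0 \<le> q \<Longrightarrow> V q \<le> 1 - \<eta>" "V (R0\<^sup>2) = 0"
    "\<And>q r. 0 \<le> q \<Longrightarrow> q < r \<Longrightarrow> V r < V q"
    "\<And>q. 0 \<le> q \<Longrightarrow> (V has_real_derivative V1 q) (at q) \<and> V1 q < 0"
    "\<And>(x0::'a::euclidean_space) e T t x. norm e = 1 \<Longrightarrow> 0 \<le> V ((x - (x0 + (\<epsilon> * (t - T)) *\<^sub>R e)) \<bullet> (x - (x0 + (\<epsilon> * (t - T)) *\<^sub>R e))) \<Longrightarrow>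
       \<exists>s. heat_at (\<lambda>t x. V ((x - (x0 + (\<epsilon> * (t - T)) *\<^sub>R e)) \<bullet> (x - (x0 + (\<epsilon> * (t - T)) *\<^sub>R e)))) t x s \<and>
         s < f (V ((x - (x0 + (\<epsilon> * (t - T)) *\<^sub>R e)) \<bullet> (x - (x0 + (\<epsilon> * (t - T)) *\<^sub>R e))))"
proof -
  have c: "0 < c" and rng: "\<And>z. 0 \<le> \<phi> z \<and> \<phi> z \<le> 1" and bot: "(\<phi> \<longlongrightarrow> 1) at_bot" and top: "(\<phi> \<longlongrightarrow> 0) at_top"
    and \<phi>0: "\<phi> 0 = \<theta>" using tf unfolding travelling_front_def by auto
  have th: "0 < \<theta>" "\<theta> < 1" using b unfolding bistable_def by auto
  obtain \<phi>1 \<phi>2 P where d1: "\<And>z. (\<phi> has_real_derivative \<phi>1 z) (at z)" and d2: "\<And>z. (\<phi>1 has_real_derivative \<phi>2 z) (at z)"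
    and ode: "\<And>z. \<phi>2 z + c * \<phi>1 z + f (\<phi> z) = 0" and neg: "\<And>z. \<phi>1 z < 0" and P: "\<And>z. \<bar>\<phi>1 z\<bar> \<le> P"
    using front_decreasing[OF b tf] by blast
  have dec: "\<phi> y < \<phi> z" if "z < y" for y z by (rule front_strict_antimono[OF d1 neg that])
  obtain \<eta> \<delta> a0 Y where \<eta>: "0 < \<eta>" "\<eta> < \<theta>" and \<delta>: "0 < \<delta>" and a0: "0 \<le> a0" "a0 < (1::real)"
    and sl1: "\<And>y a. y \<le> Y \<Longrightarrow> 0 \<le> a \<Longrightarrow> a \<le> 1 \<Longrightarrow> 0 < \<delta> * \<phi>1 y - a * (c * \<phi>1 y + f (\<phi> y)) + f (\<phi> y - \<eta>)"
    and sl2: "\<And>y a. Y \<le> y \<Longrightarrow> \<eta> \<le> \<phi> y \<Longrightarrow> a0 \<le> a \<Longrightarrow> a \<le> 1 \<Longrightarrow> 0 < \<delta> * \<phi>1 y - a * (c * \<phi>1 y + f (\<phi> y)) + f (\<phi> y - \<eta>)"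
    using front_slack[OF b top bot rng c d1 d2 neg P] by blast
  let ?d = "real DIM('a)"
  define \<epsilon> where "\<epsilon> = \<delta> / 2"
  define B where "B = 2 * ?d / \<delta>"
  have B: "0 < B" and \<epsilon>: "0 < \<epsilon>" using \<delta> by (auto simp: B_def \<epsilon>_def)
  have \<epsilon>B: "\<epsilon> + ?d / B = \<delta>" using \<delta> by (simp add: B_def \<epsilon>_def)
  \<comment> \<open>Where the regularised distance \<open>R\<close> is at least \<open>\<rho>\<close>, one has \<open>1 - B\<^sup>2 / R\<^sup>2 \<ge> a0\<close>.\<close>
  define \<rho> where "\<rho> = B / sqrt (1 - a0)"
  have \<rho>: "0 < \<rho>" "B \<le> \<rho>"
    using B a0 by (auto simp: \<rho>_def pos_le_divide_eq mult_left_le)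
  define s0 where "s0 = \<rho> + \<bar>Y\<bar>"
  obtain Y2 where Y2: "0 < Y2" "\<phi> Y2 = \<eta>"
  proof -
    have "\<forall>\<^sub>F y in at_top. \<phi> y < \<eta>" using order_tendstoD(2)[OF top, of \<eta>] \<eta> by simp
    then obtain N where N: "\<And>y. N \<le> y \<Longrightarrow> \<phi> y < \<eta>" unfolding eventually_at_top_linorder by blast
    have "continuous_on {0..max N 1} \<phi>"
      by (intro continuous_at_imp_continuous_on ballI DERIV_isCont[OF d1])
    then have "\<exists>y. 0 \<le> y \<and> y \<le> max N 1 \<and> \<phi> y = \<eta>"
      using IVT2'[of \<phi> "max N 1" \<eta> 0] N[of "max N 1"] \<eta> \<phi>0 by simp
    then obtain y where "0 \<le> y" "\<phi> y = \<eta>" by blast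
    moreover then have "y \<noteq> 0" using \<phi>0 \<eta> by auto
    ultimately show ?thesis using that[of y] by simp
  qed
  define V where "V = (\<lambda>q. \<phi> (sqrt (q + B\<^sup>2) - s0) - \<eta>)"
  define V1 where "V1 = (\<lambda>q. \<phi>1 (sqrt (q + B\<^sup>2) - s0) * (inverse (sqrt (q + B\<^sup>2)) / 2))"
  define R0 where "R0 = sqrt ((s0 + Y2)\<^sup>2 - B\<^sup>2)"
  have sB: "B < s0 + Y2" using \<rho> Y2 by (simp add: s0_def)
  have R0: "0 < R0" "R0\<^sup>2 = (s0 + Y2)\<^sup>2 - B\<^sup>2"
  proof -
    have "B\<^sup>2 < (s0 + Y2)\<^sup>2" using sB B by (intro power_strict_mono) auto
    then show "0 < R0" "R0\<^sup>2 = (s0 + Y2)\<^sup>2 - B\<^sup>2" by (auto simp: R0_def)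
  qed
  have VR0: "V (R0\<^sup>2) = 0" using R0 sB B Y2 by (simp add: V_def)
  have Vdec: "V r < V q" if "0 \<le> q" "q < r" for q r
    unfolding V_def using that by (intro diff_strict_right_mono dec) simp
  have Vd: "(V has_real_derivative V1 q) (at q)" if "- (B\<^sup>2) < q" for q
  proof -
    have "((\<lambda>q. sqrt (q + B\<^sup>2) - s0) has_real_derivative (inverse (sqrt (q + B\<^sup>2)) / 2)) (at q)"
      using that by (auto intro!: derivative_eq_intros)
    from DERIV_diff[OF DERIV_chain2[OF d1 this] DERIV_const]
    show ?thesis unfolding V_def V1_def by simp
  qed
  have B2: "0 < B\<^sup>2" using B by simp
  have V1neg: "V1 q < 0" if "0 \<le> q" for q
    unfolding V1_def using neg that B2 by (intro mult_neg_pos) (auto intro: add_nonneg_pos)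
  show ?thesis
  proof (rule that[of R0 \<epsilon> \<eta> V V1])
    show "0 < R0" "0 < \<epsilon>" "0 < \<eta>" by (fact R0(1) \<epsilon> \<eta>(1))+
    show "V (R0\<^sup>2) = 0" by (fact VR0)
    show "V r < V q" if "0 \<le> q" "q < r" for q r by (rule Vdec[OF that])
    show "\<eta> < 1" using \<eta> th by simp
    show "V q \<le> 1 - \<eta>" for q using rng by (simp add: V_def)
    show "(V has_real_derivative V1 q) (at q) \<and> V1 q < 0" if "0 \<le> q" for q
      using Vd[of q] V1neg[OF that] that B2 by simp
  next
    fix x0 e :: 'a and T t x
    let ?xc = "\<lambda>t. x0 + (\<epsilon> * (t - T)) *\<^sub>R e"
    let ?q = "(x - ?xc t) \<bullet> (x - ?xc t)"
    assume e: "norm e = 1" and V0: "0 \<le> V ?q"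
    define R where "R = sqrt (?q + B\<^sup>2)"
    define y where "y = R - s0"
    define a where "a = ?q / R\<^sup>2"
    have q0: "0 \<le> ?q" by simp
    have Rq: "R\<^sup>2 = ?q + B\<^sup>2" using B2 by (simp add: R_def)
    have RB: "B \<le> R" unfolding R_def using q0 by (intro real_le_rsqrt) simp
    then have R: "0 < R" using B by simp
    have a: "0 \<le> a" "a \<le> 1" "a = 1 - B\<^sup>2 / R\<^sup>2"
    proof -
      show "0 \<le> a" by (simp add: a_def)
      have "?q \<le> R\<^sup>2" using Rq B2 by linarith
      moreover have "0 < R\<^sup>2" using R by (rule zero_less_power)
      ultimately have "?q \<le> R\<^sup>2" "0 < R\<^sup>2" .
      then show "a \<le> 1" unfolding a_def by (simp only: divide_le_eq_1 simp_thms)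
      have "?q = R\<^sup>2 - B\<^sup>2" using Rq by simp
      then show "a = 1 - B\<^sup>2 / R\<^sup>2" unfolding a_def using R by (simp add: diff_divide_distrib)
    qed
    have ph: "\<eta> \<le> \<phi> y" using V0 by (simp add: V_def y_def R_def)
    have slack: "0 < \<delta> * \<phi>1 y - a * (c * \<phi>1 y + f (\<phi> y)) + f (\<phi> y - \<eta>)"
    proof (cases "y \<le> Y")
      case True
      then show ?thesis using sl1 a by blast
    next
      case False
      then have "\<rho> \<le> R" by (simp add: y_def s0_def)
      then have "B\<^sup>2 / R\<^sup>2 \<le> B\<^sup>2 / \<rho>\<^sup>2" using \<rho> R by (intro divide_left_mono power_mono) auto
      also have "\<dots> = 1 - a0" using B a0 by (simp add: \<rho>_def power_divide)
      finally have "a0 \<le> a" using a by simp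
      then show ?thesis using sl2[of y a] False ph a by simp
    qed
    have ev: "\<forall>\<^sub>F s in nhds ?q. (V has_real_derivative V1 s) (at s)"
    proof -
      have "\<forall>\<^sub>F s in nhds ?q. s \<in> {- (B\<^sup>2)<..}"
      proof (rule eventually_nhds_in_open)
        have "- (B\<^sup>2) < ?q" using q0 B2 by linarith
        then show "?q \<in> {- (B\<^sup>2)<..}" by (simp only: greaterThan_iff)
      qed simp
      then show ?thesis by eventually_elim (use Vd in auto)
    qed
    have dV1: "(V1 has_real_derivative (\<phi>2 y / (4 * R\<^sup>2) - \<phi>1 y / (4 * R ^ 3))) (at ?q)"
    proof -
      have pos: "0 < ?q + B\<^sup>2" using q0 B2 by linarith
      have s1: "((\<lambda>q. sqrt (q + B\<^sup>2)) has_real_derivative (inverse R / 2)) (at ?q)"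
        unfolding R_def using pos by (auto intro!: derivative_eq_intros)
      have s2: "((\<lambda>q. sqrt (q + B\<^sup>2) - s0) has_real_derivative (inverse R / 2)) (at ?q)"
        using DERIV_diff[OF s1 DERIV_const] by simp
      have s3: "((\<lambda>q. \<phi>1 (sqrt (q + B\<^sup>2) - s0)) has_real_derivative \<phi>2 y * (inverse R / 2)) (at ?q)"
        using DERIV_chain2[OF d2 s2] by (simp add: y_def R_def)
      have s4: "((\<lambda>q. inverse (sqrt (q + B\<^sup>2)) / 2) has_real_derivative (- (inverse R * (inverse R / 2) * inverse R) / 2)) (at ?q)"
        using DERIV_cdivide[OF DERIV_inverse'[OF s1], of 2] R by (simp add: R_def)
      have "(V1 has_real_derivative (\<phi>1 y * (- (inverse R * (inverse R / 2) * inverse R) / 2) + \<phi>2 y * (inverse R / 2) * (inverse R / 2))) (at ?q)"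
        using DERIV_mult'[OF s3 s4] unfolding V1_def by (simp add: y_def R_def)
      moreover have "\<phi>1 y * (- (inverse R * (inverse R / 2) * inverse R) / 2) + \<phi>2 y * (inverse R / 2) * (inverse R / 2)
         = \<phi>2 y / (4 * R\<^sup>2) - \<phi>1 y / (4 * R ^ 3)"
        using R by (simp add: field_simps power2_eq_square power3_eq_cube)
      ultimately show ?thesis by simp
    qed
    define l where "l = 4 * (\<phi>2 y / (4 * R\<^sup>2) - \<phi>1 y / (4 * R ^ 3)) * ?q + 2 * ?d * V1 ?q"
    have lap: "lap_at (\<lambda>x. V ((x - ?xc t) \<bullet> (x - ?xc t))) x l"
      unfolding l_def by (rule lap_at_comp_sq[OF ev dV1])
    have "V1 ?q = \<phi>1 y * (inverse R / 2)" unfolding V1_def y_def R_def ..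
    also have "\<dots> = \<phi>1 y / (2 * R)" using R by (simp add: field_simps)
    finally have V1q: "V1 ?q = \<phi>1 y / (2 * R)" .
    have Vq: "V ?q = \<phi> y - \<eta>" unfolding V_def y_def R_def ..
    have l_eq: "l = a * \<phi>2 y + \<phi>1 y * ((?d - a) / R)"
      unfolding l_def V1q a_def using R by (simp add: field_simps power2_eq_square power3_eq_cube)
    have l_ge: "a * \<phi>2 y + \<phi>1 y * (?d / B) \<le> l"
    proof -
      have "(?d - a) / R \<le> ?d / B" using a RB B R by (intro frac_le) auto
      then have "\<phi>1 y * (?d / B) \<le> \<phi>1 y * ((?d - a) / R)" using neg[of y] by (intro mult_left_mono_neg) auto
      then show ?thesis by (simp add: l_eq)
    qed
    have ee: "e \<bullet> e = 1" using e by (simp add: norm_eq_1)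
    define q' where "q' = - (2 * \<epsilon> * ((x - ?xc t) \<bullet> e))"
    have dq: "((\<lambda>\<tau>. (x - ?xc \<tau>) \<bullet> (x - ?xc \<tau>)) has_real_derivative q') (at t)"
      unfolding has_field_derivative_def q'_def
      by (auto intro!: derivative_eq_intros simp: inner_commute fun_eq_iff)
    have dt: "((\<lambda>\<tau>. V ((x - ?xc \<tau>) \<bullet> (x - ?xc \<tau>))) has_real_derivative V1 ?q * q') (at t)"
      by (rule DERIV_chain2[OF Vd dq]) (use q0 B2 in linarith)
    have tb: "V1 ?q * q' \<le> - (\<epsilon> * \<phi>1 y)"
    proof -
      have "\<bar>(x - ?xc t) \<bullet> e\<bar> \<le> norm (x - ?xc t) * norm e" by (rule Cauchy_Schwarz_ineq2)
      also have "\<dots> \<le> R" unfolding R_def e using B2 by (simp add: norm_eq_sqrt_inner)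
      finally have ab: "(x - ?xc t) \<bullet> e / R \<le> 1" "- 1 \<le> (x - ?xc t) \<bullet> e / R" using R by (auto simp: abs_le_iff field_simps)
      have "V1 ?q * q' = (- \<phi>1 y * \<epsilon>) * ((x - ?xc t) \<bullet> e / R)" unfolding V1q q'_def using R by (simp add: field_simps)
      also have "\<dots> \<le> (- \<phi>1 y * \<epsilon>) * 1" using ab neg[of y] \<epsilon> by (intro mult_left_mono) (auto simp: mult_le_0_iff)
      finally show ?thesis by (simp add: mult.commute)
    qed
    have "heat_at (\<lambda>t x. V ((x - ?xc t) \<bullet> (x - ?xc t))) t x (V1 ?q * q' - l)"
      unfolding heat_at_def using dt lap by blast
    moreover have "V1 ?q * q' - l < f (V ?q)"
    proof -
      have p2: "\<phi>2 y = - (c * \<phi>1 y + f (\<phi> y))" using ode[of y] by simp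
      have "V1 ?q * q' - l \<le> - (\<epsilon> * \<phi>1 y) - (a * \<phi>2 y + \<phi>1 y * (?d / B))" using tb l_ge by linarith
      also have "\<dots> = - (\<delta> * \<phi>1 y) + a * (c * \<phi>1 y + f (\<phi> y))"
        unfolding p2 \<epsilon>B[symmetric] by (simp add: algebra_simps)
      also have "\<dots> < f (\<phi> y - \<eta>)" using slack by linarith
      finally show ?thesis by (simp add: Vq)
    qed
    ultimately show "\<exists>s. heat_at (\<lambda>t x. V ((x - ?xc t) \<bullet> (x - ?xc t))) t x s \<and> s < f (V ?q)" by blast
  qed
qed

text \<open>The bump cannot overtake \<open>u\<close> at an interior point because it is a strict subsolution. At a boundary point
\<open>y\<close>, the ball of radius \<open>R0 - \<mu>\<close> around the centre and the exterior ball at \<open>y\<close> are disjoint, which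
forces \<open>y - xc\<close> to point strictly outward if \<open>\<mu>\<close> is small; since the bump decreases radially, its difference
to \<open>u\<close> then still increases into the domain.\<close>

lemma (in neumann_flow) moving_subsolution_below:
  fixes R0 \<epsilon> \<eta> T :: real and V V1 :: "real \<Rightarrow> real" and x0 e :: 'a
  defines "xc \<equiv> \<lambda>t. x0 + (\<epsilon> * (t - T)) *\<^sub>R e"
  assumes R0: "0 < R0" and \<epsilon>: "0 < \<epsilon>" and \<eta>: "0 < \<eta>" and Vle: "\<And>q. 0 \<le> q \<Longrightarrow> V q \<le> 1 - \<eta>" and VR: "V (R0\<^sup>2) = 0"
    and Vdec: "\<And>q r. 0 \<le> q \<Longrightarrow> q < r \<Longrightarrow> V r < V q"
    and Vd: "\<And>q. 0 \<le> q \<Longrightarrow> (V has_real_derivative V1 q) (at q) \<and> V1 q < 0"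
    and heatV: "\<And>t x. 0 \<le> V ((x - xc t) \<bullet> (x - xc t)) \<Longrightarrow>
       \<exists>s. heat_at (\<lambda>t x. V ((x - xc t) \<bullet> (x - xc t))) t x s \<and> s < f (V ((x - xc t) \<bullet> (x - xc t)))"
    and e: "norm e = 1" and \<mu>: "0 < \<mu>" "\<mu> < R0" "\<mu> * (2 * R0) < 2 * r0 * (R0 - \<mu>)"
    and ballin: "\<And>t. T \<le> t \<Longrightarrow> ball (xc t) (R0 - \<mu>) \<subseteq> \<Omega>"
    and init: "\<And>x. x \<in> closure \<Omega> \<Longrightarrow> dist (xc T) x \<le> R0 \<Longrightarrow> 1 - \<eta> \<le> u T x"
    and t: "T \<le> t" and x: "x \<in> closure \<Omega>" "dist (xc t) x \<le> R0"
  shows "V ((x - xc t) \<bullet> (x - xc t)) \<le> u t x"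
proof -
  define w where "w = (\<lambda>t x. V ((x - xc t) \<bullet> (x - xc t)))"
  define K where "K = ({T..t} \<times> (closure \<Omega> \<inter> cball x0 (R0 + \<epsilon> * (t - T)))) \<inter> {p. dist (xc (fst p)) (snd p) \<le> R0}"
  \<comment> \<open>The exponential factor absorbs \<open>f(w) - f(u) \<le> L (w - u)\<close>, so that contact need not be exact.\<close>
  define z where "z = (\<lambda>s x. exp (- L * (s - T)) * (w s x - u s x))"
  have "closed {p::real \<times> 'a. dist (xc (fst p)) (snd p) \<le> R0}"
    unfolding xc_def by (intro closed_Collect_le continuous_intros)
  then have K: "compact K" unfolding K_def by (intro compact_Int_closed compact_Times closed_Int_compact) auto
  have inK: "(s, y) \<in> K" if "T \<le> s" "s \<le> t" "y \<in> closure \<Omega>" "dist (xc s) y \<le> R0" for s y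
  proof -
    have "dist x0 (xc s) = \<epsilon> * (s - T)" using e \<epsilon> that by (simp add: xc_def dist_norm abs_mult)
    also have "\<dots> \<le> \<epsilon> * (t - T)" using that \<epsilon> by simp
    finally have "dist x0 y \<le> R0 + \<epsilon> * (t - T)" using dist_triangle[of x0 y "xc s"] that by simp
    then show ?thesis using that by (simp add: K_def)
  qed
  have contV: "continuous_on {0..} V"
    by (intro continuous_at_imp_continuous_on ballI) (use Vd DERIV_isCont in auto)
  have contw: "continuous_on K (\<lambda>p. w (fst p) (snd p))"
    unfolding w_def by (rule continuous_on_compose2[OF contV]) (auto simp: xc_def intro!: continuous_intros)
  have contz: "continuous_on K (\<lambda>(s, x). z s x)"
    unfolding z_def case_prod_beta
    by (intro continuous_intros contw continuous_on_subset[OF cont_u[unfolded case_prod_beta]]) (auto simp: K_def)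
  have "z t x \<le> 0"
  proof (rule parabolic_max_principle[OF K contz])
    show "(t, x) \<in> K" by (rule inK) (use t x in auto)
    fix s y assume sy: "(s, y) \<in> K" and pos: "0 < z s y"
    have s: "T \<le> s" "s \<le> t" and y: "y \<in> closure \<Omega>" "dist (xc s) y \<le> R0" using sy by (auto simp: K_def)
    have wu: "u s y < w s y" using pos by (simp add: z_def zero_less_mult_iff)
    have wpos: "0 < w s y" using wu u01[OF y(1), of s] by auto
    have dR: "dist (xc s) y < R0"
    proof (rule ccontr)
      assume "\<not> dist (xc s) y < R0"
      then have "(y - xc s) \<bullet> (y - xc s) = R0\<^sup>2" using y by (simp add: dot_square_norm dist_norm norm_minus_commute)
      then show False using wpos VR by (simp add: w_def)
    qed
    have sT: "T < s"
    proof (rule ccontr)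
      assume "\<not> T < s"
      then have "s = T" using s by simp
      then have "1 - \<eta> \<le> u s y" using init[OF y(1)] y(2) by simp
      moreover have "w s y \<le> 1 - \<eta>" unfolding w_def by (rule Vle) simp
      ultimately show False using wu by simp
    qed
    show "(\<exists>s' y'. (s', y') \<in> K \<and> z s y < z s' y') \<or>
        (\<exists>r<0. heat_at z s y r \<and> (\<forall>\<^sub>F y' in nhds y. (s, y') \<in> K) \<and> (\<forall>\<^sub>F \<tau> in at_left s. (\<tau>, y) \<in> K))"
    proof (cases "y \<in> \<Omega>")
      case True
      obtain r where r: "heat_at w s y r" "r < f (w s y)"
        using heatV[of y s] wpos unfolding w_def by auto
      have "((\<lambda>s. exp (- L * (s - T))) has_real_derivative (- L * exp (- L * (s - T)))) (at s)"
        by (auto intro!: derivative_eq_intros)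
      then have h: "heat_at z s y ((- L * exp (- L * (s - T))) * (w s y - u s y) + exp (- L * (s - T)) * (r - f (u s y)))"
        unfolding z_def by (intro heat_at_time_mult heat_at_diff r heat_u True)
      have w1: "w s y \<le> 1" unfolding w_def using Vle[of "(y - xc s) \<bullet> (y - xc s)"] \<eta> by simp
      have "\<bar>f (w s y) - f (u s y)\<bar> \<le> L * \<bar>w s y - u s y\<bar>"
        by (rule f_lip) (use wpos w1 u01[OF y(1)] in auto)
      then have "r - f (u s y) < L * (w s y - u s y)" using r(2) wu by simp
      then have "exp (- L * (s - T)) * (r - f (u s y)) < exp (- L * (s - T)) * (L * (w s y - u s y))" by simp
      then have n: "(- L * exp (- L * (s - T))) * (w s y - u s y) + exp (- L * (s - T)) * (r - f (u s y)) < 0"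
        by (simp add: algebra_simps)
      have "\<forall>\<^sub>F y' in nhds y. y' \<in> \<Omega> \<inter> ball (xc s) R0"
        by (rule eventually_nhds_in_open) (use open_dom True dR in auto)
      then have ev1: "\<forall>\<^sub>F y' in nhds y. (s, y') \<in> K"
        by eventually_elim (use s dom_closure in \<open>auto intro!: inK\<close>)
      have "((\<lambda>\<tau>. dist (xc \<tau>) y) \<longlongrightarrow> dist (xc s) y) (at_left s)"
        unfolding xc_def by (intro tendsto_intros)
      then have "\<forall>\<^sub>F \<tau> in at_left s. dist (xc \<tau>) y < R0" using dR by (rule order_tendstoD(2))
      moreover have "\<forall>\<^sub>F \<tau> in at_left s. T < \<tau>" "\<forall>\<^sub>F \<tau> in at_left s. \<tau> < s"
        using sT by (auto simp: eventually_at_left_field)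
      ultimately have ev2: "\<forall>\<^sub>F \<tau> in at_left s. (\<tau>, y) \<in> K"
        by eventually_elim (use s y in \<open>auto intro!: inK\<close>)
      show ?thesis using h n ev1 ev2 by blast
    next
      case False
      then have q: "y \<in> frontier \<Omega>" using y closure_cases by blast
      have inward: "(y - xc s) \<bullet> n y < 0"
      proof -
        have "ball (xc s) (R0 - \<mu>) \<inter> ball (y - r0 *\<^sub>R n y) r0 = {}"
          using ballin[OF s(1)] outer_ball[OF q] by blast
        from disjoint_balls_dist[OF this] have "R0 - \<mu> + r0 \<le> norm ((y - xc s) + (- r0) *\<^sub>R n y)"
          using \<mu> r0 by (simp add: dist_norm norm_minus_commute algebra_simps)
        then have "(R0 - \<mu> + r0)\<^sup>2 \<le> (norm ((y - xc s) + (- r0) *\<^sub>R n y))\<^sup>2" using \<mu> r0 by (intro power_mono) auto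
        also have "\<dots> = (norm (y - xc s))\<^sup>2 - 2 * r0 * ((y - xc s) \<bullet> n y) + r0\<^sup>2"
          unfolding norm_add_scaleR_sq using norm_n[OF q] by simp
        also have "(norm (y - xc s))\<^sup>2 \<le> R0\<^sup>2" using dR by (intro power_mono) (auto simp: dist_norm norm_minus_commute)
        finally have i: "(R0 - \<mu> + r0)\<^sup>2 \<le> R0\<^sup>2 - 2 * r0 * ((y - xc s) \<bullet> n y) + r0\<^sup>2" by simp
        have "(R0 - \<mu> + r0)\<^sup>2 = R0\<^sup>2 + r0\<^sup>2 - \<mu> * (2 * R0) + \<mu>\<^sup>2 + 2 * r0 * (R0 - \<mu>)"
          by (simp add: power2_eq_square algebra_simps)
        moreover have "0 \<le> \<mu>\<^sup>2" by simp
        ultimately have "2 * r0 * ((y - xc s) \<bullet> n y) < 0" using i \<mu>(3) by linarith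
        then show ?thesis using r0 by (simp add: mult_less_0_iff)
      qed
      let ?l = "\<lambda>\<sigma>. y + \<sigma> *\<^sub>R n y"
      let ?q = "(y - xc s) \<bullet> (y - xc s)"
      have dq: "((\<lambda>\<sigma>. (?l \<sigma> - xc s) \<bullet> (?l \<sigma> - xc s)) has_real_derivative (2 * ((y - xc s) \<bullet> n y))) (at 0)"
        unfolding has_field_derivative_def
        by (auto intro!: derivative_eq_intros simp: inner_commute fun_eq_iff)
      have "(V has_real_derivative V1 ?q) (at ((?l 0 - xc s) \<bullet> (?l 0 - xc s)))" using Vd[of ?q] by simp
      from DERIV_chain2[OF this dq]
      have "((\<lambda>\<sigma>. w s (?l \<sigma>)) has_real_derivative V1 ?q * (2 * ((y - xc s) \<bullet> n y))) (at 0)"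
        by (simp add: w_def)
      then have "((\<lambda>\<sigma>. w s (?l \<sigma>)) has_real_derivative V1 ?q * (2 * ((y - xc s) \<bullet> n y))) (at 0 within {0..})"
        by (rule has_field_derivative_at_within)
      from DERIV_cmult[OF DERIV_diff[OF this normal_derivative_zero[OF q]], of "exp (- L * (s - T))" s]
      have D: "((\<lambda>\<sigma>. z s (?l \<sigma>)) has_real_derivative exp (- L * (s - T)) * (V1 ?q * (2 * ((y - xc s) \<bullet> n y)) - 0)) (at 0 within {0..})"
        by (simp add: z_def)
      have "0 < V1 ?q * (2 * ((y - xc s) \<bullet> n y))" using Vd[of ?q] inward by (intro mult_neg_neg) auto
      then have "0 < exp (- L * (s - T)) * (V1 ?q * (2 * ((y - xc s) \<bullet> n y)) - 0)" by simp
      then obtain d where d: "d > 0" "\<And>h. 0 < h \<Longrightarrow> h < d \<Longrightarrow> z s (?l 0) < z s (?l h)"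
        using has_real_derivative_pos_inc_right[OF D] by auto
      define h where "h = Min {d / 2, r0, R0 - dist (xc s) y}"
      have h: "0 < h" "h < d" "h \<le> r0" "h \<le> R0 - dist (xc s) y" using d r0 dR by (auto simp: h_def)
      have "?l h \<in> \<Omega>" using inward_inside(1)[OF q q] h r0 by simp
      moreover have "dist (xc s) (?l h) \<le> R0"
        using dist_triangle[of "xc s" "?l h" y] h norm_n[OF q] by (simp add: dist_norm)
      ultimately have "(s, ?l h) \<in> K" using s dom_closure by (intro inK) auto
      moreover have "z s y < z s (?l h)" using d(2)[OF h(1,2)] by simp
      ultimately show ?thesis by blast
    qed
  qed
  then have "w t x - u t x \<le> 0" by (simp add: z_def mult_le_0_iff)
  then show ?thesis by (simp add: w_def)
qed


section \<open>Tangent balls from local graphs\<close>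

lemma C2_graph_quadratic_bound:
  assumes C: "C2_holder_bounded \<alpha> K (ball 0 r) \<psi>" and \<psi>0: "\<psi> 0 = 0" and K: "0 < K" and r: "0 < r"
  obtains G where "\<And>y. norm y < r \<Longrightarrow> GDERIV \<psi> y :> G y" "continuous_on (ball 0 r) G"
    "\<And>y. norm y < r \<Longrightarrow> \<bar>\<psi> y - y \<bullet> G 0\<bar> \<le> K * (norm y)\<^sup>2"
proof -
  obtain G H where gh: "has_grad_hess \<psi> G H (ball 0 r)" and HK: "\<And>x. x \<in> ball 0 r \<Longrightarrow> norm (H x) \<le> K"
    using C unfolding C2_holder_bounded_def by blast
  have g: "GDERIV \<psi> y :> G y" if "norm y < r" for y
    using gh that unfolding has_grad_hess_def by auto
  have h: "(G has_derivative blinfun_apply (H y)) (at y)" if "norm y < r" for y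
    using gh that unfolding has_grad_hess_def by auto
  have Gl: "norm (G y - G 0) \<le> K * norm y" if y: "norm y < r" for y
  proof -
    have "norm (G y - G 0) \<le> K * norm (y - 0)"
    proof (rule differentiable_bound[of "ball 0 r" G "\<lambda>y. blinfun_apply (H y)"])
      show "(G has_derivative blinfun_apply (H x)) (at x within ball 0 r)" if "x \<in> ball 0 r" for x
        using h[of x] that by (auto intro: has_derivative_at_withinI)
      show "onorm (blinfun_apply (H x)) \<le> K" if "x \<in> ball 0 r" for x
        using HK[OF that] by (simp add: norm_blinfun.rep_eq)
    qed (use y r in auto)
    then show ?thesis by simp
  qed
  have q: "\<bar>\<psi> y - y \<bullet> G 0\<bar> \<le> K * (norm y)\<^sup>2" if y: "norm y < r" for y
  proof -
    have ins: "norm (s *\<^sub>R y) < r" if "0 \<le> s" "s \<le> 1" for s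
      using that y mult_left_le_one_le[of "norm y" s] by auto
    have d: "((\<lambda>s. \<psi> (s *\<^sub>R y)) has_derivative (\<lambda>a. (a *\<^sub>R y) \<bullet> G (s *\<^sub>R y))) (at s)" if s: "0 \<le> s" "s \<le> 1" for s
      by (rule has_derivative_compose[of "\<lambda>s. s *\<^sub>R y" "\<lambda>a. a *\<^sub>R y" s UNIV \<psi>])
         (use g[OF ins[OF s]] in \<open>auto simp: gderiv_def intro!: derivative_eq_intros\<close>)
    have "continuous_on {0..1} (\<lambda>s. \<psi> (s *\<^sub>R y))"
      by (intro continuous_at_imp_continuous_on ballI has_derivative_continuous[OF d]) auto
    from mvt[OF zero_less_one this d[OF less_imp_le less_imp_le]]
    obtain s where s: "0 < s" "s < 1" "\<psi> (1 *\<^sub>R y) - \<psi> (0 *\<^sub>R y) = ((1 - 0) *\<^sub>R y) \<bullet> G (s *\<^sub>R y)" by blast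
    have "\<psi> y - y \<bullet> G 0 = y \<bullet> (G (s *\<^sub>R y) - G 0)" using s(3) \<psi>0 by (simp add: inner_diff_right)
    also have "\<bar>\<dots>\<bar> \<le> norm y * norm (G (s *\<^sub>R y) - G 0)" by (rule Cauchy_Schwarz_ineq2)
    also have "\<dots> \<le> norm y * (K * norm y)"
    proof (rule mult_left_mono)
      have "norm (G (s *\<^sub>R y) - G 0) \<le> K * norm (s *\<^sub>R y)" by (rule Gl[OF ins]) (use s in auto)
      also have "\<dots> \<le> K * norm y" using s K mult_left_le_one_le[of "norm y" s] by (intro mult_left_mono) auto
      finally show "norm (G (s *\<^sub>R y) - G 0) \<le> K * norm y" .
    qed simp
    finally show ?thesis by (simp add: power2_eq_square mult_ac)
  qed
  have "continuous_on (ball 0 r) G"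
    by (intro continuous_at_imp_continuous_on ballI has_derivative_continuous[OF h]) auto
  then show ?thesis using that[of G] g q by blast
qed

text \<open>Below the graph of a function with second derivatives bounded by \<open>K\<close> there is room for a tangent
ball of radius \<open>1 / (2 K)\<close>, and likewise above it. The normal is read off from the defining function
\<open>\<psi>(y) - s\<close>.\<close>

lemma chart_two_sided_ball:
  fixes T :: "real \<times> (real^'n) \<Rightarrow> real \<times> (real^'n)"
  assumes p: "p \<in> frontier \<Omega>" and T: "orthogonal_transformation T"
    and C: "C2_holder_bounded \<alpha> K (ball 0 r) \<psi>" and \<psi>0: "\<psi> 0 = 0" and K: "0 < K" and r: "0 < r"
    and chart: "\<And>s y. \<bar>s\<bar> < r \<Longrightarrow> norm y < r \<Longrightarrow> p + T (s, y) \<in> \<Omega> \<longleftrightarrow> \<psi> y < s"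
    and \<rho>: "0 < \<rho>" "2 * \<rho> \<le> r" "2 * \<rho> * K \<le> 1"
  shows "\<exists>n. norm n = 1 \<and> ball (p + \<rho> *\<^sub>R n) \<rho> \<subseteq> \<Omega> \<and> ball (p - \<rho> *\<^sub>R n) \<rho> \<inter> \<Omega> = {} \<and> outward_unit_normal \<Omega> p (- n)"
proof -
  obtain G where G: "\<And>y. norm y < r \<Longrightarrow> GDERIV \<psi> y :> G y" "continuous_on (ball 0 r) G"
    and quad: "\<And>y. norm y < r \<Longrightarrow> \<bar>\<psi> y - y \<bullet> G 0\<bar> \<le> K * (norm y)\<^sup>2"
    using C2_graph_quadratic_bound[OF C \<psi>0 K r] by blast
  have lin: "linear T" and Tin: "\<And>v w. T v \<bullet> T w = v \<bullet> w" using T unfolding orthogonal_transformation_def by auto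
  have Tn: "norm (T v) = norm v" for v by (simp add: norm_eq_sqrt_inner Tin)
  define g where "g = G 0"
  define w where "w = sqrt (1 + g \<bullet> g)"
  have w: "1 \<le> w" "w\<^sup>2 = 1 + g \<bullet> g" by (auto simp: w_def)
  have w0: "0 < w" using w by simp
  define n where "n = (1 / w) *\<^sub>R T (1, - g)"
  have n1: "norm n = 1"
  proof -
    have "norm (1::real, - g) = w" by (simp add: norm_eq_sqrt_inner w_def inner_Pair)
    then show ?thesis using w0 by (simp add: n_def Tn)
  qed
  \<comment> \<open>Both balls at once: \<open>\<sigma> = 1\<close> is the inner one, \<open>\<sigma> = - 1\<close> the outer one.\<close>
  have key: "\<bar>s\<bar> < r \<and> norm y < r \<and> K * (norm y)\<^sup>2 < \<sigma> * (s - y \<bullet> g)"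
    if d: "norm (T (s, y) - (\<sigma> * \<rho>) *\<^sub>R n) < \<rho>" and \<sigma>: "\<sigma> = 1 \<or> \<sigma> = - 1" for s y and \<sigma> :: real
  proof -
    have sg: "\<sigma> * \<sigma> = 1" "\<bar>\<sigma>\<bar> = 1" using \<sigma> by auto
    have "norm (T (s, y)) \<le> norm (T (s, y) - (\<sigma> * \<rho>) *\<^sub>R n) + norm ((\<sigma> * \<rho>) *\<^sub>R n)"
      by (metis diff_add_cancel norm_triangle_ineq)
    also have "norm ((\<sigma> * \<rho>) *\<^sub>R n) = \<rho>" using n1 sg \<rho> by (simp add: abs_mult)
    finally have N: "norm (s, y) < r" using d \<rho> by (simp add: Tn)
    have sr: "\<bar>s\<bar> < r" using N norm_fst_le[of s y] by simp
    have yr: "norm y < r" using N norm_snd_le[of y s] by simp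
    have "T (s, y) \<bullet> n = (s - y \<bullet> g) / w" by (simp add: n_def Tin inner_Pair)
    then have "(norm (T (s, y) + (- (\<sigma> * \<rho>)) *\<^sub>R n))\<^sup>2 = (norm (s, y))\<^sup>2 - 2 * (\<sigma> * \<rho>) * ((s - y \<bullet> g) / w) + (\<sigma> * \<rho>)\<^sup>2"
      unfolding norm_add_scaleR_sq using n1 by (simp add: Tn)
    moreover have "(norm (T (s, y) + (- (\<sigma> * \<rho>)) *\<^sub>R n))\<^sup>2 < \<rho>\<^sup>2"
      using d by (intro power_strict_mono) auto
    moreover have "(\<sigma> * \<rho>)\<^sup>2 = \<rho>\<^sup>2" using sg by (simp add: power_mult_distrib power2_eq_square)
    moreover have "(norm (s, y))\<^sup>2 = s\<^sup>2 + (norm y)\<^sup>2" by (simp add: norm_Pair)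
    moreover have "2 * (\<sigma> * \<rho>) * ((s - y \<bullet> g) / w) = 2 * \<rho> * (\<sigma> * (s - y \<bullet> g)) / w" by simp
    ultimately have 1: "s\<^sup>2 + (norm y)\<^sup>2 < 2 * \<rho> * (\<sigma> * (s - y \<bullet> g)) / w" by linarith
    let ?D = "\<sigma> * (s - y \<bullet> g)"
    have "0 \<le> s\<^sup>2 + (norm y)\<^sup>2" by simp
    then have "0 < 2 * \<rho> * ?D / w" using 1 by linarith
    then have D: "0 < ?D" using w0 \<rho> by (simp add: zero_less_divide_iff zero_less_mult_iff)
    have "2 * \<rho> * ?D / w \<le> 2 * \<rho> * ?D / 1" using D w \<rho> by (intro divide_left_mono) auto
    moreover have "0 \<le> s\<^sup>2" by simp
    ultimately have "(norm y)\<^sup>2 < 2 * \<rho> * ?D" using 1 by linarith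
    then have "K * (norm y)\<^sup>2 < K * (2 * \<rho> * ?D)" using K by simp
    also have "\<dots> = (2 * \<rho> * K) * ?D" by simp
    also have "\<dots> \<le> 1 * ?D" using D \<rho> by (intro mult_right_mono) auto
    finally show ?thesis using sr yr by simp
  qed
  have surj: "\<exists>s y. x - p = T (s, y)" for x
    using orthogonal_transformation_surj[OF T] by (metis surj_def surj_pair)
  have inn: "ball (p + \<rho> *\<^sub>R n) \<rho> \<subseteq> \<Omega>"
  proof
    fix x assume x: "x \<in> ball (p + \<rho> *\<^sub>R n) \<rho>"
    obtain s y where sy: "x - p = T (s, y)" using surj by blast
    have "norm (T (s, y) - (1 * \<rho>) *\<^sub>R n) < \<rho>"
      using x by (simp add: sy[symmetric] dist_norm norm_minus_commute algebra_simps)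
    from key[OF this] have k: "\<bar>s\<bar> < r" "norm y < r" "K * (norm y)\<^sup>2 < s - y \<bullet> g" by auto
    have "\<psi> y < s" using quad[OF k(2)] k(3) unfolding g_def by linarith
    then have "p + T (s, y) \<in> \<Omega>" using chart[OF k(1,2)] by simp
    then show "x \<in> \<Omega>" by (simp add: sy[symmetric])
  qed
  have out: "x \<notin> \<Omega>" if x: "x \<in> ball (p - \<rho> *\<^sub>R n) \<rho>" for x
  proof -
    obtain s y where sy: "x - p = T (s, y)" using surj by blast
    have "norm (T (s, y) - (- 1 * \<rho>) *\<^sub>R n) < \<rho>"
      using x by (simp add: sy[symmetric] dist_norm norm_minus_commute algebra_simps)
    from key[OF this] have k: "\<bar>s\<bar> < r" "norm y < r" "K * (norm y)\<^sup>2 < - (s - y \<bullet> g)" by auto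
    have "\<not> \<psi> y < s" using quad[OF k(2)] k(3) unfolding g_def by linarith
    then have "p + T (s, y) \<notin> \<Omega>" using chart[OF k(1,2)] by simp
    then show ?thesis by (simp add: sy[symmetric])
  qed
  define S where "S = inv T"
  have TS: "T (S v) = v" for v unfolding S_def using orthogonal_transformation_surj[OF T] by (simp add: surj_f_inv_f)
  have OS: "orthogonal_transformation S" unfolding S_def by (rule orthogonal_transformation_inv[OF T])
  then have linS: "linear S" unfolding orthogonal_transformation_def by blast
  then have blS: "bounded_linear S" by (simp add: linear_conv_bounded_linear)
  have Sn: "norm (S v) = norm v" for v using Tn[of "S v"] TS[of v] by simp
  have Sin: "S v \<bullet> a = v \<bullet> T a" for v a using Tin[of "S v" a] TS[of v] by simp
  have snr: "norm (snd (S (x - p))) < r" "\<bar>fst (S (x - p))\<bar> < r" if "x \<in> ball p r" for x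
  proof -
    have "norm (S (x - p)) < r" using that by (simp add: Sn dist_norm norm_minus_commute)
    moreover have "norm (snd (S (x - p))) \<le> norm (S (x - p))" "norm (fst (S (x - p))) \<le> norm (S (x - p))"
      by (metis norm_snd_le prod.collapse) (metis norm_fst_le prod.collapse)
    ultimately show "norm (snd (S (x - p))) < r" "\<bar>fst (S (x - p))\<bar> < r" by auto
  qed
  define \<rho>f where "\<rho>f = (\<lambda>x. \<psi> (snd (S (x - p))) - fst (S (x - p)))"
  define Gf where "Gf = (\<lambda>x. T (- 1, G (snd (S (x - p)))))"
  have "outward_unit_normal \<Omega> p (- n)"
    unfolding outward_unit_normal_def
  proof (intro conjI p exI[of _ r] exI[of _ \<rho>f] exI[of _ Gf] r ballI)
    fix x assume x: "x \<in> ball p r"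
    have "((\<lambda>x. x - p) has_derivative (\<lambda>h. h)) (at x)" by (auto intro!: derivative_eq_intros)
    from bounded_linear.has_derivative[OF blS this]
    have dS: "((\<lambda>x. S (x - p)) has_derivative (\<lambda>h. S h)) (at x)" .
    have "((\<lambda>x. \<psi> (snd (S (x - p)))) has_derivative (\<lambda>h. snd (S h) \<bullet> G (snd (S (x - p))))) (at x)"
      by (rule has_derivative_compose[of "\<lambda>x. snd (S (x - p))" "\<lambda>h. snd (S h)" x UNIV \<psi>])
         (use G(1)[OF snr(1)[OF x]] dS in \<open>auto simp: gderiv_def intro!: has_derivative_snd\<close>)
    then have "(\<rho>f has_derivative (\<lambda>h. snd (S h) \<bullet> G (snd (S (x - p))) - fst (S h))) (at x)"
      unfolding \<rho>f_def by (intro has_derivative_diff has_derivative_fst dS)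
    moreover have "snd (S h) \<bullet> G (snd (S (x - p))) - fst (S h) = h \<bullet> Gf x" for h
      unfolding Gf_def Sin[symmetric] by (simp add: inner_prod_def)
    ultimately show "GDERIV \<rho>f x :> Gf x" by (simp add: gderiv_def)
  next
    have "bounded_linear T" using lin by (simp add: linear_conv_bounded_linear)
    have cS: "continuous_on (ball p r) (\<lambda>x. snd (S (x - p)))"
      by (intro continuous_on_snd bounded_linear.continuous_on[OF blS] continuous_intros)
    have "continuous_on (ball p r) (\<lambda>x. G (snd (S (x - p))))"
      by (rule continuous_on_compose2[OF G(2) cS]) (use snr in auto)
    then show "continuous_on (ball p r) Gf" unfolding Gf_def
      by (intro bounded_linear.continuous_on[OF \<open>bounded_linear T\<close>] continuous_intros)
  next
    have S0: "S 0 = 0" by (rule linear_0[OF linS])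
    have Gp: "Gf p = T (- 1, g)" by (simp add: Gf_def S0 g_def)
    have "norm (- 1::real, g) = w" by (simp add: norm_eq_sqrt_inner w_def inner_Pair)
    then have Gn: "norm (Gf p) = w" by (simp add: Gp Tn)
    then show "Gf p \<noteq> 0" using w0 by auto
    have "Gf p = - T (1, - g)" unfolding Gp using linear_neg[OF lin, of "(1, - g)"] by simp
    then show "- n = sgn (Gf p)" unfolding sgn_div_norm Gn by (simp add: n_def divide_inverse)
    show "\<Omega> \<inter> ball p r = {x \<in> ball p r. \<rho>f x < 0}"
    proof -
      have "x \<in> \<Omega> \<longleftrightarrow> \<rho>f x < 0" if x: "x \<in> ball p r" for x
        using chart[OF snr(2)[OF x] snr(1)[OF x]] TS[of "x - p"] by (simp add: \<rho>f_def)
      then show ?thesis by blast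
    qed
  qed
  then show ?thesis using n1 inn out by blast
qed

lemma admissible_two_sided_ball:
  fixes \<Omega> :: "(real \<times> (real^'n)) set"
  assumes "admissible_domain \<alpha> \<Omega> \<omega>"
  obtains n r0 where "two_sided_ball \<Omega> n r0" "\<And>q. q \<in> frontier \<Omega> \<Longrightarrow> outward_unit_normal \<Omega> q (- n q)"
proof -
  have op: "open \<Omega>" and un: "uniformly_C2_holder \<alpha> \<Omega>" using assms unfolding admissible_domain_def by auto
  obtain r K where r: "0 < r" and K: "0 < K" and ch: "\<And>p. p \<in> frontier \<Omega> \<Longrightarrow>
      \<exists>(T :: real \<times> (real^'n) \<Rightarrow> real \<times> (real^'n)) \<psi>. orthogonal_transformation T \<and>
        C2_holder_bounded \<alpha> K (ball 0 r) \<psi> \<and> \<psi> 0 = 0 \<and>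
        (\<forall>s y. \<bar>s\<bar> < r \<and> norm y < r \<longrightarrow> (p + T (s, y) \<in> \<Omega> \<longleftrightarrow> \<psi> y < s))"
    using un unfolding uniformly_C2_holder_def by blast
  define r0 where "r0 = min (r / 2) (1 / (2 * K))"
  have r0: "0 < r0" "2 * r0 \<le> r" using r K by (auto simp: r0_def)
  have "r0 \<le> 1 / (2 * K)" by (simp add: r0_def)
  then have rK: "2 * r0 * K \<le> 1" using K by (simp add: pos_le_divide_eq mult_ac)
  have "\<exists>n. norm n = 1 \<and> ball (p + r0 *\<^sub>R n) r0 \<subseteq> \<Omega> \<and> ball (p - r0 *\<^sub>R n) r0 \<inter> \<Omega> = {} \<and> outward_unit_normal \<Omega> p (- n)"
    if p: "p \<in> frontier \<Omega>" for p
  proof -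
    obtain T :: "real \<times> (real^'n) \<Rightarrow> real \<times> (real^'n)" and \<psi> where
      T: "orthogonal_transformation T" "C2_holder_bounded \<alpha> K (ball 0 r) \<psi>" "\<psi> 0 = 0"
        "\<forall>s y. \<bar>s\<bar> < r \<and> norm y < r \<longrightarrow> (p + T (s, y) \<in> \<Omega> \<longleftrightarrow> \<psi> y < s)"
      using ch[OF p] by blast
    show ?thesis by (rule chart_two_sided_ball[OF p T(1,2,3) K r _ r0 rK]) (use T(4) in blast)
  qed
  then obtain n where n: "\<And>p. p \<in> frontier \<Omega> \<Longrightarrow> norm (n p) = 1 \<and> ball (p + r0 *\<^sub>R n p) r0 \<subseteq> \<Omega> \<and>
      ball (p - r0 *\<^sub>R n p) r0 \<inter> \<Omega> = {} \<and> outward_unit_normal \<Omega> p (- n p)" by metis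
  show ?thesis
    by (rule that[of n r0]) (use n op r0 in \<open>auto simp: two_sided_ball_def\<close>)
qed

section \<open>Propagation along the axis\<close>

theorem theorem1p10:
  fixes f :: "real \<Rightarrow> real" and \<theta> :: real
  assumes "bistable f \<theta>"
  shows "\<exists>R0>0. \<forall>\<alpha> (\<Omega> :: (real \<times> (real^'n)) set) \<omega> \<phi> c u R.
           0 < \<alpha> \<and> \<alpha> < 1 \<and> admissible_domain \<alpha> \<Omega> \<omega> \<and>
           travelling_front f \<theta> \<phi> c \<and> entire_solution_from_front f \<phi> c \<Omega> u \<and>
           R > R0 \<and> UNIV \<times> ball 0 R \<subseteq> \<Omega> \<longrightarrow>
           (\<exists>u_inf. tendsto_C2_loc \<Omega> u u_inf \<and> stationary_solution f \<Omega> u_inf \<and>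
                    0 < (INF x\<in>UNIV \<times> ball 0 R. u_inf x))"
proof (cases "\<exists>\<phi> c. travelling_front f \<theta> \<phi> c")
  case False
  then show ?thesis by (intro exI[of _ 1]) auto
next
  case True
  \<comment> \<open>The radius is that of the subsolution made from one chosen front, so it depends on \<open>f\<close> and on the
    dimension alone.\<close>
  then obtain \<phi>0 c0 where tf0: "travelling_front f \<theta> \<phi>0 c0" by blast
  obtain R0 \<epsilon> \<eta> :: real and V V1 :: "real \<Rightarrow> real" where R0: "0 < R0" and \<epsilon>: "0 < \<epsilon>" and \<eta>: "0 < \<eta>" "\<eta> < 1"
    and Vle: "\<And>q. 0 \<le> q \<Longrightarrow> V q \<le> 1 - \<eta>" and VR: "V (R0\<^sup>2) = 0"
    and Vdec: "\<And>q r. 0 \<le> q \<Longrightarrow> q < r \<Longrightarrow> V r < V q"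
    and Vd: "\<And>q. 0 \<le> q \<Longrightarrow> (V has_real_derivative V1 q) (at q) \<and> V1 q < 0"
    and heatV: "\<And>(x0::real \<times> (real^'n)) e T t x. norm e = 1 \<Longrightarrow> 0 \<le> V ((x - (x0 + (\<epsilon> * (t - T)) *\<^sub>R e)) \<bullet> (x - (x0 + (\<epsilon> * (t - T)) *\<^sub>R e))) \<Longrightarrow>
       \<exists>s. heat_at (\<lambda>t x. V ((x - (x0 + (\<epsilon> * (t - T)) *\<^sub>R e)) \<bullet> (x - (x0 + (\<epsilon> * (t - T)) *\<^sub>R e)))) t x s \<and>
         s < f (V ((x - (x0 + (\<epsilon> * (t - T)) *\<^sub>R e)) \<bullet> (x - (x0 + (\<epsilon> * (t - T)) *\<^sub>R e))))"
    by (rule moving_subsolution[OF assms tf0, where 'a = "real \<times> (real^'n)"]) blast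
  obtain L where L: "0 < L"
    "\<And>a b. a \<in> {0..1} \<Longrightarrow> b \<in> {0..1} \<Longrightarrow> \<bar>f a - f b\<bar> \<le> L * \<bar>a - b\<bar>"
    "\<And>a b c d. a \<in> {0..1} \<Longrightarrow> b \<in> {0..1} \<Longrightarrow> c \<in> {0..1} \<Longrightarrow> d \<in> {0..1} \<Longrightarrow>
        \<bar>f a - f b - (f c - f d)\<bar> \<le> L * \<bar>a - b - (c - d)\<bar> + L * (\<bar>c - d\<bar> + \<bar>a - b\<bar>) * \<bar>b - d\<bar>"
    using bistable_derivative_properties[OF assms] by blast
  have f0: "f 0 = 0" using assms unfolding bistable_def by blast
  have "\<exists>u_inf. tendsto_C2_loc \<Omega> u u_inf \<and> stationary_solution f \<Omega> u_inf \<and> 0 < (INF x\<in>UNIV \<times> ball 0 R. u_inf x)"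
    if adm: "admissible_domain \<alpha> \<Omega> \<omega>" and tf: "travelling_front f \<theta> \<phi> c"
      and ent: "entire_solution_from_front f \<phi> c \<Omega> u" and R: "R0 < R" and cyl: "UNIV \<times> ball 0 R \<subseteq> \<Omega>"
    for \<alpha> and \<Omega> :: "(real \<times> (real^'n)) set" and \<omega> \<phi> c u R
  proof -
    have c: "0 < c" and bot: "(\<phi> \<longlongrightarrow> 1) at_bot" using tf unfolding travelling_front_def by auto
    obtain n r0 where tsb: "two_sided_ball \<Omega> n r0" and oun: "\<And>q. q \<in> frontier \<Omega> \<Longrightarrow> outward_unit_normal \<Omega> q (- n q)"
      using admissible_two_sided_ball[OF adm] by blast
    have lim: "uniform_limit (closure \<Omega>) (\<lambda>t x. u t x - \<phi> (fst x - c * t)) (\<lambda>_. 0) at_bot"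
      and ns: "neumann_solution f \<Omega> u" using ent unfolding entire_solution_from_front_def by auto
    have "\<exists>u_t G H. continuous_on (UNIV \<times> closure \<Omega>) (\<lambda>(t, x). u t x) \<and>
        continuous_on (UNIV \<times> closure \<Omega>) (\<lambda>(t, x). G t x) \<and>
        continuous_on (UNIV \<times> \<Omega>) (\<lambda>(t, x). u_t t x) \<and>
        continuous_on (UNIV \<times> \<Omega>) (\<lambda>(t, x). H t x) \<and>
        (\<forall>t. \<forall>x\<in>\<Omega>. ((\<lambda>\<tau>. u \<tau> x) has_real_derivative u_t t x) (at t)) \<and>
        (\<forall>t. has_grad_hess (u t) (G t) (H t) \<Omega>) \<and>
        (\<forall>t. \<forall>x\<in>\<Omega>. u_t t x - trace_of (H t x) = f (u t x)) \<and>
        (\<forall>t p \<nu>. outward_unit_normal \<Omega> p \<nu> \<longrightarrow> G t p \<bullet> \<nu> = 0)"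
      using ns unfolding neumann_solution_def by (rule conjunct2)
    then obtain u_t G H where sol:
        "continuous_on (UNIV \<times> closure \<Omega>) (\<lambda>(t, x). u t x)"
        "continuous_on (UNIV \<times> closure \<Omega>) (\<lambda>(t, x). G t x)"
        "continuous_on (UNIV \<times> \<Omega>) (\<lambda>(t, x). H t x)"
        "\<forall>t. \<forall>x\<in>\<Omega>. ((\<lambda>\<tau>. u \<tau> x) has_real_derivative u_t t x) (at t)"
        "\<forall>t. has_grad_hess (u t) (G t) (H t) \<Omega>"
        "\<forall>t. \<forall>x\<in>\<Omega>. u_t t x - trace_of (H t x) = f (u t x)"
        "\<forall>t p \<nu>. outward_unit_normal \<Omega> p \<nu> \<longrightarrow> G t p \<bullet> \<nu> = 0"
      by (elim exE conjE)
    have u01: "u t x \<in> {0..1}" if "x \<in> closure \<Omega>" for t x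
      using ns that unfolding neumann_solution_def by auto
    interpret two_sided_ball \<Omega> n r0 by (rule tsb)
    interpret neumann_flow \<Omega> n r0 f L u u_t G H
    proof
      fix t q assume "q \<in> frontier \<Omega>"
      then have "G t q \<bullet> - n q = 0" using sol(7) oun by blast
      then show "G t q \<bullet> n q = 0" by simp
    qed (use L f0 u01 sol in blast)+
    have mono: "u s x \<le> u t x" if "s \<le> t" "x \<in> closure \<Omega>" for s t x
      by (rule increasing_in_time[OF assms tf lim that])
    obtain v Gv Hv where uv: "\<And>x. x \<in> closure \<Omega> \<Longrightarrow> ((\<lambda>t. u t x) \<longlongrightarrow> v x) at_top"
      and GGv: "\<And>x. x \<in> closure \<Omega> \<Longrightarrow> ((\<lambda>t. G t x) \<longlongrightarrow> Gv x) at_top"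
      and gh: "has_grad_hess v Gv Hv \<Omega>" and cv: "continuous_on (closure \<Omega>) v" "continuous_on (closure \<Omega>) Gv" "continuous_on \<Omega> Hv"
      and unif: "\<And>C. compact C \<Longrightarrow> C \<subseteq> \<Omega> \<Longrightarrow> uniform_limit C u v at_top \<and> uniform_limit C G Gv at_top \<and> uniform_limit C H Hv at_top"
      and eqv: "\<And>x. x \<in> \<Omega> \<Longrightarrow> trace_of (Hv x) + f (v x) = 0"
      using long_time_limit[OF mono] by blast
    have cH: "continuous_on \<Omega> (H t)" for t
      by (rule continuous_on_compose2[OF sol(3), of _ "\<lambda>x. (t, x)", simplified]) (auto intro!: continuous_intros)
    have 1: "tendsto_C2_loc \<Omega> u v"
      unfolding tendsto_C2_loc_def
      by (rule exI[of _ G], rule exI[of _ H], rule exI[of _ Gv], rule exI[of _ Hv])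
         (use sol(5) cH gh cv(3) unif in blast)
    have uv_le: "u t x \<le> v x" if x: "x \<in> closure \<Omega>" for t x
    proof (rule tendsto_lowerbound[OF uv[OF x]])
      show "\<forall>\<^sub>F s in at_top. u t x \<le> u s x"
        unfolding eventually_at_top_linorder using mono x by blast
    qed simp
    have v01: "0 \<le> v x \<and> v x \<le> 1" if x: "x \<in> closure \<Omega>" for x
    proof
      show "0 \<le> v x" using uv_le[OF x, of 0] u01[OF x, of 0] by simp
      show "v x \<le> 1" by (rule tendsto_upperbound[OF uv[OF x]]) (use u01[OF x] in auto)
    qed
    have nv: "Gv p \<bullet> \<nu> = 0" if o: "outward_unit_normal \<Omega> p \<nu>" for p \<nu>
    proof -
      have "p \<in> closure \<Omega>" using o unfolding outward_unit_normal_def frontier_def by blast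
      then have "((\<lambda>t. G t p \<bullet> \<nu>) \<longlongrightarrow> Gv p \<bullet> \<nu>) at_top" by (intro tendsto_inner GGv tendsto_const)
      then have "((\<lambda>t::real. 0::real) \<longlongrightarrow> Gv p \<bullet> \<nu>) at_top" using sol(7) o by simp
      then show ?thesis by (simp add: tendsto_const_iff)
    qed
    have 2: "stationary_solution f \<Omega> v"
      unfolding stationary_solution_def neumann_solution_def
    proof (intro conjI)
      have cc: "continuous_on (UNIV \<times> S) (\<lambda>(t::real, x). g x)" if "continuous_on S g" for S and g :: "real \<times> (real^'n) \<Rightarrow> 'z::topological_space"
        unfolding case_prod_beta by (rule continuous_on_compose2[OF that]) (auto intro!: continuous_intros)
      show "\<exists>u_t G H. continuous_on (UNIV \<times> closure \<Omega>) (\<lambda>(t::real, x). v x) \<and>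
          continuous_on (UNIV \<times> closure \<Omega>) (\<lambda>(t::real, x). G t x) \<and>
          continuous_on (UNIV \<times> \<Omega>) (\<lambda>(t, x). u_t t x) \<and>
          continuous_on (UNIV \<times> \<Omega>) (\<lambda>(t::real, x). H t x) \<and>
          (\<forall>t. \<forall>x\<in>\<Omega>. ((\<lambda>\<tau>. v x) has_real_derivative u_t t x) (at t)) \<and>
          (\<forall>t. has_grad_hess v (G t) (H t) \<Omega>) \<and>
          (\<forall>t. \<forall>x\<in>\<Omega>. u_t t x - trace_of (H t x) = f (v x)) \<and>
          (\<forall>t p \<nu>. outward_unit_normal \<Omega> p \<nu> \<longrightarrow> G t p \<bullet> \<nu> = 0)"
      proof (rule exI[of _ "\<lambda>_ _. 0"], rule exI[of _ "\<lambda>_. Gv"], rule exI[of _ "\<lambda>_. Hv"], intro conjI allI ballI impI)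
        show "0 - trace_of (Hv x) = f (v x)" if "x \<in> \<Omega>" for x using eqv[OF that] by simp
      qed (use cc cv gh nv in \<open>auto intro!: continuous_intros\<close>)
    qed (use v01 in auto)
    \<comment> \<open>The width by which the ball of radius \<open>R0\<close> may stick out of the cylinder.\<close>
    define \<mu> where "\<mu> = r0 * R0 / (2 * (r0 + R0))"
    have \<mu>: "0 < \<mu>" "\<mu> < R0" "\<mu> * (2 * R0) < 2 * r0 * (R0 - \<mu>)"
    proof -
      show m0: "0 < \<mu>" using r0 R0 by (simp add: \<mu>_def)
      have "2 * (a / (2 * b) * b) = a" if "0 < b" for a b :: real using that by simp
      from this[of "r0 + R0" "r0 * R0"] r0 R0
      have e: "2 * (\<mu> * (r0 + R0)) = r0 * R0" unfolding \<mu>_def by linarith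
      have "0 < \<mu> * (r0 + R0)" using m0 r0 R0 by simp
      then have lt: "\<mu> * (r0 + R0) < r0 * R0" using e by linarith
      then show "\<mu> * (2 * R0) < 2 * r0 * (R0 - \<mu>)" by (simp add: algebra_simps)
      have "r0 * R0 < (r0 + R0) * R0" using R0 by (simp add: algebra_simps)
      then have "\<mu> * (r0 + R0) < R0 * (r0 + R0)" using lt by (simp add: mult.commute)
      then show "\<mu> < R0" using r0 R0 by simp
    qed
    define m0 where "m0 = V ((R0 - \<mu>)\<^sup>2)"
    have "(R0 - \<mu>)\<^sup>2 < R0\<^sup>2" using \<mu> by (intro power_strict_mono) auto
    then have m0: "0 < m0" using Vdec[of "(R0 - \<mu>)\<^sup>2" "R0\<^sup>2"] VR by (simp add: m0_def)
    have "m0 \<le> v x" if x: "x \<in> UNIV \<times> ball 0 R" for x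
    proof -
      obtain a x' where ax: "x = (a, x')" by force
      have x': "norm x' < R" using x ax by simp
      have xc: "x \<in> closure \<Omega>" using x cyl dom_closure by blast
      \<comment> \<open>\<open>y\<close> is the axis of a thinner cylinder of radius \<open>R0 - \<mu>\<close> inside the given one that reaches \<open>x'\<close>.\<close>
      define y where "y = ((R - (R0 - \<mu>)) / R) *\<^sub>R x'"
      have Rp: "0 < R" using R R0 by simp
      have yn: "norm y \<le> R - (R0 - \<mu>)"
      proof -
        have "norm y = (R - (R0 - \<mu>)) / R * norm x'" using Rp R \<mu> by (simp add: y_def)
        also have "\<dots> \<le> (R - (R0 - \<mu>)) / R * R" using x' Rp R \<mu> by (intro mult_left_mono) auto
        finally show ?thesis using Rp by simp
      qed
      have xy: "norm (x' - y) \<le> R0 - \<mu>"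
      proof -
        have "x' - y = (1 - (R - (R0 - \<mu>)) / R) *\<^sub>R x'" by (simp add: y_def scaleR_diff_left)
        also have "1 - (R - (R0 - \<mu>)) / R = (R0 - \<mu>) / R" using Rp by (simp add: field_simps)
        finally have "norm (x' - y) = (R0 - \<mu>) / R * norm x'" using Rp \<mu> by simp
        also have "\<dots> \<le> (R0 - \<mu>) / R * R" using x' Rp \<mu> by (intro mult_left_mono) auto
        finally show ?thesis using Rp by simp
      qed
      have "\<forall>\<^sub>F z in at_bot. 1 - \<eta> / 2 < \<phi> z" using order_tendstoD(1)[OF bot, of "1 - \<eta> / 2"] \<eta> by simp
      then obtain A where A: "\<And>z. z \<le> A \<Longrightarrow> 1 - \<eta> / 2 < \<phi> z" unfolding eventually_at_bot_linorder by blast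
      have "\<forall>\<^sub>F t in at_bot. \<forall>x\<in>closure \<Omega>. dist (u t x - \<phi> (fst x - c * t)) 0 < \<eta> / 2"
        using lim[unfolded uniform_limit_iff, rule_format, of "\<eta> / 2"] \<eta>(1) by simp
      then obtain T1 where T1: "\<And>t x. t \<le> T1 \<Longrightarrow> x \<in> closure \<Omega> \<Longrightarrow> \<bar>u t x - \<phi> (fst x - c * t)\<bar> < \<eta> / 2"
        unfolding eventually_at_bot_linorder by (auto simp: dist_real_def)
      \<comment> \<open>So early that \<open>u\<close> is close to the front, and that a ball behind the front has its centre \<open>(X, y)\<close> to
        the left of \<open>a\<close>; the moving centre then passes over \<open>a\<close> at the later time \<open>ts\<close>.\<close>
      define T where "T = min T1 ((a - A + R0) / c)"
      define X where "X = c * T + A - R0"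
      have "c * T \<le> c * ((a - A + R0) / c)" using c by (intro mult_left_mono) (auto simp: T_def)
      then have Xa: "X \<le> a" using c by (simp add: X_def)
      define ts where "ts = T + (a - X) / \<epsilon>"
      have ts: "T \<le> ts" using Xa \<epsilon> by (simp add: ts_def)
      let ?e = "(1, 0) :: real \<times> (real^'n)"
      have e1: "norm ?e = 1" by (simp add: norm_Pair)
      let ?xc = "\<lambda>t. (X, y) + (\<epsilon> * (t - T)) *\<^sub>R ?e"
      have xcts: "?xc ts = (a, y)" using \<epsilon> by (simp add: ts_def)
      have "V ((x - ?xc ts) \<bullet> (x - ?xc ts)) \<le> u ts x"
      proof (rule moving_subsolution_below[OF R0 \<epsilon> \<eta>(1) Vle VR Vdec Vd heatV[OF e1] e1 \<mu>])
        fix t assume "T \<le> t"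
        show "ball (?xc t) (R0 - \<mu>) \<subseteq> \<Omega>"
        proof
          fix z assume "z \<in> ball (?xc t) (R0 - \<mu>)"
          moreover have "dist (snd (?xc t)) (snd z) \<le> dist (?xc t) z" by (rule dist_snd_le)
          ultimately have "norm (snd z) < R"
            using yn norm_triangle_sub[of "snd z" y] by (simp add: dist_norm norm_minus_commute)
          then have "z \<in> UNIV \<times> ball 0 R" by (simp add: mem_Times_iff)
          then show "z \<in> \<Omega>" using cyl by blast
        qed
      next
        fix z assume z: "z \<in> closure \<Omega>" "dist (?xc T) z \<le> R0"
        have "dist (fst (?xc T)) (fst z) \<le> dist (?xc T) z" by (rule dist_fst_le)
        then have "fst z \<le> X + R0" using z(2) by (simp add: dist_real_def)
        then have "fst z - c * T \<le> A" by (simp add: X_def)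
        then have "1 - \<eta> / 2 < \<phi> (fst z - c * T)" by (rule A)
        moreover have "\<bar>u T z - \<phi> (fst z - c * T)\<bar> < \<eta> / 2" by (rule T1[OF _ z(1)]) (simp add: T_def)
        ultimately show "1 - \<eta> \<le> u T z" by linarith
      next
        have "dist (a, y) x = norm (x' - y)" by (simp add: ax dist_norm norm_Pair norm_minus_commute)
        then show "dist (?xc ts) x \<le> R0" unfolding xcts using xy \<mu> by simp
      qed (use ts xc in auto)
      moreover have "(x - ?xc ts) \<bullet> (x - ?xc ts) = (norm (x' - y))\<^sup>2"
        unfolding xcts by (simp add: ax inner_Pair power2_norm_eq_inner)
      ultimately have "V ((norm (x' - y))\<^sup>2) \<le> u ts x" by (simp only:)
      moreover have "m0 \<le> V ((norm (x' - y))\<^sup>2)"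
      proof -
        have "(norm (x' - y))\<^sup>2 \<le> (R0 - \<mu>)\<^sup>2" using xy by (intro power_mono) auto
        then show ?thesis unfolding m0_def using Vdec[of "(norm (x' - y))\<^sup>2" "(R0 - \<mu>)\<^sup>2"]
          by (cases "(norm (x' - y))\<^sup>2 = (R0 - \<mu>)\<^sup>2") auto
      qed
      ultimately show ?thesis using uv_le[OF xc, of ts] by linarith
    qed
    moreover have "UNIV \<times> ball (0::real^'n) R \<noteq> {}" using R R0 by simp
    ultimately have "m0 \<le> (INF x\<in>UNIV \<times> ball 0 R. v x)" by (intro cINF_greatest) auto
    then have 3: "0 < (INF x\<in>UNIV \<times> ball 0 R. v x)" using m0 by linarith
    show ?thesis using 1 2 3 by blast
  qed
  then show ?thesis using R0 by blast
qed

end
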